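(* Let $\Omega\subset\mathbb{R}^n$ be a bounded Lipschitz domain, $1<p<q<\infty$, $\varkappa>0$, and let $a:\Omega\to[0,\infty)$ satisfy $a\in\mathcal{Z}^\varkappa(\Omega)$. Let $G:\Omega\times\mathbb{R}\times\mathbb{R}^n\to\mathbb{R}$ be measurable in the first variable and continuous with respect to the second and third variables, and suppose there are constants $0<\nu<1<L$ and a nonnegative $\Lambda\in L^1(\Omega)$ such that $$\nu\left(|\xi|^p+a(x)|\xi|^q\right)\le G(x,z,\xi)\le L\left(|\xi|^p+a(x)|\xi|^q+\Lambda(x)\right)\quad\text{for all }x\in\Omega,\ z\in\mathbb{R},\ \xi\in\mathbb{R}^n.$$ Set $\mathcal{G}[u]=\int_\Omega G(x,u(x),\nabla u(x))\,dx$ and $W(\Omega)=\{\varphi\in W^{1,1}_0(\Omega):\int_\Omega|\nabla\varphi|^p+a(x)|\nabla\varphi|^q\,dx<\infty\}$. Let $u_0\in W^{1,1}(\Omega)$ satisfy $\mathcal{G}[u_0]<\infty$. Then the following hold. (i) If $\varkappa\ge q-p$, then $$\inf_{v\in u_0+W(\Omega)}\mathcal{G}[v]=\inf_{w\in u_0+C_c^\infty(\Omega)}\mathcal{G}[w].$$ (ii) Let $\gamma\in(0,1]$. If $\varkappa\ge(q-p)(1-\gamma)$, then $$\inf_{v\in u_0+W(\Omega)\cap C^{0,\gamma}(\Omega)}\mathcal{G}[v]=\inf_{w\in u_0+C_c^\infty(\Omega)}\mathcal{G}[w].$$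
   Context: For $\varkappa\in(0,\infty)$, the class $\mathcal{Z}^\varkappa(\Omega)$ consists of all (Lebesgue measurable) functions $a:\Omega\to[0,\infty)$ for which there is a constant $C>0$ such that $a(x)\le C\,(a(y)+|x-y|^\varkappa)$ for all $x,y\in\Omega$. $C^{0,\gamma}(\Omega)$ is the space of functions $f$ on $\Omega$ with $\sup_{x\ne y\in\Omega}|f(x)-f(y)|/|x-y|^\gamma<\infty$. The set $u_0+W(\Omega)\cap C^{0,\gamma}(\Omega)$ means $\{u_0+\varphi:\varphi\in W(\Omega)\cap C^{0,\gamma}(\Omega)\}$. Continuity of $G$ in the second and third variables means that for each $x$ the map $(z,\xi)\mapsto G(x,z,\xi)$ is continuous. *)

theory Defs
  imports "HOL-Analysis.Analysis"
begin

text \<open>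
  A function on an open set \<open>\<Omega>\<close> is represented by a total function on the ambient space whose
  values outside \<open>\<Omega>\<close> are irrelevant. Elements of Lebesgue and Sobolev spaces are represented
  by functions rather than by classes modulo null sets.
\<close>

text \<open>
  Near every boundary point, \<open>\<Omega>\<close> is the strict epigraph of a Lipschitz function over
  the hyperplane orthogonal to some unit vector \<open>e\<close>; \<open>x \<bullet> e\<close> and \<open>x - (x \<bullet> e) *\<^sub>R e\<close> are
  the vertical and horizontal coordinates of \<open>x\<close>.
\<close>

definition lipschitz_domain :: "'a::euclidean_space set \<Rightarrow> bool" where
  "lipschitz_domain \<Omega> \<longleftrightarrow> open \<Omega> \<and> connected \<Omega> \<and> \<Omega> \<noteq> {} \<and>
     (\<forall>z\<in>frontier \<Omega>. \<exists>r>0. \<exists>e \<psi> M. norm e = 1 \<and> M-lipschitz_on {y. y \<bullet> e = 0} \<psi> \<and>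
        \<Omega> \<inter> ball z r = {x \<in> ball z r. \<psi> (x - (x \<bullet> e) *\<^sub>R e) < x \<bullet> e})"

primrec Ck_fun :: "nat \<Rightarrow> ('a::euclidean_space \<Rightarrow> real) \<Rightarrow> bool" where
  "Ck_fun 0 f \<longleftrightarrow> continuous_on UNIV f"
| "Ck_fun (Suc k) f \<longleftrightarrow> (\<forall>x. f differentiable (at x)) \<and>
     (\<forall>b\<in>Basis. Ck_fun k (\<lambda>x. frechet_derivative f (at x) b))"

text \<open>Functions in \<open>C\<^sub>c\<^sup>\<infinity>(\<Omega>)\<close> are extended by zero to the whole space.\<close>

definition Cc_infinity :: "'a::euclidean_space set \<Rightarrow> ('a \<Rightarrow> real) set" where
  "Cc_infinity \<Omega> = {\<phi>. (\<forall>k. Ck_fun k \<phi>) \<and>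
     compact (closure {x. \<phi> x \<noteq> 0}) \<and> closure {x. \<phi> x \<noteq> 0} \<subseteq> \<Omega>}"

definition locally_integrable_on ::
    "('a::euclidean_space \<Rightarrow> 'b::euclidean_space) \<Rightarrow> 'a set \<Rightarrow> bool"
    (infixr \<open>locally'_integrable'_on\<close> 46) where
  "f locally_integrable_on \<Omega> \<longleftrightarrow>
     (\<forall>K. compact K \<and> K \<subseteq> \<Omega> \<longrightarrow> f absolutely_integrable_on K)"

definition is_weak_gradient ::
    "'a::euclidean_space set \<Rightarrow> ('a \<Rightarrow> real) \<Rightarrow> ('a \<Rightarrow> 'a) \<Rightarrow> bool" where
  "is_weak_gradient \<Omega> u g \<longleftrightarrow>
     u locally_integrable_on \<Omega> \<and> g locally_integrable_on \<Omega> \<and>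
     (\<forall>\<phi>\<in>Cc_infinity \<Omega>. \<forall>b\<in>Basis.
        (LINT x:\<Omega>|lebesgue. u x * frechet_derivative \<phi> (at x) b) =
        - (LINT x:\<Omega>|lebesgue. (g x \<bullet> b) * \<phi> x))"

text \<open>
  A weak gradient is unique up to null sets, and every use below is inside an integral over
  \<open>\<Omega>\<close>, so the chosen representative does not matter. The value is meaningful only if
  some weak gradient exists, in particular on \<open>W\<^sup>1\<^sup>,\<^sup>1(\<Omega>)\<close>.
\<close>

definition weak_gradient ::
    "'a::euclidean_space set \<Rightarrow> ('a \<Rightarrow> real) \<Rightarrow> ('a \<Rightarrow> 'a)" where
  "weak_gradient \<Omega> u = (SOME g. is_weak_gradient \<Omega> u g)"

definition W11 :: "'a::euclidean_space set \<Rightarrow> ('a \<Rightarrow> real) set" where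
  "W11 \<Omega> = {u. u absolutely_integrable_on \<Omega> \<and>
     (\<exists>g. is_weak_gradient \<Omega> u g \<and> g absolutely_integrable_on \<Omega>)}"

definition W11_norm :: "'a::euclidean_space set \<Rightarrow> ('a \<Rightarrow> real) \<Rightarrow> real" where
  "W11_norm \<Omega> u = (LINT x:\<Omega>|lebesgue. \<bar>u x\<bar>) + (LINT x:\<Omega>|lebesgue. norm (weak_gradient \<Omega> u x))"

definition W11_0 :: "'a::euclidean_space set \<Rightarrow> ('a \<Rightarrow> real) set" where
  "W11_0 \<Omega> = {u \<in> W11 \<Omega>. \<exists>\<phi>. (\<forall>k::nat. \<phi> k \<in> Cc_infinity \<Omega>) \<and>
     (\<lambda>k. W11_norm \<Omega> (\<lambda>x. u x - \<phi> k x)) \<longlonglongrightarrow> 0}"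

definition holder_space :: "real \<Rightarrow> 'a::euclidean_space set \<Rightarrow> ('a \<Rightarrow> real) set" where
  "holder_space \<gamma> \<Omega> =
     {f. bdd_above {\<bar>f x - f y\<bar> / norm (x - y) powr \<gamma> | x y. x \<in> \<Omega> \<and> y \<in> \<Omega> \<and> x \<noteq> y}}"

definition Z_class :: "real \<Rightarrow> 'a::euclidean_space set \<Rightarrow> ('a \<Rightarrow> real) set" where
  "Z_class \<kappa> \<Omega> = {a. a \<in> borel_measurable (lebesgue_on \<Omega>) \<and> (\<forall>x\<in>\<Omega>. 0 \<le> a x) \<and>
     (\<exists>C>0. \<forall>x\<in>\<Omega>. \<forall>y\<in>\<Omega>. a x \<le> C * (a y + norm (x - y) powr \<kappa>))}"

definition double_phase_W ::
    "real \<Rightarrow> real \<Rightarrow> ('a \<Rightarrow> real) \<Rightarrow> 'a::euclidean_space set \<Rightarrow> ('a \<Rightarrow> real) set" where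
  "double_phase_W p q a \<Omega> = {\<phi> \<in> W11_0 \<Omega>.
     (\<integral>\<^sup>+x\<in>\<Omega>. ennreal (norm (weak_gradient \<Omega> \<phi> x) powr p +
                     a x * norm (weak_gradient \<Omega> \<phi> x) powr q) \<partial>lebesgue) < \<infinity>}"

text \<open>
  The energy of a nonnegative integrand, with values in \<open>[0,\<infinity>]\<close>. Since \<open>ennreal\<close> truncates
  negative numbers to zero, it is only meaningful for \<open>G \<ge> 0\<close>.
\<close>

definition energy ::
    "('a \<Rightarrow> real \<Rightarrow> 'a \<Rightarrow> real) \<Rightarrow> 'a::euclidean_space set \<Rightarrow> ('a \<Rightarrow> real) \<Rightarrow> ennreal" where
  "energy G \<Omega> u = (\<integral>\<^sup>+x\<in>\<Omega>. ennreal (G x (u x) (weak_gradient \<Omega> u x)) \<partial>lebesgue)"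

definition translate_set :: "('a \<Rightarrow> real) \<Rightarrow> ('a \<Rightarrow> real) set \<Rightarrow> ('a \<Rightarrow> real) set" where
  "translate_set u S = {\<lambda>x. u x + \<phi> x | \<phi>. \<phi> \<in> S}"

end

theory Submission
  imports Defs
begin

text \<open>
  Both parts are instances \<open>\<gamma> \<in> [0, 1]\<close> of one statement: part (i) is the case \<open>\<gamma> = 0\<close>, because
  \<open>\<phi> \<in> W(\<Omega>)\<close> can first be replaced
      by the bounded functions \<open>k arctan(\<phi>/k)\<close>.
  The zero extension of \<open>\<phi>\<close> is a Sobolev function on the whole space, and in part (ii) it is
  Hoelder continuous, since a Hoelder function in \<open>W\<^sub>0\<^sup>1\<^sup>,\<^sup>1\<close> of a Lipschitz domain vanishes on the
  boundary. It is mollified at scale \<open>s = \<epsilon> \<delta>\<close> and composed with \<open>T x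
      = x + \<delta> h x\<close>, where \<open>h\<close> is a
  smooth field pointing out of \<open>\<Omega>\<close>; this yields functions \<open>\<phi>\<^sub>s \<in> C\<^sub>c\<^sup>\<infinity>(\<Omega>)\<close>.

  The Hoelder bound gives \<open>\<bar>\<nabla>\<phi>\<^sub>s\<bar>
      \<le> C s\<^sup>\<gamma>\<^sup>-\<^sup>1\<close>. On a ball of radius comparable to \<open>s\<close> the weight \<open>a\<close> exceeds
  a constant multiple of its infimum by at most \<open>C s\<^sup>\<kappa>\<close>,
      and \<open>s\<^sup>\<kappa> \<bar>\<nabla>\<phi>\<^sub>s\<bar>\<^sup>q
          \<le> C \<bar>\<nabla>\<phi>\<^sub>s\<bar>\<^sup>p\<close> because
  \<open>\<kappa> \<ge> (q - p) (1 - \<gamma>)\<close>. With the weight replaced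
      by a constant, Jensen's inequality bounds
  \<open>\<bar>\<nabla>\<phi>\<^sub>s\<bar>\<^sup>p + a \<bar>\<nabla>\<phi>\<^sub>s\<bar>\<^sup>q\<close>
      by a mollification of \<open>\<bar>\<nabla>\<phi>\<bar>\<^sup>p + a \<bar>\<nabla>\<phi>\<bar>\<^sup>q\<close>, which converges in
  \<open>L\<^sup>1\<close>, so the energies converge by dominated convergence.
\<close>

subsection \<open>Smooth functions\<close>

text \<open>The push and the mollification have to run on one scale. The push moves points by at
  most a multiple of \<delta>, so with s = \<epsilon> \<delta> and \<epsilon> fixed the weight is
  compared only at points whose distance is a fixed multiple of s, and the resulting error meets a
  gradient bound in the same parameter. Pushing outward produces the compact support: if x is within
  s of the complement, the whole s-ball around T x lies outside \<Omega>, where the zero extension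
  vanishes. The weight may be discontinuous, and the class compares its values only up to the factor
  C. Hence the integrands of the approximations are bounded by a constant times a mollification, not
  by something close to the original integrand; passing to the limit in the energies needs majorants
  that vary with n and converge in L^1, together with a.e. convergence of functions and gradients
  along a subsequence. Only \<phi> is regularised. The fixed u_0 enters through its finite energy,
  which by the lower bound on G makes its own double phase integrand integrable. The reverse
  inequality of the infima is an inclusion: test functions are competitors, because a is bounded and
  gradients of test functions are bounded.\<close>

definition smooth :: "('a::euclidean_space \<Rightarrow> real) \<Rightarrow> bool" where
  "smooth f \<longleftrightarrow> (\<forall>k. Ck_fun k f)"

text \<open>Lets an explicit derivative replace \<open>frechet_derivative\<close>, which is fixed
  only by a choice operator; all regularity inductions below go through this rule.\<close>

lemma Ck_fun_SucI:
  assumes "\<And>x. (f has_derivative f' x) (at x)" "\<And>b. b \<in> Basis \<Longrightarrow>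
      Ck_fun k (\<lambda>x. f' x b)"
  shows "Ck_fun (Suc k) f"
proof -
  have eq: "frechet_derivative f (at x) = f' x" for x
    by (rule frechet_derivative_at[OF assms(1), symmetric])
  show ?thesis
    unfolding Ck_fun.simps(2) eq using assms by (blast intro: differentiableI)
qed

lemma Ck_fun_Suc_imp: "Ck_fun (Suc k) f \<Longrightarrow> Ck_fun k f"
proof (induction k arbitrary: f)
  case 0
  then have "continuous_on UNIV f"
    by (intro continuous_at_imp_continuous_on ballI) (simp add: differentiable_imp_continuous_within)
  then show ?case by simp
next
  case (Suc k)
  show ?case unfolding Ck_fun.simps(2)[of k]
  proof (intro conjI allI ballI)
    fix x show "f differentiable at x" using Suc.prems by simp
  next
    fix b :: 'a assume "b \<in> Basis"
    then have "Ck_fun (Suc k) (\<lambda>x. frechet_derivative f (at x) b)"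
      using Suc.prems unfolding Ck_fun.simps(2)[of "Suc k"] by blast
    then show "Ck_fun k (\<lambda>x. frechet_derivative f (at x) b)" by (rule Suc.IH)
  qed
qed

lemma Ck_fun_const: "Ck_fun k (\<lambda>x. c)"
proof (induction k arbitrary: c)
  case (Suc k)
  show ?case by (rule Ck_fun_SucI[where f' = "\<lambda>x h. 0"]) (use Suc in simp_all)
qed simp

lemma Ck_fun_SucD:
  assumes "Ck_fun (Suc k) f"
  shows "(f has_derivative frechet_derivative f (at x)) (at x)"
    and "b \<in> Basis \<Longrightarrow> Ck_fun k (\<lambda>x. frechet_derivative f (at x) b)"
  using assms by (simp_all add: frechet_derivative_works[symmetric])

lemma Ck_fun_add: "Ck_fun k f \<Longrightarrow> Ck_fun k g \<Longrightarrow> Ck_fun k (\<lambda>x. f x + g x)"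
proof (induction k arbitrary: f g)
  case 0
  then show ?case by (simp add: continuous_on_add)
next
  case (Suc k)
  show ?case
  proof (rule Ck_fun_SucI)
    show "((\<lambda>x. f x + g x) has_derivative
        (\<lambda>h. frechet_derivative f (at x) h + frechet_derivative g (at x) h)) (at x)" for x
      by (intro has_derivative_add Ck_fun_SucD[OF Suc.prems(1)] Ck_fun_SucD[OF Suc.prems(2)])
    fix b :: 'a assume "b \<in> Basis"
    then show "Ck_fun k (\<lambda>x. frechet_derivative f (at x) b + frechet_derivative g (at x) b)"
      by (intro Suc.IH Ck_fun_SucD(2)[OF Suc.prems(1)] Ck_fun_SucD(2)[OF Suc.prems(2)])
  qed
qed

lemma Ck_fun_mult: "Ck_fun k f \<Longrightarrow> Ck_fun k g \<Longrightarrow> Ck_fun k (\<lambda>x. f x * g x)"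
proof (induction k arbitrary: f g)
  case 0
  then show ?case by (simp add: continuous_on_mult)
next
  case (Suc k)
  show ?case
  proof (rule Ck_fun_SucI)
    show "((\<lambda>x. f x * g x) has_derivative
        (\<lambda>h. f x * frechet_derivative g (at x) h + frechet_derivative f (at x) h * g x)) (at x)" for x
      by (intro has_derivative_mult Ck_fun_SucD[OF Suc.prems(1)] Ck_fun_SucD[OF Suc.prems(2)])
    fix b :: 'a assume "b \<in> Basis"
    then show "Ck_fun k (\<lambda>x. f x * frechet_derivative g (at x) b + frechet_derivative f (at x) b * g x)"
      by (intro Ck_fun_add Suc.IH Ck_fun_SucD(2)[OF Suc.prems(1)] Ck_fun_SucD(2)[OF Suc.prems(2)]
          Ck_fun_Suc_imp[OF Suc.prems(1)] Ck_fun_Suc_imp[OF Suc.prems(2)])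
  qed
qed

lemma Ck_fun_sum: "(\<And>i. i \<in> I \<Longrightarrow> Ck_fun k (f i)) \<Longrightarrow>
    Ck_fun k (\<lambda>x. \<Sum>i\<in>I. f i x)"
  by (induction I rule: infinite_finite_induct) (auto intro: Ck_fun_add Ck_fun_const)

lemma Ck_fun_inner: "Ck_fun k (\<lambda>x. x \<bullet> v)"
proof (cases k)
  case (Suc j)
  show ?thesis unfolding Suc
    by (rule Ck_fun_SucI[where f' = "\<lambda>x h. h \<bullet> v"])
      (auto intro!: derivative_eq_intros Ck_fun_const)
qed (auto intro: continuous_intros)

lemma linear_eq_sum_Basis:
  assumes "linear (f :: 'a::euclidean_space \<Rightarrow> real)"
  shows "f h = (\<Sum>b\<in>Basis. (h \<bullet> b) * f b)"
proof -
  have "f h = f (\<Sum>b\<in>Basis. (h \<bullet> b) *\<^sub>R b)"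
    by (simp add: euclidean_representation)
  also have "\<dots> = (\<Sum>b\<in>Basis. (h \<bullet> b) * f b)"
    using assms by (simp add: linear_sum linear_cmul)
  finally show ?thesis .
qed

text \<open>The partial derivatives of the composition are finite sums of products of partials of
  the components of T with partials of f at T x. Only f is generalised in the induction, since the
  partials of f replace f while T stays.\<close>

lemma Ck_fun_compose:
  fixes T :: "'a::euclidean_space \<Rightarrow> 'b::euclidean_space"
  shows "Ck_fun k f \<Longrightarrow> (\<And>c. c \<in> Basis \<Longrightarrow>
      Ck_fun k (\<lambda>x. T x \<bullet> c)) \<Longrightarrow> Ck_fun k (\<lambda>x. f (T x))"
proof (induction k arbitrary: f)
  case 0
  have "continuous_on UNIV T"
    using 0(2) by (subst continuous_on_componentwise) simp
  then show ?case
    using 0(1) continuous_on_compose2[of UNIV f UNIV T] by simp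
next
  case (Suc k)
  define T' where "T' x h
      = (\<Sum>c\<in>Basis. frechet_derivative (\<lambda>x. T x \<bullet> c) (at x) h *\<^sub>R c)" for x h
  have dT: "(T has_derivative T' x) (at x)" for x
  proof (subst has_derivative_componentwise_within, intro ballI)
    fix c :: 'b assume "c \<in> Basis"
    then show "((\<lambda>x. T x \<bullet> c) has_derivative (\<lambda>h. T' x h \<bullet> c)) (at x)"
      using Ck_fun_SucD(1)[OF Suc.prems(2)] unfolding T'_def by simp
  qed
  have df: "(f has_derivative frechet_derivative f (at x)) (at x)" for x
    by (rule Ck_fun_SucD(1)[OF Suc.prems(1)])
  show ?case
  proof (rule Ck_fun_SucI[where f' = "\<lambda>x h. frechet_derivative f (at (T x)) (T' x h)"])
    show "((\<lambda>x. f (T x)) has_derivative (\<lambda>h. frechet_derivative f (at (T x)) (T' x h))) (at x)" for x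
      by (rule has_derivative_compose[OF dT df])
    fix b :: 'a assume b: "b \<in> Basis"
    have "frechet_derivative f (at (T x)) (T' x b) =
        (\<Sum>c\<in>Basis. frechet_derivative (\<lambda>x. T x \<bullet> c) (at x) b * frechet_derivative f (at (T x)) c)" for x
      by (subst linear_eq_sum_Basis[OF has_derivative_linear[OF df]]) (simp add: T'_def)
    moreover have "Ck_fun k (\<lambda>x. \<Sum>c\<in>Basis. frechet_derivative (\<lambda>x. T x \<bullet> c) (at x) b * frechet_derivative f (at (T x)) c)"
    proof (rule Ck_fun_sum, rule Ck_fun_mult)
      fix c :: 'b assume c: "c \<in> Basis"
      show "Ck_fun k (\<lambda>x. frechet_derivative (\<lambda>x. T x \<bullet> c) (at x) b)"
        by (rule Ck_fun_SucD(2)[OF Suc.prems(2)[OF c] b])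
      show "Ck_fun k (\<lambda>x. frechet_derivative f (at (T x)) c)"
        by (rule Suc.IH[OF Ck_fun_SucD(2)[OF Suc.prems(1) c]])
          (rule Ck_fun_Suc_imp[OF Suc.prems(2)])
    qed
    ultimately show "Ck_fun k (\<lambda>x. frechet_derivative f (at (T x)) (T' x b))" by simp
  qed
qed

subsection \<open>A smooth bump\<close>

text \<open>The function exp(-1/t) t^(-n), extended by 0. The powers are included because
  differentiation maps this family into its own linear span, so smoothness can be proved for all n
  at once.\<close>

definition flat_fun :: "nat \<Rightarrow> real \<Rightarrow> real" where
  "flat_fun n t = (if t > 0 then exp (- inverse t) * inverse t ^ n else 0)"

lemma flat_fun_deriv:
  "(flat_fun n has_real_derivative flat_fun (n + 2) t - n * flat_fun (Suc n) t) (at t)"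
proof -
  consider "t > 0" | "t < 0" | "t = 0" by linarith
  then show ?thesis
  proof cases
    case 1
    have "((\<lambda>t. exp (- inverse t) * inverse t ^ n) has_real_derivative flat_fun (n + 2) t - n * flat_fun (Suc n) t) (at t)"
      using 1 by (cases n) (auto intro!: derivative_eq_intros simp: flat_fun_def divide_inverse power2_eq_square algebra_simps,
          metis One_nat_def power_eq_if)
    moreover have "\<forall>\<^sub>F s in nhds t. flat_fun n s = exp (- inverse s) * inverse s ^ n"
      using eventually_nhds_in_open[of "{0<..}" t] 1
      by (auto simp: flat_fun_def elim!: eventually_mono)
    ultimately show ?thesis
      by (subst DERIV_cong_ev) auto
  next
    case 2
    have "\<forall>\<^sub>F s in nhds t. flat_fun n s = 0"
      using eventually_nhds_in_open[of "{..<0}" t] 2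
      by (auto simp: flat_fun_def elim!: eventually_mono)
    then show ?thesis
      using 2 by (subst DERIV_cong_ev) (auto simp: flat_fun_def)
  next
    case 3
    \<comment> \<open>At the origin the left quotients are zero; on the right the substitution of
      1/h turns the quotient into a power divided by an exponential.\<close>
    have "((\<lambda>h. flat_fun n h / h) \<longlongrightarrow> 0) (at_left 0)"
      by (rule tendsto_eventually) (auto simp: flat_fun_def eventually_at_filter)
    moreover have "((\<lambda>h::real. exp (- inverse h) * inverse h ^ n / h) \<longlongrightarrow> 0) (at_right 0)"
    proof -
      have "((\<lambda>h::real. inverse h ^ Suc n / exp (inverse h)) \<longlongrightarrow> 0) (at_right 0)"
        by (rule filterlim_compose[OF tendsto_power_div_exp_0 filterlim_inverse_at_top_right])
      then show ?thesis
        by (simp add: exp_minus field_simps)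
    qed
    then have "((\<lambda>h. flat_fun n h / h) \<longlongrightarrow> 0) (at_right 0)"
      by (rule Lim_transform_eventually) (auto simp: flat_fun_def eventually_at_filter)
    ultimately have "((\<lambda>h. flat_fun n h / h) \<longlongrightarrow> 0) (at 0)"
      by (rule filterlim_split_at)
    then show ?thesis
      using 3 by (simp add: DERIV_def flat_fun_def)
  qed
qed

text \<open>The standard profile exp(-1/(1 - |x|^2)) on the unit ball.\<close>

definition bump :: "'a::euclidean_space \<Rightarrow> real" where
  "bump x = flat_fun 0 (1 - x \<bullet> x)"

lemma smooth_bump: "smooth bump"
proof -
  have "Ck_fun k (\<lambda>x::'a. flat_fun n (1 - x \<bullet> x))" for k n
  proof (induction k arbitrary: n)
    case 0
    have "continuous_on UNIV (flat_fun n)"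
      by (meson DERIV_isCont continuous_at_imp_continuous_on flat_fun_deriv)
    then show ?case
      by (auto intro!: continuous_on_compose2[of UNIV "flat_fun n"] continuous_intros)
  next
    case (Suc k)
    let ?d = "\<lambda>t. flat_fun (n + 2) t + (- real n) * flat_fun (Suc n) t"
    show ?case
    proof (rule Ck_fun_SucI[where f' = "\<lambda>x h. ?d (1 - x \<bullet> x) * (- 2 * (x \<bullet> h))"])
      fix x :: 'a
      have "((\<lambda>x::'a. 1 - x \<bullet> x) has_derivative (\<lambda>h. - 2 * (x \<bullet> h))) (at x)"
        by (auto intro!: derivative_eq_intros simp: inner_commute)
      moreover have "(flat_fun n has_derivative (*) (?d (1 - x \<bullet> x))) (at (1 - x \<bullet> x))"
        using flat_fun_deriv[of n "1 - x \<bullet> x"] by (simp add: has_field_derivative_def)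
      ultimately show "((\<lambda>x. flat_fun n (1 - x \<bullet> x)) has_derivative
          (\<lambda>h. ?d (1 - x \<bullet> x) * (- 2 * (x \<bullet> h)))) (at x)"
        by (rule has_derivative_compose)
    next
      fix b :: 'a assume "b \<in> Basis"
      show "Ck_fun k (\<lambda>x. ?d (1 - x \<bullet> x) * (- 2 * (x \<bullet> b)))"
        by (intro Ck_fun_mult Ck_fun_add Suc Ck_fun_const Ck_fun_inner)
    qed
  qed
  from this[of _ 0] show ?thesis
    by (auto simp: smooth_def bump_def[abs_def])
qed

lemma bump_pos_iff: "bump x > 0 \<longleftrightarrow> norm x < 1"
  by (auto simp: bump_def flat_fun_def norm_lt_square)

lemma bump_nonneg: "bump x \<ge> 0"
  by (auto simp: bump_def flat_fun_def)

lemma bump_eq_0: "norm x \<ge> 1 \<Longrightarrow> bump x = 0"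
  using bump_pos_iff[of x] bump_nonneg[of x] by linarith

lemma bump_le: "bump x \<le> 1"
  by (auto simp: bump_def flat_fun_def)

text \<open>The radius 3/4 is an arbitrary inner radius; 16/7 is 1/(1 - (3/4)^2). The bound serves
  twice: for the mass of the mollifier and for the size of the pushing field near the
  boundary.\<close>

lemma bump_ge: 
  assumes "norm x \<le> 3/4" shows "bump x \<ge> exp (- 16/7)"
proof -
  have "x \<bullet> x \<le> 9/16"
    using power_mono[OF assms norm_ge_zero, of 2] by (simp add: power2_norm_eq_inner power_divide)
  then have "inverse (1 - x \<bullet> x) \<le> 16/7" "1 - x \<bullet> x > 0"
    by (auto simp: field_simps)
  then show ?thesis
    by (auto simp: bump_def flat_fun_def)
qed

subsection \<open>Test functions and convolution\<close>

text \<open>Needed for Tonelli on the product of two completed measures; the countable cover is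
  inherited from \<open>lborel\<close>.\<close>

lemma sigma_finite_lebesgue: "sigma_finite_measure (lebesgue :: 'a::euclidean_space measure)"
proof
  obtain A :: "'a set set" where A: "countable A" "A \<subseteq> sets lborel" "\<Union>A = space lborel"
      "\<forall>a\<in>A. emeasure lborel a \<noteq> \<infinity>"
    using sigma_finite_measure.sigma_finite_countable[OF sigma_finite_lborel] by blast
  then show "\<exists>A::'a set set. countable A \<and> A \<subseteq> sets lebesgue \<and> \<Union>A
      = space lebesgue \<and>
      (\<forall>a\<in>A. emeasure lebesgue a \<noteq> \<infinity>)"
    by (intro exI[of _ A]) auto
qed

lemma borel_measurable_continuous_lebesgue:
  assumes "continuous_on UNIV (f :: 'a::euclidean_space \<Rightarrow> 'b::{second_countable_topology, real_normed_vector})"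
  shows "f \<in> borel_measurable lebesgue"
  using assms by (intro measurable_completion) (simp add: borel_measurable_continuous_onI)

lemma smooth_Ck: "smooth f \<Longrightarrow> Ck_fun k f"
  by (simp add: smooth_def)

lemma smooth_has_derivative:
  "smooth f \<Longrightarrow> (f has_derivative frechet_derivative f (at x)) (at x)"
  using Ck_fun_SucD(1)[of 0 f x] smooth_Ck[of f "Suc 0"] by simp

lemma smooth_frechet_derivative:
  "smooth f \<Longrightarrow> b \<in> Basis \<Longrightarrow> smooth (\<lambda>x. frechet_derivative f (at x) b)"
  using Ck_fun_SucD(2) smooth_def by blast

lemma smooth_continuous: "smooth f \<Longrightarrow> continuous_on UNIV f"
  using smooth_Ck[of f 0] by simp

lemma smooth_add: "smooth f \<Longrightarrow> smooth g \<Longrightarrow> smooth (\<lambda>x. f x + g x)"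
  by (simp add: smooth_def Ck_fun_add)

lemma norm_scaleR_inverse: "c > 0 \<Longrightarrow> norm (v /\<^sub>R c) = norm v / c"
  by (simp add: divide_inverse mult.commute)

lemma frechet_derivative_outside_support:
  assumes "closed K" "\<And>x. x \<notin> K \<Longrightarrow> f x = 0" "x \<notin> K"
  shows "frechet_derivative f (at x) b = 0"
proof -
  have "((\<lambda>_. 0) has_derivative (\<lambda>_. 0)) (at x)" by simp
  then have "(f has_derivative (\<lambda>_. 0)) (at x)"
    by (rule has_derivative_transform_within_open[where s = "- K"]) (use assms in auto)
  from frechet_derivative_at[OF this, symmetric] show ?thesis by simp
qed

text \<open>Any compact subset of \<Omega> off which f vanishes may play the part of the closed
  support, so membership can be shown without computing a closure.\<close>

lemma Cc_infinity_iff: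
  "f \<in> Cc_infinity \<Omega> \<longleftrightarrow> smooth f \<and> (\<exists>K. compact K \<and> K \<subseteq> \<Omega> \<and> (\<forall>x. x \<notin> K \<longrightarrow> f x = 0))"
proof (intro iffI conjI)
  assume f: "f \<in> Cc_infinity \<Omega>"
  then show "smooth f" by (simp add: Cc_infinity_def smooth_def)
  let ?K = "closure {x. f x \<noteq> 0}"
  have "compact ?K" "?K \<subseteq> \<Omega>"
    using f unfolding Cc_infinity_def by blast+
  moreover have "f x = 0" if "x \<notin> ?K" for x
    using that closure_subset[of "{x. f x \<noteq> 0}"] by blast
  ultimately show "\<exists>K. compact K \<and> K \<subseteq> \<Omega> \<and> (\<forall>x. x \<notin> K \<longrightarrow> f x = 0)"
    by blast
next
  assume "smooth f \<and> (\<exists>K. compact K \<and> K \<subseteq> \<Omega> \<and> (\<forall>x. x \<notin> K \<longrightarrow> f x = 0))"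
  then obtain K where K: "smooth f" "compact K" "K \<subseteq> \<Omega>" "\<And>x. x \<notin> K \<Longrightarrow>
      f x = 0"
    by blast
  have sub: "closure {x. f x \<noteq> 0} \<subseteq> K"
    by (rule closure_minimal) (use K(4) compact_imp_closed[OF K(2)] in blast)+
  then have "compact (closure {x. f x \<noteq> 0})"
    unfolding compact_closure
    using K(4) by (intro bounded_subset[OF compact_imp_bounded[OF K(2)]]) blast
  with sub K(1,3) show "f \<in> Cc_infinity \<Omega>"
    unfolding Cc_infinity_def smooth_def by blast
qed

lemma Cc_infinity_UNIV_iff:
  "f \<in> Cc_infinity UNIV \<longleftrightarrow> smooth f \<and> (\<exists>R. \<forall>x. norm x > R \<longrightarrow> f x = 0)"
proof
  assume "f \<in> Cc_infinity UNIV"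
  then obtain K where K: "smooth f" "compact K" "\<And>x. x \<notin> K \<Longrightarrow> f x = 0"
    by (auto simp: Cc_infinity_iff)
  obtain R where "\<And>x. x \<in> K \<Longrightarrow> norm x \<le> R"
    using compact_imp_bounded[OF K(2)] by (auto simp: bounded_iff)
  then have "norm x > R \<Longrightarrow> x \<notin> K" for x by force
  with K show "smooth f \<and> (\<exists>R. \<forall>x. norm x > R \<longrightarrow> f x = 0)" by blast
next
  assume "smooth f \<and> (\<exists>R. \<forall>x. norm x > R \<longrightarrow> f x = 0)"
  then obtain R where "smooth f" "\<And>x. norm x > R \<Longrightarrow> f x = 0" by blast
  then show "f \<in> Cc_infinity UNIV"
    by (auto simp: Cc_infinity_iff intro!: exI[of _ "cball 0 R"])
qed

lemma Cc_infinity_mono: "f \<in> Cc_infinity A \<Longrightarrow> A \<subseteq> B \<Longrightarrow>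
    f \<in> Cc_infinity B"
  by (auto simp: Cc_infinity_def)

lemma Cc_infinity_smooth: "f \<in> Cc_infinity A \<Longrightarrow> smooth f"
  by (auto simp: Cc_infinity_iff)

lemma Cc_infinity_outside: "f \<in> Cc_infinity A \<Longrightarrow> x \<notin> A \<Longrightarrow> f x = 0"
  by (auto simp: Cc_infinity_iff)

lemma Cc_infinity_frechet_derivative:
  assumes f: "f \<in> Cc_infinity A" and b: "b \<in> Basis"
  shows "(\<lambda>x. frechet_derivative f (at x) b) \<in> Cc_infinity A"
proof -
  obtain K where K: "smooth f" "compact K" "K \<subseteq> A" "\<And>x. x \<notin> K \<Longrightarrow> f x = 0"
    using f by (auto simp: Cc_infinity_iff)
  have "frechet_derivative f (at x) b = 0" if "x \<notin> K" for x
    by (rule frechet_derivative_outside_support[OF compact_imp_closed[OF K(2)] K(4) that])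
  with K b show ?thesis
    by (auto simp: Cc_infinity_iff intro!: smooth_frechet_derivative)
qed

lemma Cc_infinity_mult:
  assumes "f \<in> Cc_infinity A" "smooth g"
  shows "(\<lambda>x. f x * g x) \<in> Cc_infinity A"
  using assms by (auto simp: Cc_infinity_iff smooth_def intro: Ck_fun_mult)

lemma smooth_compose:
  fixes T :: "'a::euclidean_space \<Rightarrow> 'b::euclidean_space"
  assumes "smooth f" "\<And>c. c \<in> Basis \<Longrightarrow> smooth (\<lambda>x. T x \<bullet> c)"
  shows "smooth (\<lambda>x. f (T x))"
  unfolding smooth_def
proof
  fix k show "Ck_fun k (\<lambda>x. f (T x))"
    by (rule Ck_fun_compose) (use assms smooth_Ck in blast)+
qed

lemma smooth_affine: "smooth (\<lambda>x. (v + c *\<^sub>R x) \<bullet> w)"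
proof -
  have "Ck_fun k (\<lambda>x. v \<bullet> w + c * (x \<bullet> w))" for k
    by (intro Ck_fun_add Ck_fun_mult Ck_fun_const Ck_fun_inner)
  then show ?thesis by (simp add: smooth_def inner_add_left)
qed

lemma Cc_infinity_UNIV_affine:
  assumes f: "f \<in> Cc_infinity UNIV" and c: "c \<noteq> 0"
  shows "(\<lambda>x. f (v + c *\<^sub>R x)) \<in> Cc_infinity UNIV"
proof -
  obtain R where R: "smooth f" "\<And>x. norm x > R \<Longrightarrow> f x = 0"
    using f by (auto simp: Cc_infinity_UNIV_iff)
  have "f (v + c *\<^sub>R x) = 0" if "norm x > (R + norm v) / \<bar>c\<bar>" for x
  proof (rule R(2))
    have "R + norm v < \<bar>c\<bar> * norm x"
      using that c by (simp add: field_simps)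
    also have "\<dots> = norm ((v + c *\<^sub>R x) - v)" by simp
    also have "\<dots> \<le> norm (v + c *\<^sub>R x) + norm v" by (rule norm_triangle_ineq4)
    finally show "R < norm (v + c *\<^sub>R x)" by simp
  qed
  moreover have "smooth (\<lambda>x. f (v + c *\<^sub>R x))"
    by (rule smooth_compose[OF R(1)]) (rule smooth_affine)
  ultimately show ?thesis by (auto simp: Cc_infinity_UNIV_iff)
qed

lemma Cc_infinity_UNIV_bounded:
  assumes "f \<in> Cc_infinity UNIV"
  obtains B where "B > 0" "\<And>x. \<bar>f x\<bar> \<le> B"
proof -
  obtain K where K: "smooth f" "compact K" "\<And>x. x \<notin> K \<Longrightarrow> f x = 0"
    using assms by (auto simp: Cc_infinity_iff)
  have "compact (f ` K)"
    using K by (intro compact_continuous_image) (auto intro: continuous_on_subset[OF smooth_continuous])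
  then obtain B where B: "B > 0" "\<And>y. y \<in> f ` K \<Longrightarrow> \<bar>y\<bar> \<le> B"
    using compact_imp_bounded bounded_pos by (metis real_norm_def)
  have "\<bar>f x\<bar> \<le> B" for x
    by (cases "x \<in> K") (use B K(3)[of x] in auto)
  with B(1) show ?thesis by (rule that)
qed

lemma compact_support_uniform:
  fixes f :: "'a::euclidean_space \<Rightarrow> real"
  assumes "continuous_on UNIV f" "\<And>x. norm x > R \<Longrightarrow> f x = 0" "e > 0"
  obtains d where "d > 0" "\<And>x y. norm (x - y) < d \<Longrightarrow> \<bar>f x - f y\<bar> < e"
proof -
  \<comment> \<open>The extra 1 in the radius goes with the \<open>min d 1\<close> below: two points
    closer than 1 either both lie in this ball or both lie where f vanishes.\<close>
  have "uniformly_continuous_on (cball 0 (\<bar>R\<bar> + 1)) f"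
    by (rule compact_uniformly_continuous) (auto intro: continuous_on_subset[OF assms(1)])
  then obtain d where d: "d > 0"
      "\<And>x y. norm x \<le> \<bar>R\<bar> + 1 \<Longrightarrow> norm y \<le> \<bar>R\<bar> + 1 \<Longrightarrow>
          dist y x < d \<Longrightarrow> dist (f y) (f x) < e"
    unfolding uniformly_continuous_on_def using assms(3) by (metis mem_cball_0)
  have "\<bar>f x - f y\<bar> < e" if "norm (x - y) < min d 1" for x y
  proof (cases "norm x \<le> \<bar>R\<bar> + 1 \<and> norm y \<le> \<bar>R\<bar> + 1")
    case True
    then show ?thesis using d(2)[of y x] that by (auto simp: dist_norm)
  next
    case False
    have "norm x \<le> norm y + 1" "norm y \<le> norm x + 1"
      using that norm_triangle_ineq2[of x y] norm_triangle_ineq3[of x y] by auto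
    with False have "f x = 0" "f y = 0" by (auto intro!: assms(2))
    then show ?thesis using assms(3) by simp
  qed
  then show ?thesis using d(1) that[of "min d 1"] by auto
qed

lemma Cc_infinity_UNIV_measurable:
  "f \<in> Cc_infinity UNIV \<Longrightarrow> f \<in> borel_measurable lebesgue"
  by (intro borel_measurable_continuous_lebesgue smooth_continuous Cc_infinity_smooth)

lemma integrable_bounded_mult:
  fixes f k :: "'a \<Rightarrow> real"
  assumes "integrable M f" "k \<in> borel_measurable M" "\<And>x. \<bar>k x\<bar> \<le> B"
  shows "integrable M (\<lambda>x. k x * f x)"
proof (rule Bochner_Integration.integrable_bound[of M "\<lambda>x. B * f x"])
  show "AE x in M. norm (k x * f x) \<le> norm (B * f x)"
  proof (intro AE_I2)
    fix x show "norm (k x * f x) \<le> norm (B * f x)"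
      using assms(3)[of x] by (simp add: abs_mult mult_right_mono)
  qed
qed (use assms in auto)

lemma Cc_infinity_integrable_mult:
  assumes "integrable lebesgue f" "k \<in> Cc_infinity UNIV"
  shows "integrable lebesgue (\<lambda>x. k x * f x)"
proof -
  obtain B where "\<And>x. \<bar>k x\<bar> \<le> B"
    using Cc_infinity_UNIV_bounded[OF assms(2)] by blast
  then show ?thesis
    by (intro integrable_bounded_mult[OF assms(1)] Cc_infinity_UNIV_measurable assms)
qed

lemma integrable_bounded_support:
  fixes f :: "'a::euclidean_space \<Rightarrow> real"
  assumes "f \<in> borel_measurable lebesgue" "\<And>x. \<bar>f x\<bar>
      \<le> B" "\<And>x. norm x > R \<Longrightarrow> f x = 0"
  shows "integrable lebesgue f"
proof (rule Bochner_Integration.integrable_bound[of _ "\<lambda>x. B * indicator (cball 0 R) x"])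
  show "AE x in lebesgue. norm (f x) \<le> norm (B * indicator (cball 0 R) x)"
  proof (intro AE_I2)
    fix x show "norm (f x) \<le> norm (B * indicator (cball 0 R) x)"
      using assms(2)[of x] assms(3)[of x] by (auto simp: indicator_def not_le)
  qed
  have "emeasure lebesgue (cball (0::'a) R) < \<infinity>"
    by (metis lmeasurable_cball fmeasurableD2 infinity_ennreal_def less_top)
  then show "integrable lebesgue (\<lambda>x::'a. B * indicator (cball 0 R) x)" by simp
qed (use assms in auto)

lemma Cc_infinity_integrable: "f \<in> Cc_infinity UNIV \<Longrightarrow> integrable lebesgue f"
  using Cc_infinity_UNIV_bounded[of f] Cc_infinity_UNIV_iff[of f]
  by (metis integrable_bounded_support Cc_infinity_UNIV_measurable)

text \<open>The mean value theorem on the segment from y to y + h, combined with uniform continuity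
  of the partials. That d does not depend on y is what permits differentiation under the integral
  sign in a convolution.\<close>

lemma Cc_infinity_uniform_differentiable:
  assumes k: "k \<in> Cc_infinity UNIV" and e: "e > 0"
  obtains d where "d > 0"
    "\<And>y h. norm h < d \<Longrightarrow>
        \<bar>k (y + h) - k y - (\<Sum>b\<in>Basis. (h \<bullet> b) * frechet_derivative k (at y) b)\<bar>
            \<le> e * norm h"
proof -
  let ?D = "\<lambda>b y. frechet_derivative k (at y) b"
  let ?e = "e / DIM('a)"
  have "\<exists>d>0. \<forall>x y. norm (x - y) < d
      \<longrightarrow> \<bar>?D b x - ?D b y\<bar> < ?e" if b: "b \<in> Basis" for b
  proof -
    obtain R where "smooth (?D b)" "\<And>x. norm x > R \<Longrightarrow> ?D b x = 0"
      using Cc_infinity_frechet_derivative[OF k b] by (auto simp: Cc_infinity_UNIV_iff)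
    then show ?thesis
      using compact_support_uniform[of "?D b" R ?e] smooth_continuous e
          by (metis DIM_positive divide_pos_pos of_nat_0_less_iff)
  qed
  then obtain d where d: "\<And>b. b \<in> Basis \<Longrightarrow> d b > 0"
    "\<And>b x y. b \<in> Basis \<Longrightarrow> norm (x - y) < d b \<Longrightarrow> \<bar>?D b x - ?D b y\<bar> < ?e"
    by metis
  define d0 where "d0 = Min (d ` Basis)"
  have d0: "d0 > 0" "\<And>b. b \<in> Basis \<Longrightarrow> d0 \<le> d b"
    using d(1) by (auto simp: d0_def)
  have "\<bar>k (y + h) - k y - (\<Sum>b\<in>Basis. (h \<bullet> b) * ?D b y)\<bar>
      \<le> e * norm h" if h: "norm h < d0" for y h
  proof -
    have dk: "(k has_derivative frechet_derivative k (at x)) (at x)" for x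
      by (rule smooth_has_derivative[OF Cc_infinity_smooth[OF k]])
    have der: "((\<lambda>t. k (y + t *\<^sub>R h)) has_real_derivative frechet_derivative k (at (y + t *\<^sub>R h)) h) (at t)" for t
    proof -
      have "((\<lambda>t. y + t *\<^sub>R h) has_derivative (\<lambda>s. s *\<^sub>R h)) (at t)"
        by (auto intro!: derivative_eq_intros)
      from has_derivative_compose[OF this dk]
      have "((\<lambda>t. k (y + t *\<^sub>R h)) has_derivative (\<lambda>s. frechet_derivative k (at (y + t *\<^sub>R h)) (s *\<^sub>R h))) (at t)" .
      then show ?thesis
        unfolding has_field_derivative_def
        by (rule has_derivative_eq_rhs)
          (auto simp: linear_cmul[OF has_derivative_linear[OF dk]] mult.commute)
    qed
    obtain t where t: "0 < t" "t < 1" "k (y + 1 *\<^sub>R h) - k (y + 0 *\<^sub>R h)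
        = (1 - 0) * frechet_derivative k (at (y + t *\<^sub>R h)) h"
      using MVT2[of 0 1 "\<lambda>t. k (y + t *\<^sub>R h)", OF _ der] by auto
    have "k (y + h) - k y - (\<Sum>b\<in>Basis. (h \<bullet> b) * ?D b y)
        = (\<Sum>b\<in>Basis. (h \<bullet> b) * (?D b (y + t *\<^sub>R h) - ?D b y))"
      using t(3) linear_eq_sum_Basis[OF has_derivative_linear[OF dk], of "y + t *\<^sub>R h" h]
      by (simp add: right_diff_distrib sum_subtractf)
    also have "\<bar>\<dots>\<bar>
        \<le> (\<Sum>b\<in>Basis. \<bar>(h \<bullet> b) * (?D b (y + t *\<^sub>R h) - ?D b y)\<bar>)"
      by (rule sum_abs)
    also have "\<dots> \<le> (\<Sum>b\<in>(Basis::'a set). norm h * ?e)"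
    proof (rule sum_mono)
      fix b :: 'a assume b: "b \<in> Basis"
      have "norm (y + t *\<^sub>R h - y) < d b"
        using t h d0(2)[OF b] mult_right_mono[of t 1 "norm h"] by auto
      then have "\<bar>?D b (y + t *\<^sub>R h) - ?D b y\<bar> \<le> ?e"
        using d(2)[OF b] by fastforce
      then show "\<bar>(h \<bullet> b) * (?D b (y + t *\<^sub>R h) - ?D b y)\<bar> \<le> norm h * ?e"
        unfolding abs_mult by (intro mult_mono Basis_le_norm[OF b]) auto
    qed
    also have "\<dots> = e * norm h" by simp
    finally show ?thesis .
  qed
  with d0(1) show ?thesis by (rule that)
qed

section \<open>Convolution of an integrable function with a test function\<close>

definition conv :: "('a::euclidean_space \<Rightarrow> real) \<Rightarrow> ('a \<Rightarrow> real) \<Rightarrow> 'a \<Rightarrow> real" where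
  "conv k f x = (LINT z|lebesgue. k (x - z) * f z)"

lemma Cc_infinity_reflect: "k \<in> Cc_infinity UNIV \<Longrightarrow> (\<lambda>z. k (x - z)) \<in> Cc_infinity UNIV"
  using Cc_infinity_UNIV_affine[of k "-1" x] by simp

lemma conv_integrable:
  "k \<in> Cc_infinity UNIV \<Longrightarrow> integrable lebesgue f \<Longrightarrow>
      integrable lebesgue (\<lambda>z. k (x - z) * f z)"
  using Cc_infinity_integrable_mult[OF _ Cc_infinity_reflect] by blast

text \<open>The first order remainder of the kernel is uniformly at most a small multiple of the
  norm of h; integrating it against f costs only the L^1 norm of f.\<close>

lemma conv_has_derivative:
  assumes k: "k \<in> Cc_infinity UNIV" and f: "integrable lebesgue f"
  shows "(conv k f has_derivative
    (\<lambda>h. \<Sum>b\<in>Basis. (h \<bullet> b) * conv (\<lambda>y. frechet_derivative k (at y) b) f x)) (at x)"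
proof -
  let ?D = "\<lambda>b y. frechet_derivative k (at y) b"
  let ?L = "\<lambda>h. \<Sum>b\<in>Basis. (h \<bullet> b) * conv (?D b) f x"
  have lin: "bounded_linear ?L"
    by (intro linear_conv_bounded_linear[THEN iffD1] linearI)
      (auto simp: inner_add_left algebra_simps sum.distrib sum_distrib_left)
  have I: "integrable lebesgue (\<lambda>z. k (y - z) * f z)" for y
    by (rule conv_integrable[OF k f])
  have ID: "b \<in> Basis \<Longrightarrow> integrable lebesgue (\<lambda>z. ?D b (x - z) * f z)" for b
    by (rule conv_integrable[OF Cc_infinity_frechet_derivative[OF k] f])
  let ?N = "LINT z|lebesgue. \<bar>f z\<bar>"
  have N: "?N \<ge> 0" by simp
  have lim: "\<exists>d>0. \<forall>h. norm h < d
      \<longrightarrow> norm (conv k f (x + h) - conv k f x - ?L h) \<le> e * norm h" if e: "e > 0" for e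
  proof -
    \<comment> \<open>Dividing by \<open>?N + 1\<close> instead of the L^1 norm \<open>?N\<close>
      covers the case that f is zero almost everywhere.\<close>
    obtain d where d: "d > 0" "\<And>y h. norm h < d \<Longrightarrow>
        \<bar>k (y + h) - k y - (\<Sum>b\<in>Basis. (h \<bullet> b) * ?D b y)\<bar> \<le> e / (?N + 1) * norm h"
      using Cc_infinity_uniform_differentiable[OF k, of "e / (?N + 1)"] N e by (smt (verit) divide_pos_pos)
    have "norm (conv k f (x + h) - conv k f x - ?L h) \<le> e * norm h" if h: "norm h < d" for h
    proof -
      let ?r = "\<lambda>z. k ((x - z) + h) - k (x - z) - (\<Sum>b\<in>Basis. (h \<bullet> b) * ?D b (x - z))"
      have "conv k f (x + h) - conv k f x - ?L h = (LINT z|lebesgue. k (x + h - z) * f z - k (x - z) * f z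
          - (\<Sum>b\<in>Basis. (h \<bullet> b) * (?D b (x - z) * f z)))"
        unfolding conv_def using I ID by (simp add: integral_sum)
      also have "\<dots> = (LINT z|lebesgue. ?r z * f z)"
        by (intro Bochner_Integration.integral_cong) (auto simp: algebra_simps sum_distrib_right sum_distrib_left)
      also have "norm \<dots> \<le> (LINT z|lebesgue. e / (?N + 1) * norm h * \<bar>f z\<bar>)"
      proof (rule Bochner_Integration.integral_norm_bound_integral)
        have "integrable lebesgue (\<lambda>z. k (x + h - z) * f z - k (x - z) * f z
          - (\<Sum>b\<in>Basis. (h \<bullet> b) * (?D b (x - z) * f z)))"
          using I ID by auto
        then show "integrable lebesgue (\<lambda>z. ?r z * f z)"
          by (rule back_subst[of "integrable lebesgue"])
            (auto simp: algebra_simps sum_distrib_right sum_distrib_left)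
        show "norm (?r z * f z) \<le> e / (?N + 1) * norm h * \<bar>f z\<bar>" for z
          using mult_right_mono[OF d(2)[OF h, of "x - z"], of "\<bar>f z\<bar>"]
              by (simp only: real_norm_def abs_mult abs_ge_zero)
      qed (use f in auto)
      also have "\<dots> = e * norm h * (?N / (?N + 1))" by simp
      also have "\<dots> \<le> e * norm h * 1"
      proof (rule mult_left_mono)
        have "t / (t + 1) \<le> 1" if "t \<ge> 0" for t :: real
          using that by (simp add: divide_le_eq)
        then show "?N / (?N + 1) \<le> 1" using N .
      qed (use e in simp)
      finally show ?thesis by simp
    qed
    with d(1) show ?thesis by blast
  qed
  have "\<exists>d>0. \<forall>y. norm (y - x) < d \<longrightarrow>
      norm (conv k f y - conv k f x - ?L (y - x)) \<le> e * norm (y - x)" if e: "e > 0" for e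
  proof -
    obtain d where d: "d > 0" "\<And>h. norm h < d \<Longrightarrow>
        norm (conv k f (x + h) - conv k f x - ?L h) \<le> e * norm h"
      using lim[OF e]
      by blast
    have "norm (conv k f y - conv k f x - ?L (y - x)) \<le> e * norm (y - x)" if "norm (y - x) < d" for y
      using d(2)[OF that] by simp
    with d(1) show ?thesis by blast
  qed
  with lin show ?thesis
    unfolding has_derivative_at_alt by blast
qed

text \<open>A partial derivative of the convolution is the convolution with a partial derivative of
  the kernel, again a test function; hence the induction varies the kernel and keeps f.\<close>

lemma conv_smooth:
  assumes "k \<in> Cc_infinity UNIV" "integrable lebesgue f"
  shows "smooth (conv k f)"
proof -
  have "Ck_fun n (conv k f)" if "k \<in> Cc_infinity UNIV" for n k
    using that
  proof (induction n arbitrary: k)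
    case 0
    then show ?case
      using conv_has_derivative[OF 0 assms(2)]
      by (auto intro!: continuous_at_imp_continuous_on dest: has_derivative_continuous)
  next
    case (Suc n)
    show ?case
    proof (rule Ck_fun_SucI[OF conv_has_derivative[OF Suc.prems assms(2)]])
      fix c :: 'a assume c: "c \<in> Basis"
      have "(\<Sum>b\<in>Basis. (c \<bullet> b) * conv (\<lambda>y. frechet_derivative k (at y) b) f x)
          = conv (\<lambda>y. frechet_derivative k (at y) c) f x" for x
        using c by (subst sum.remove[of _ c]) (auto simp: inner_Basis split: if_splits intro!: sum.neutral)
      then show "Ck_fun n (\<lambda>x. \<Sum>b\<in>Basis. (c \<bullet> b) * conv (\<lambda>y. frechet_derivative k (at y) b) f x)"
        using Suc.IH[OF Cc_infinity_frechet_derivative[OF Suc.prems c]] by simp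
    qed
  qed
  with assms show ?thesis by (simp add: smooth_def)
qed

lemma frechet_derivative_conv:
  assumes "k \<in> Cc_infinity UNIV" "integrable lebesgue f" "b \<in> Basis"
  shows "frechet_derivative (conv k f) (at x) b = conv (\<lambda>y. frechet_derivative k (at y) b) f x"
  using assms(3)
  by (subst frechet_derivative_at[OF conv_has_derivative[OF assms(1,2)], symmetric])
    (subst sum.remove[of _ b], auto simp: inner_Basis split: if_splits intro!: sum.neutral)

subsection \<open>Integration by parts and mollifiers\<close>

text \<open>Covers translations (c = 1) and reflections (c = -1) with Jacobian 1. Continuity makes
  both integrands Borel measurable, so the computation can be moved to \<open>lborel\<close> and
  back.\<close>

lemma integral_affine_unit:
  fixes f :: "'a::euclidean_space \<Rightarrow> real"
  assumes f: "continuous_on UNIV f" and c: "\<bar>c\<bar> = 1"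
  shows "(LINT x|lebesgue. f (t + c *\<^sub>R x)) = (LINT x|lebesgue. f x)"
proof -
  have [measurable]: "f \<in> borel_measurable borel"
    using f by (rule borel_measurable_continuous_onI)
  have cont: "continuous_on UNIV (\<lambda>x. f (t + c *\<^sub>R x))"
    by (rule continuous_on_compose2[OF f]) (auto intro!: continuous_intros)
  have "(LINT x|lebesgue. f x) = (LINT x|lborel. f x)"
    by (rule integral_completion) simp
  also have "\<dots> = (LINT x|distr lborel borel (\<lambda>x. t + c *\<^sub>R x). f x)"
    using lborel_affine[of c t] c by (auto simp: density_1)
  also have "\<dots> = (LINT x|lborel. f (t + c *\<^sub>R x))"
    by (rule integral_distr) auto
  also have "\<dots> = (LINT x|lebesgue. f (t + c *\<^sub>R x))"
    by (rule integral_completion[symmetric]) (use cont in \<open>simp add: borel_measurable_continuous_onI\<close>)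
  finally show ?thesis by simp
qed

lemma continuous_compact_support_bounded:
  fixes f :: "'a::euclidean_space \<Rightarrow> real"
  assumes "continuous_on UNIV f" "\<And>x. norm x > R \<Longrightarrow> f x = 0"
  obtains B where "B > 0" "\<And>x. \<bar>f x\<bar> \<le> B"
proof -
  have "compact (f ` cball 0 R)"
    by (intro compact_continuous_image) (auto intro: continuous_on_subset[OF assms(1)])
  then obtain B where B: "B > 0" "\<And>y. y \<in> f ` cball 0 R \<Longrightarrow> \<bar>y\<bar> \<le> B"
    using compact_imp_bounded bounded_pos by (metis real_norm_def)
  have "\<bar>f x\<bar> \<le> B" for x
    by (cases "norm x \<le> R") (use B assms(2)[of x] in auto)
  with B(1) show ?thesis by (rule that)
qed

text \<open>By translation invariance every difference quotient has integral zero; the mean value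
  theorem dominates the quotients by the supremum of the derivative on a fixed ball, and dominated
  convergence concludes.\<close>

lemma integral_derivative_eq_0:
  fixes f :: "'a::euclidean_space \<Rightarrow> real"
  assumes der: "\<And>x. (f has_derivative f' x) (at x)"
    and cont: "continuous_on UNIV (\<lambda>x. f' x b)"
    and supp: "\<And>x. norm x > R \<Longrightarrow> f x = 0"
  shows "(LINT x|lebesgue. f' x b) = 0"
proof -
  have cf: "continuous_on UNIV f"
    by (intro continuous_at_imp_continuous_on ballI has_derivative_continuous[OF der])
  have supp': "f' x b = 0" if "norm x > R" for x
  proof -
    have "((\<lambda>_. 0) has_derivative (\<lambda>_. 0)) (at x)" by simp
    then have "(f has_derivative (\<lambda>_. 0)) (at x)"
      by (rule has_derivative_transform_within_open[where s = "- cball 0 R"]) (use that supp in auto)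
    from has_derivative_unique[OF this der] show ?thesis by (metis)
  qed
  obtain B where B: "B > 0" "\<And>x. \<bar>f' x b\<bar> \<le> B"
    using continuous_compact_support_bounded[OF cont, of R] supp' by blast
  \<comment> \<open>The step sizes are 1/(n+1) and at most 1, so all quotients vanish outside the
    ball of radius \<open>R + norm b\<close>, the support of the majorant used below.\<close>
  define F where "F n x = (f (x + (1 / Suc n) *\<^sub>R b) - f x) * Suc n" for n x
  have der_line: "((\<lambda>t. f (x + t *\<^sub>R b)) has_real_derivative f' (x + t *\<^sub>R b) b) (at t)" for x t
  proof -
    have "((\<lambda>t. x + t *\<^sub>R b) has_derivative (\<lambda>s. s *\<^sub>R b)) (at t)"
      by (auto intro!: derivative_eq_intros)
    from has_derivative_compose[OF this der]
    show ?thesis unfolding has_field_derivative_def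
      by (rule has_derivative_eq_rhs)
        (auto simp: linear_cmul[OF has_derivative_linear[OF der]] mult.commute)
  qed
  have F0: "(LINT x|lebesgue. F n x) = 0" for n
  proof -
    obtain B' where "\<And>x. \<bar>f x\<bar> \<le> B'"
      using continuous_compact_support_bounded[OF cf supp] by blast
    then have i1: "integrable lebesgue f"
      by (intro integrable_bounded_support[OF borel_measurable_continuous_lebesgue[OF cf] _ supp])
    have c2: "continuous_on UNIV (\<lambda>x. f (x + (1 / Suc n) *\<^sub>R b))"
      by (rule continuous_on_compose2[OF cf]) (auto intro!: continuous_intros)
    have "f (x + (1 / Suc n) *\<^sub>R b) = 0" if "norm x > R + norm b" for x
    proof (rule supp)
      have "norm ((1 / Suc n) *\<^sub>R b) \<le> norm b"
        by (simp add: divide_le_eq mult_le_cancel_left1)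
      then show "norm (x + (1 / Suc n) *\<^sub>R b) > R"
        using that norm_diff_ineq[of x "(1 / Suc n) *\<^sub>R b"] by linarith
    qed
    then have i2: "integrable lebesgue (\<lambda>x. f (x + (1 / Suc n) *\<^sub>R b))"
      using \<open>\<And>x. \<bar>f x\<bar> \<le> B'\<close>
      by (intro integrable_bounded_support[OF borel_measurable_continuous_lebesgue[OF c2], of B' "R + norm b"])
    show ?thesis
      unfolding F_def using i1 i2 integral_affine_unit[OF cf, of 1 "(1 / Suc n) *\<^sub>R b"]
      by (simp add: add.commute)
  qed
  have "(\<lambda>n. LINT x|lebesgue. F n x) \<longlonglongrightarrow> (LINT x|lebesgue. f' x b)"
  proof (rule integral_dominated_convergence[where w = "\<lambda>x. B * indicator (cball 0 (R + norm b)) x"])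
    show "(\<lambda>x. f' x b) \<in> borel_measurable lebesgue"
      by (rule borel_measurable_continuous_lebesgue[OF cont])
    show "F n \<in> borel_measurable lebesgue" for n
      unfolding F_def
      by (intro borel_measurable_continuous_lebesgue continuous_intros continuous_on_compose2[OF cf])
        (auto intro!: continuous_intros)
    have "emeasure lebesgue (cball (0::'a) (R + norm b)) < \<infinity>"
      by (metis lmeasurable_cball fmeasurableD2 infinity_ennreal_def less_top)
    then show "integrable lebesgue (\<lambda>x::'a. B * indicator (cball 0 (R + norm b)) x)" by simp
    show "AE x in lebesgue. (\<lambda>n. F n x) \<longlonglongrightarrow> f' x b"
    proof (intro AE_I2)
      fix x
      have "((\<lambda>h. (f (x + h *\<^sub>R b) - f x) / h) \<longlongrightarrow> f' x b) (at 0)"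
        using der_line[of x 0] by (simp add: DERIV_def)
      moreover have "filterlim (\<lambda>n. 1 / real (Suc n)) (at 0) sequentially"
        by (rule filterlim_atI) (use LIMSEQ_inverse_real_of_nat in \<open>auto simp: inverse_eq_divide\<close>)
      ultimately have "(\<lambda>n. (f (x + (1 / Suc n) *\<^sub>R b) - f x) / (1 / Suc n)) \<longlonglongrightarrow> f' x b"
        by (rule filterlim_compose)
      then show "(\<lambda>n. F n x) \<longlonglongrightarrow> f' x b" by (simp add: F_def)
    qed
    show "AE x in lebesgue. norm (F n x) \<le> B * indicator (cball 0 (R + norm b)) x" for n
    proof (intro AE_I2)
      fix x
      obtain t where t: "0 < t" "t < 1 / Suc n"
        "f (x + (1 / Suc n) *\<^sub>R b) - f (x + 0 *\<^sub>R b) = (1 / Suc n - 0) * f' (x + t *\<^sub>R b) b"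
        using MVT2[of 0 "1 / Suc n" "\<lambda>t. f (x + t *\<^sub>R b)", OF _ der_line] by auto
      have eq: "F n x = f' (x + t *\<^sub>R b) b"
        using t(3) unfolding F_def by simp
      show "norm (F n x) \<le> B * indicator (cball 0 (R + norm b)) x"
      proof (cases "norm x \<le> R + norm b")
        case True
        then show ?thesis using B(2) eq by simp
      next
        case False
        have "t \<le> 1"
          using t(2) by (rule order.trans[OF less_imp_le]) (simp add: divide_le_eq)
        then have "norm (t *\<^sub>R b) \<le> norm b"
          using t(1) by (simp add: mult_left_le_one_le)
        then have "norm (x + t *\<^sub>R b) > R"
          using False norm_diff_ineq[of x "t *\<^sub>R b"] by linarith
        then show ?thesis using supp' eq False by simp
      qed
    qed
  qed
  then show ?thesis
    using F0 LIMSEQ_unique by (simp add: LIMSEQ_const_iff)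
qed

text \<open>The previous lemma applied to the product of f and k, whose support is bounded because
  that of k is. Continuity of f' is asked only in the direction b, which suits compositions of a C^1
  function with a smooth one.\<close>

lemma integral_by_parts:
  fixes f :: "'a::euclidean_space \<Rightarrow> real"
  assumes der: "\<And>x. (f has_derivative f' x) (at x)" and cont: "continuous_on UNIV (\<lambda>x. f' x b)"
    and k: "k \<in> Cc_infinity UNIV" and b: "b \<in> Basis"
  shows "(LINT x|lebesgue. f x * frechet_derivative k (at x) b) = - (LINT x|lebesgue. f' x b * k x)"
proof -
  let ?k' = "\<lambda>x. frechet_derivative k (at x)"
  obtain R where R: "\<And>x. norm x > R \<Longrightarrow> k x = 0" "smooth k"
    using k by (auto simp: Cc_infinity_UNIV_iff)
  have k': "(\<lambda>x. ?k' x b) \<in> Cc_infinity UNIV"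
    by (rule Cc_infinity_frechet_derivative[OF k b])
  obtain R' where R': "\<And>x. norm x > R' \<Longrightarrow> ?k' x b = 0"
    using k' by (auto simp: Cc_infinity_UNIV_iff)
  have cf: "continuous_on UNIV f"
    by (intro continuous_at_imp_continuous_on ballI has_derivative_continuous[OF der])
  have I: "integrable lebesgue (\<lambda>x. g x * h x)"
    if "continuous_on UNIV g" "continuous_on UNIV h" "\<And>x. norm x > R \<Longrightarrow> h x
        = 0" for g h :: "'a \<Rightarrow> real" and R
  proof -
    have c: "continuous_on UNIV (\<lambda>x. g x * h x)" and s: "norm x > R \<Longrightarrow> g x * h x = 0" for x
      using that by (auto intro: continuous_intros)
    obtain B where "\<And>x. \<bar>g x * h x\<bar> \<le> B"
      using continuous_compact_support_bounded[OF c s] by blast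
    then show ?thesis
      by (rule integrable_bounded_support[OF borel_measurable_continuous_lebesgue[OF c] _ s])
  qed
  have "(LINT x|lebesgue. f x * ?k' x b + f' x b * k x) = 0"
  proof (rule integral_derivative_eq_0[where f = "\<lambda>x. f x * k x" and R = R
        and f' = "\<lambda>x h. f x * ?k' x h + f' x h * k x"])
    show "((\<lambda>x. f x * k x) has_derivative (\<lambda>h. f x * ?k' x h + f' x h * k x)) (at x)" for x
      by (intro has_derivative_mult der smooth_has_derivative R)
    show "continuous_on UNIV (\<lambda>x. f x * ?k' x b + f' x b * k x)"
      by (intro continuous_intros cf cont smooth_continuous R Cc_infinity_smooth[OF k'])
  qed (use R in auto)
  moreover have "(LINT x|lebesgue. f x * ?k' x b + f' x b * k x)
      = (LINT x|lebesgue. f x * ?k' x b) + (LINT x|lebesgue. f' x b * k x)"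
    by (intro Bochner_Integration.integral_add I[where R = R] I[where R = R'] cf cont smooth_continuous
        R Cc_infinity_smooth[OF k'] R')
  ultimately show ?thesis by simp
qed

lemma integral_frechet_derivative_eq_0:
  assumes "k \<in> Cc_infinity UNIV" "b \<in> Basis"
  shows "(LINT x|lebesgue. frechet_derivative k (at x) b) = 0"
  using integral_by_parts[of "\<lambda>_. 1" "\<lambda>_ _. 0" b k] assms by simp

text \<open>Dividing by the integral of the rescaled bump, rather than by a power of s, makes unit
  mass immediate without a change of variables; the power of s reappears as the bound in
  \<open>mollifier_bounds\<close>.\<close>

definition mollifier :: "real \<Rightarrow> 'a::euclidean_space \<Rightarrow> real" where
  "mollifier s x = bump (x /\<^sub>R s) / (LINT z|lebesgue. bump ((z::'a) /\<^sub>R s))"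

lemma bump_Cc_infinity: "bump \<in> Cc_infinity UNIV"
  unfolding Cc_infinity_UNIV_iff using smooth_bump bump_eq_0 by (meson less_imp_le)

lemma bump_scaled_Cc_infinity: "s > 0 \<Longrightarrow> (\<lambda>x. bump (x /\<^sub>R s)) \<in> Cc_infinity UNIV"
  using Cc_infinity_UNIV_affine[OF bump_Cc_infinity, of "inverse s" 0] by simp

lemma content_cball_DIM:
  "r \<ge> 0 \<Longrightarrow> measure lebesgue (cball (c::'a::euclidean_space) r)
      = unit_ball_vol (DIM('a)) * r ^ DIM('a)"
  using content_cball[of r c] by simp

lemma emeasure_cball_finite: "emeasure lebesgue (cball (c::'a::euclidean_space) r) < \<infinity>"
  by (metis lmeasurable_cball fmeasurableD2 infinity_ennreal_def less_top)

text \<open>The bump is bounded below on the ball of radius 3s/4, whose volume supplies the power of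
  s.\<close>

lemma integral_bump_ge:
  assumes "s > 0"
  shows "(LINT z|lebesgue. bump ((z::'a::euclidean_space) /\<^sub>R s))
     \<ge> exp (- 16/7) * unit_ball_vol (DIM('a)) * (3/4) ^ DIM('a) * s ^ DIM('a)"
proof -
  have "(LINT z|lebesgue. exp (- 16/7) * indicator (cball (0::'a) (3/4 * s)) z)
      \<le> (LINT z|lebesgue. bump ((z::'a) /\<^sub>R s))"
  proof (rule integral_mono)
    show "integrable lebesgue (\<lambda>z::'a. exp (- 16/7) * indicator (cball 0 (3/4 * s)) z :: real)"
      using emeasure_cball_finite[of "0::'a"] by simp
    show "integrable lebesgue (\<lambda>z::'a. bump (z /\<^sub>R s))"
      by (rule Cc_infinity_integrable[OF bump_scaled_Cc_infinity[OF assms]])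
    fix z :: 'a
    show "exp (- 16/7) * indicator (cball 0 (3/4 * s)) z \<le> bump (z /\<^sub>R s)"
    proof (cases "norm z \<le> 3/4 * s")
      case True
      then have "norm (z /\<^sub>R s) \<le> 3/4"
        using assms by (simp add: field_simps)
      from bump_ge[OF this] True show ?thesis by simp
    qed (simp add: bump_nonneg)
  qed
  moreover have "(LINT z|lebesgue. exp (- 16/7) * indicator (cball (0::'a) (3/4 * s)) z)
      = exp (- 16/7) * measure lebesgue (cball (0::'a) (3/4 * s))"
    by simp
  moreover have "measure lebesgue (cball (0::'a) (3/4 * s)) = unit_ball_vol (DIM('a)) * (3/4 * s) ^ DIM('a)"
    using assms by (intro content_cball_DIM) simp
  ultimately show ?thesis
    by (simp only: power_mult_distrib mult.assoc)
qed

lemma integral_bump_pos: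
  assumes "s > 0" shows "(LINT z|lebesgue. bump ((z::'a::euclidean_space) /\<^sub>R s)) > 0"
  by (rule less_le_trans[OF _ integral_bump_ge[OF assms]]) (use assms in \<open>simp add: unit_ball_vol_def\<close>)

lemma mollifier_Cc_infinity: "s > 0 \<Longrightarrow> mollifier s \<in> Cc_infinity UNIV"
proof -
  assume s: "s > 0"
  have "smooth (\<lambda>_::'a. inverse (LINT z|lebesgue. bump ((z::'a) /\<^sub>R s)))"
    by (simp add: smooth_def Ck_fun_const)
  from Cc_infinity_mult[OF bump_scaled_Cc_infinity[OF s] this]
  show ?thesis by (simp add: mollifier_def[abs_def] divide_inverse)
qed

lemma mollifier_nonneg: "s > 0 \<Longrightarrow> mollifier s x \<ge> 0"
  using integral_bump_pos[of s] by (simp add: mollifier_def bump_nonneg order.strict_implies_order)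

lemma mollifier_eq_0: "s > 0 \<Longrightarrow> norm x \<ge> s \<Longrightarrow> mollifier s x = 0"
  by (simp add: mollifier_def bump_eq_0 field_simps)

lemma integral_mollifier: "s > 0 \<Longrightarrow> (LINT x|lebesgue. mollifier s x) = 1"
  using integral_bump_pos[of s, where 'a = 'a] by (simp add: mollifier_def)

lemma integral_mollifier_shift: 
  "s > 0 \<Longrightarrow> (LINT z|lebesgue. mollifier s (x - z)) = 1"
  using integral_affine_unit[of "mollifier s" "-1" x] integral_mollifier[of s, where 'a = 'a]
    smooth_continuous[OF Cc_infinity_smooth[OF mollifier_Cc_infinity[of s]]]
  by simp

lemma mollifier_bounds:
  obtains C :: real where "C > 0"
    "\<And>s (x::'a::euclidean_space). s > 0 \<Longrightarrow> mollifier s x \<le> C / s ^ DIM('a)"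
    "\<And>s b (x::'a). s > 0 \<Longrightarrow> b \<in> Basis \<Longrightarrow>
        \<bar>frechet_derivative (mollifier s) (at x) b\<bar> \<le> C / s ^ (DIM('a) + 1)"
proof -
  let ?n = "DIM('a)"
  let ?D = "\<lambda>b y::'a. frechet_derivative bump (at y) b"
  have "\<exists>B>0. \<forall>x. \<bar>?D b x\<bar> \<le> B" if "b \<in> Basis" for b
    using Cc_infinity_UNIV_bounded[OF Cc_infinity_frechet_derivative[OF bump_Cc_infinity that]] by metis
  then obtain B where B: "\<And>b. b \<in> Basis \<Longrightarrow>
      B b > 0" "\<And>b x. b \<in> Basis \<Longrightarrow> \<bar>?D b x\<bar> \<le> B b"
    by metis
  \<comment> \<open>The summand 1 lets \<open>B0\<close> bound the values of the bump along with all
    its partial derivatives.\<close>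
  define B0 where "B0 = 1 + (\<Sum>b\<in>(Basis::'a set). B b)"
  have "B b \<le> (\<Sum>b\<in>(Basis::'a set). B b)" if "b \<in> Basis" for b
    using B(1) that by (intro member_le_sum) (auto intro: less_imp_le)
  moreover have "(\<Sum>b\<in>(Basis::'a set). B b) \<ge> 0"
    using B(1) by (intro sum_nonneg) (auto intro: less_imp_le)
  ultimately have B0: "B0 \<ge> 1" and B0': "\<bar>?D b x\<bar> \<le> B0" if "b \<in> Basis" for b x
    unfolding B0_def using B(2)[OF that, of x] that by fastforce+
  define A where "A = exp (- 16/7) * unit_ball_vol (real ?n) * (3/4) ^ ?n"
  have A: "A > 0" by (simp add: A_def unit_ball_vol_def)
  show thesis
  proof (rule that[of "B0 / A"])
    show "B0 / A > 0" using A B0[OF SOME_Basis] by simp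
    fix s :: real assume s: "s > 0"
    let ?I = "LINT z|lebesgue. bump ((z::'a) /\<^sub>R s)"
    have I: "?I \<ge> A * s ^ ?n" "?I > 0"
      using integral_bump_ge[OF s, where 'a = 'a] integral_bump_pos[OF s, where 'a = 'a] by (auto simp: A_def)
    have As: "A * s ^ ?n > 0" using A s by simp
    have le: "t / ?I \<le> B0 / (A * s ^ ?n)" if "0 \<le> t" "t \<le> B0" for t
      using that I As by (intro frac_le) auto
    show "mollifier s x \<le> B0 / A / s ^ ?n" for x :: 'a
    proof -
      have "bump (x /\<^sub>R s) \<le> B0" using bump_le[of "x /\<^sub>R s"] B0[OF SOME_Basis] by linarith
      from le[OF bump_nonneg this] show ?thesis by (simp add: mollifier_def mult.commute)
    qed
    show "\<bar>frechet_derivative (mollifier s) (at x) b\<bar>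
        \<le> B0 / A / s ^ (?n + 1)" if b: "b \<in> Basis" for b x :: 'a
    proof -
      have "((\<lambda>x::'a. x /\<^sub>R s) has_derivative (\<lambda>h. h /\<^sub>R s)) (at x)"
        by (intro derivative_intros)
      from has_derivative_compose[OF this smooth_has_derivative[OF smooth_bump]]
      have "((\<lambda>x. bump (x /\<^sub>R s) / ?I) has_derivative (\<lambda>h. frechet_derivative bump (at (x /\<^sub>R s)) (h /\<^sub>R s) / ?I)) (at x)"
        using I(2) by (intro bounded_linear.has_derivative[OF bounded_linear_divide])
      then have "frechet_derivative (mollifier s) (at x) b
          = frechet_derivative bump (at (x /\<^sub>R s)) (b /\<^sub>R s) / ?I"
        unfolding mollifier_def[abs_def] using frechet_derivative_at by metis
      also have "\<dots> = ?D b (x /\<^sub>R s) / ?I / s"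
        using linear_cmul[OF has_derivative_linear[OF smooth_has_derivative[OF smooth_bump]], of "x /\<^sub>R s" "inverse s" b]
        by (simp add: field_simps)
      finally have "\<bar>frechet_derivative (mollifier s) (at x) b\<bar> = \<bar>?D b (x /\<^sub>R s)\<bar> / ?I / s"
        using I(2) s by (simp add: abs_mult)
      also have "\<dots> \<le> B0 / (A * s ^ ?n) / s"
        using s le[OF abs_ge_zero B0'[OF b]] by (intro divide_right_mono) auto
      finally show ?thesis by (simp add: field_simps)
    qed
  qed
qed

lemma conv_mollifier_smooth: "s > 0 \<Longrightarrow> integrable lebesgue f \<Longrightarrow>
    smooth (conv (mollifier s) f)"
  by (rule conv_smooth[OF mollifier_Cc_infinity])

subsection \<open>Approximation in the mean\<close>

lemma integral_norm_bound_LIMSEQ: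
  fixes f :: "'a \<Rightarrow> real"
  assumes lim: "AE x in M. (\<lambda>n. g n x) \<longlonglongrightarrow> f x"
    and meas: "f \<in> borel_measurable M" "\<And>n. g n \<in> borel_measurable M"
    and dom: "integrable M w" "\<And>n. AE x in M. \<bar>g n x\<bar> \<le> w x"
  shows "(\<lambda>n. LINT x|M. \<bar>f x - g n x\<bar>) \<longlonglongrightarrow> 0"
proof -
  have bd: "AE x in M. \<bar>f x\<bar> \<le> w x"
  proof -
    have "AE x in M. \<forall>n. \<bar>g n x\<bar> \<le> w x" using dom(2) by (simp add: AE_all_countable)
    with lim show ?thesis
    proof eventually_elim
      case (elim x)
      then have "(\<lambda>n. \<bar>g n x\<bar>) \<longlonglongrightarrow> \<bar>f x\<bar>" by (intro tendsto_rabs)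
      then show ?case using elim(2) by (intro LIMSEQ_le_const2) auto
    qed
  qed
  have "(\<lambda>n. LINT x|M. \<bar>f x - g n x\<bar>) \<longlonglongrightarrow> (LINT x|M. 0)"
  proof (rule integral_dominated_convergence[where w = "\<lambda>x. 2 * w x"])
    show "AE x in M. (\<lambda>n. \<bar>f x - g n x\<bar>) \<longlonglongrightarrow> 0"
      using lim by eventually_elim (auto intro!: tendsto_eq_intros)
    show "AE x in M. norm \<bar>f x - g n x\<bar> \<le> 2 * w x" for n
      using bd dom(2)[of n] by eventually_elim auto
  qed (use meas dom in auto)
  then show ?thesis by simp
qed

text \<open>Density of compactly supported continuous functions in L^1. First f is truncated in
  range and in space; then measurability provides continuous functions converging to the truncation
  off a null set, which are clamped and cut off to have a common integrable majorant.\<close>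

lemma integrable_approx_continuous:
  fixes f :: "'a::euclidean_space \<Rightarrow> real"
  assumes f: "integrable lebesgue f" and e: "e > 0"
  obtains g R where "continuous_on UNIV g" "\<And>x. norm x > R \<Longrightarrow> g x = 0"
    "(LINT x|lebesgue. \<bar>f x - g x\<bar>) < e"
proof -
  define fm where "fm m x = (if norm x \<le> real m then max (- real m) (min (real m) (f x)) else 0)" for m x
  have [measurable]: "f \<in> borel_measurable lebesgue" using f by auto
  have [measurable]: "(\<lambda>x::'a. x) \<in> borel_measurable lebesgue"
    by (rule borel_measurable_continuous_lebesgue[OF continuous_on_id])
  have [measurable]: "fm m \<in> borel_measurable lebesgue" for m
    unfolding fm_def by measurable
  have "(\<lambda>m. LINT x|lebesgue. \<bar>f x - fm m x\<bar>) \<longlonglongrightarrow> 0"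
  proof (rule integral_norm_bound_LIMSEQ[where w = "\<lambda>x. \<bar>f x\<bar>"])
    show "AE x in lebesgue. (\<lambda>m. fm m x) \<longlonglongrightarrow> f x"
    proof (intro AE_I2 tendsto_eventually)
      fix x
      obtain m0 :: nat where m0: "max (norm x) \<bar>f x\<bar> \<le> real m0" using real_arch_simple by blast
      then show "\<forall>\<^sub>F m in sequentially. fm m x = f x"
        by (intro eventually_sequentiallyI[of m0]) (auto simp: fm_def)
    qed
  qed (use f in \<open>auto simp: fm_def\<close>)
  then obtain m where m: "(LINT x|lebesgue. \<bar>f x - fm m x\<bar>) < e / 2"
    using e by (metis (no_types, lifting) LIMSEQ_le_const half_gt_zero linorder_not_le order_refl)
  have "fm m measurable_on UNIV"
    by (rule lebesgue_measurable_imp_measurable_on_real) auto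
  then obtain N h where N: "negligible N" and ch: "\<And>n. continuous_on UNIV (h n)"
    and lim: "\<And>x. x \<notin> N \<Longrightarrow> (\<lambda>n. h n x) \<longlonglongrightarrow> fm m x"
    unfolding measurable_on_def by auto
  \<comment> \<open>A continuous cutoff, equal to 1 on the ball of radius m, where the truncation
    lives, and to 0 beyond radius m + 1.\<close>
  define c where "c x = max 0 (min 1 (real m + 1 - norm x))" for x :: 'a
  define g where "g n x = c x * max (- real m) (min (real m) (h n x))" for n x
  have cg: "continuous_on UNIV (g n)" for n
    unfolding g_def c_def by (intro continuous_intros ch)
  have c: "0 \<le> c x" "c x \<le> 1" "norm x \<le> m \<Longrightarrow> c x = 1" "norm x > m + 1 \<Longrightarrow>
      c x = 0" for x
    by (auto simp: c_def)
  have bd: "\<bar>g n x\<bar> \<le> real m" for n x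
  proof -
    have "\<bar>max (- real m) (min (real m) (h n x))\<bar> \<le> real m" by auto
    with c(1,2)[of x] mult_mono[of "c x" 1 _ "real m"] show ?thesis
      unfolding g_def abs_mult by auto
  qed
  have ig: "integrable lebesgue (g n)" for n
    by (rule integrable_bounded_support[OF borel_measurable_continuous_lebesgue[OF cg] bd, of "m + 1"])
      (simp add: g_def c(4))
  have "(\<lambda>n. LINT x|lebesgue. \<bar>fm m x - g n x\<bar>) \<longlonglongrightarrow> 0"
  proof (rule integral_norm_bound_LIMSEQ[where w = "\<lambda>x. real m * indicator (cball 0 (m + 1)) x"])
    have ae: "AE x in lebesgue. x \<notin> N"
      using N by (auto simp: negligible_iff_null_sets intro: AE_not_in)
    show "AE x in lebesgue. (\<lambda>n. g n x) \<longlonglongrightarrow> fm m x"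
      using ae
    proof eventually_elim
      case (elim x)
      have "(\<lambda>n. g n x) \<longlonglongrightarrow> c x * max (- real m) (min (real m) (fm m x))"
        unfolding g_def by (intro tendsto_intros lim elim)
      also have "c x * max (- real m) (min (real m) (fm m x)) = fm m x"
        using c(3) by (auto simp: fm_def)
      finally show ?case .
    qed
    show "AE x in lebesgue. \<bar>g n x\<bar> \<le> real m * indicator (cball 0 (m + 1)) x" for n
    proof (intro AE_I2)
      fix x :: 'a
      show "\<bar>g n x\<bar> \<le> real m * indicator (cball 0 (m + 1)) x"
        using bd[of n x] c(4)[of x] by (cases "norm x \<le> m + 1") (auto simp: g_def)
    qed
    show "integrable lebesgue (\<lambda>x::'a. real m * indicator (cball 0 (m + 1)) x)"
      using emeasure_cball_finite[of "0::'a"] by simp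
  qed (use ig in auto)
  then obtain n where n: "(LINT x|lebesgue. \<bar>fm m x - g n x\<bar>) < e / 2"
    using e by (metis (no_types, lifting) LIMSEQ_le_const half_gt_zero linorder_not_le order_refl)
  have ifm: "integrable lebesgue (fm m)"
    by (rule integrable_bounded_support[of _ "real m" "real m"]) (auto simp: fm_def)
  have "(LINT x|lebesgue. \<bar>f x - g n x\<bar>)
      \<le> (LINT x|lebesgue. \<bar>f x - fm m x\<bar> + \<bar>fm m x - g n x\<bar>)"
    by (rule integral_mono) (use f ifm ig in auto)
  also have "\<dots> = (LINT x|lebesgue. \<bar>f x - fm m x\<bar>) + (LINT x|lebesgue. \<bar>fm m x - g n x\<bar>)"
    using f ifm ig by simp
  also have "\<dots> < e" using m n by simp
  finally show ?thesis
    using that[of "g n" "m + 1"] cg by (simp add: g_def c(4))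
qed

text \<open>Tonelli: after exchanging the integrals only the mass of x \<mapsto> |k(T x - z)|
  matters, uniformly in z. Stating this mass as a hypothesis replaces a change of variables under
  T.\<close>

lemma conv_L1_bound:
  fixes f :: "'a::euclidean_space \<Rightarrow> real" and T :: "'a \<Rightarrow> 'a"
  assumes f: "integrable lebesgue f" and k: "k \<in> Cc_infinity UNIV" and T: "continuous_on UNIV T"
    and B: "B \<ge> 0" "\<And>z. (\<integral>\<^sup>+ x. ennreal \<bar>k (T x - z)\<bar> \<partial>lebesgue)
        \<le> ennreal B"
  shows "integrable lebesgue (\<lambda>x. conv k f (T x))"
    and "(LINT x|lebesgue. \<bar>conv k f (T x)\<bar>) \<le> B * (LINT x|lebesgue. \<bar>f x\<bar>)"
proof -
  interpret sigma_finite_measure "lebesgue :: 'a measure" by (rule sigma_finite_lebesgue)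
  interpret pair_sigma_finite "lebesgue :: 'a measure" "lebesgue :: 'a measure" ..
  have ck: "continuous_on UNIV k" by (rule smooth_continuous[OF Cc_infinity_smooth[OF k]])
  have mf [measurable]: "f \<in> borel_measurable lebesgue" using f by auto
  have meas: "(\<lambda>x. conv k f (T x)) \<in> borel_measurable lebesgue"
    by (intro borel_measurable_continuous_lebesgue
        continuous_on_compose2[OF smooth_continuous[OF conv_smooth[OF k f]] T]) auto
  \<comment> \<open>The product of the Lebesgue sigma-algebras is finer than the Borel one, so joint
    continuity of the integrand suffices.\<close>
  have mk: "(\<lambda>p. k (T (fst p) - snd p)) \<in> borel_measurable (lebesgue \<Otimes>\<^sub>M lebesgue)"
  proof -
    have "continuous_on UNIV (\<lambda>p. k (T (fst p) - snd p))"
      by (intro continuous_on_compose2[OF ck] continuous_on_compose2[OF T] continuous_intros) auto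
    then have "(\<lambda>p. k (T (fst p) - snd p)) \<in> borel_measurable (borel \<Otimes>\<^sub>M borel)"
      by (simp add: borel_prod borel_measurable_continuous_onI)
    moreover have "(\<lambda>p. p) \<in> measurable (lebesgue \<Otimes>\<^sub>M lebesgue) ((borel :: 'a measure) \<Otimes>\<^sub>M (borel :: 'a measure))"
    proof (rule measurable_pair)
      have id: "(\<lambda>x::'a. x) \<in> measurable lebesgue borel" by (intro measurable_completion) simp
      show "fst \<circ> (\<lambda>p. p) \<in> measurable (lebesgue \<Otimes>\<^sub>M lebesgue) (borel :: 'a measure)"
        using measurable_compose[OF measurable_fst id] by (simp add: comp_def)
      show "snd \<circ> (\<lambda>p. p) \<in> measurable (lebesgue \<Otimes>\<^sub>M lebesgue) (borel :: 'a measure)"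
        using measurable_compose[OF measurable_snd id] by (simp add: comp_def)
    qed
    ultimately show ?thesis
      using measurable_compose by blast
  qed
  have "(\<integral>\<^sup>+ x. ennreal \<bar>conv k f (T x)\<bar> \<partial>lebesgue)
      \<le> (\<integral>\<^sup>+ x. (\<integral>\<^sup>+ z. ennreal \<bar>k (T x - z)\<bar> * ennreal \<bar>f z\<bar> \<partial>lebesgue) \<partial>lebesgue)"
  proof (rule nn_integral_mono)
    fix x
    have "ennreal \<bar>conv k f (T x)\<bar>
        \<le> (\<integral>\<^sup>+ z. ennreal (norm (k (T x - z) * f z)) \<partial>lebesgue)"
      using integral_norm_bound_ennreal[OF conv_integrable[OF k f, of "T x"]] by (simp add: conv_def)
    also have "\<dots> = (\<integral>\<^sup>+ z. ennreal \<bar>k (T x - z)\<bar> * ennreal \<bar>f z\<bar> \<partial>lebesgue)"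
      by (intro nn_integral_cong) (simp add: abs_mult ennreal_mult)
    finally show "ennreal \<bar>conv k f (T x)\<bar>
        \<le> (\<integral>\<^sup>+ z. ennreal \<bar>k (T x - z)\<bar> * ennreal \<bar>f z\<bar> \<partial>lebesgue)" .
  qed
  also have "\<dots> = (\<integral>\<^sup>+ z. (\<integral>\<^sup>+ x. ennreal \<bar>k (T x - z)\<bar> * ennreal \<bar>f z\<bar> \<partial>lebesgue) \<partial>lebesgue)"
  proof (rule Fubini'[of "\<lambda>x z. ennreal \<bar>k (T x - z)\<bar> * ennreal \<bar>f z\<bar>", symmetric])
    have "(\<lambda>p. ennreal \<bar>k (T (fst p) - snd p)\<bar> * ennreal \<bar>f (snd p)\<bar>) \<in> borel_measurable (lebesgue \<Otimes>\<^sub>M lebesgue)"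
      using mk by measurable
    then show "(\<lambda>(x, z). ennreal \<bar>k (T x - z)\<bar> * ennreal \<bar>f z\<bar>) \<in> borel_measurable (lebesgue \<Otimes>\<^sub>M lebesgue)"
      by (simp add: case_prod_beta)
  qed
  also have "\<dots> = (\<integral>\<^sup>+ z. (\<integral>\<^sup>+ x. ennreal \<bar>k (T x - z)\<bar> \<partial>lebesgue) * ennreal \<bar>f z\<bar> \<partial>lebesgue)"
  proof (intro nn_integral_cong nn_integral_multc)
    fix z
    have "(\<lambda>x. k (T x - z)) \<in> borel_measurable lebesgue"
      by (intro borel_measurable_continuous_lebesgue continuous_on_compose2[OF ck] continuous_intros T) auto
    then show "(\<lambda>x. ennreal \<bar>k (T x - z)\<bar>) \<in> borel_measurable lebesgue" by measurable
  qed
  also have "\<dots> \<le> (\<integral>\<^sup>+ z. ennreal B * ennreal \<bar>f z\<bar> \<partial>lebesgue)"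
    by (intro nn_integral_mono mult_right_mono B) auto
  also have "\<dots> = ennreal (B * (LINT x|lebesgue. \<bar>f x\<bar>))"
    using f B(1) by (simp add: nn_integral_cmult nn_integral_eq_integral ennreal_mult)
  finally have fin: "(\<integral>\<^sup>+ x. ennreal \<bar>conv k f (T x)\<bar> \<partial>lebesgue)
      \<le> ennreal (B * (LINT x|lebesgue. \<bar>f x\<bar>))" .
  show I: "integrable lebesgue (\<lambda>x. conv k f (T x))"
    using meas fin by (intro integrableI_bounded) (auto simp: less_top[symmetric] top_unique)
  show "(LINT x|lebesgue. \<bar>conv k f (T x)\<bar>) \<le> B * (LINT x|lebesgue. \<bar>f x\<bar>)"
    using fin I B(1) by (simp add: nn_integral_eq_integral)
qed

text \<open>If T shrinks distances by at most the factor 2, the preimage of an s-ball lies in a ball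
  of radius 4s. Its volume cancels the supremum of the mollifier, of order s^(-n), so the bound is
  uniform in s, T and z and no Jacobian occurs.\<close>

lemma mollifier_nn_integral_bound:
  "\<exists>B\<ge>0. \<forall>s (T :: 'a::euclidean_space \<Rightarrow> 'a) z. s > 0
      \<longrightarrow> (\<forall>x y. norm (x - y) \<le> 2 * norm (T x - T y)) \<longrightarrow>
     (\<integral>\<^sup>+ x. ennreal \<bar>mollifier s (T x - z)\<bar> \<partial>lebesgue) \<le> ennreal B"
proof -
  obtain C :: real where C: "C > 0" "\<And>s (x::'a). s > 0 \<Longrightarrow> mollifier s x \<le> C / s ^ DIM('a)"
    by (rule mollifier_bounds[where 'a = 'a]) (rule that, assumption+)
  let ?B = "C * (unit_ball_vol (DIM('a)) * 4 ^ DIM('a))"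
  show ?thesis
  proof (intro exI[of _ ?B] conjI allI impI)
    show "0 \<le> ?B" using C by (simp add: unit_ball_vol_def)
    fix s :: real and z and T :: "'a \<Rightarrow> 'a"
    assume s: "s > 0" and "\<forall>x y. norm (x - y) \<le> 2 * norm (T x - T y)"
    then have T: "norm (x - y) \<le> 2 * norm (T x - T y)" for x y by blast
    show "(\<integral>\<^sup>+ x. ennreal \<bar>mollifier s (T x - z)\<bar> \<partial>lebesgue) \<le> ennreal ?B"
    proof (cases "\<exists>x0. norm (T x0 - z) < s")
      case False
      then have "mollifier s (T x - z) = 0" for x
        by (meson False mollifier_eq_0[OF s] not_less)
      then show ?thesis by simp
    next
      case True
      then obtain x0 where x0: "norm (T x0 - z) < s" by blast
      have "(\<integral>\<^sup>+ x. ennreal \<bar>mollifier s (T x - z)\<bar> \<partial>lebesgue) \<le>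
          (\<integral>\<^sup>+ x. ennreal (C / s ^ DIM('a)) * indicator (cball x0 (4 * s)) x \<partial>lebesgue)"
      proof (rule nn_integral_mono)
        fix x
        show "ennreal \<bar>mollifier s (T x - z)\<bar>
            \<le> ennreal (C / s ^ DIM('a)) * indicator (cball x0 (4 * s)) x"
        proof (cases "norm (T x - z) < s")
          case True
          have "norm (T x - T x0) \<le> norm (T x - z) + norm (T x0 - z)"
            using norm_triangle_ineq4[of "T x - z" "T x0 - z"] by simp
          then have "norm (x - x0) \<le> 4 * s" using T[of x x0] True x0 by linarith
          then have "x \<in> cball x0 (4 * s)" by (simp add: dist_norm norm_minus_commute)
          then show ?thesis
            using C(2)[OF s, of "T x - z"] mollifier_nonneg[OF s, of "T x - z"] by (simp add: ennreal_leI)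
        next
          case False
          then show ?thesis using mollifier_eq_0[OF s, of "T x - z"] by simp
        qed
      qed
      also have "\<dots> = ennreal (C / s ^ DIM('a)) * emeasure lebesgue (cball x0 (4 * s))"
        by (simp add: nn_integral_cmult_indicator)
      also have "\<dots> = ennreal (C / s ^ DIM('a) * (unit_ball_vol (DIM('a)) * (4 * s) ^ DIM('a)))"
      proof -
        have "emeasure lebesgue (cball x0 (4 * s)) = ennreal (unit_ball_vol (DIM('a)) * (4 * s) ^ DIM('a))"
          using emeasure_cball[of "4 * s" x0] s by simp
        then show ?thesis
          using s C by (simp only:) (intro ennreal_mult[symmetric]; simp add: unit_ball_vol_def)
      qed
      also have "C / s ^ DIM('a) * (unit_ball_vol (DIM('a)) * (4 * s) ^ DIM('a)) = ?B"
        using s by (simp add: power_mult_distrib)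
      finally show ?thesis .
    qed
  qed
qed

text \<open>A mollification is an average over the s-ball. The case e = 0 is also used, for
  functions that are constant on that ball.\<close>

lemma conv_mollifier_close:
  fixes g :: "'a::euclidean_space \<Rightarrow> real"
  assumes s: "s > 0" and g: "integrable lebesgue g"
    and close: "\<And>z. norm (y - z) \<le> s \<Longrightarrow> \<bar>g z - c\<bar> \<le> e"
  shows "\<bar>conv (mollifier s) g y - c\<bar> \<le> e"
proof -
  have k: "mollifier s \<in> Cc_infinity (UNIV :: 'a set)" by (rule mollifier_Cc_infinity[OF s])
  have I: "integrable lebesgue (\<lambda>z. mollifier s (y - z))"
    by (rule Cc_infinity_integrable[OF Cc_infinity_reflect[OF k]])
  have "conv (mollifier s) g y - c = (LINT z|lebesgue. mollifier s (y - z) * g z - mollifier s (y - z) * c)"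
    unfolding conv_def using I conv_integrable[OF k g, of y] integral_mollifier_shift[OF s, of y]
    by simp
  also have "\<bar>\<dots>\<bar> \<le> (LINT z|lebesgue. mollifier s (y - z) * e)"
  proof -
    have "norm (LINT z|lebesgue. mollifier s (y - z) * g z - mollifier s (y - z) * c)
        \<le> (LINT z|lebesgue. mollifier s (y - z) * e)"
    proof (rule Bochner_Integration.integral_norm_bound_integral)
      fix z
      have "norm (mollifier s (y - z) * g z - mollifier s (y - z) * c) = mollifier s (y - z) * \<bar>g z - c\<bar>"
        using mollifier_nonneg[OF s, of "y - z"] by (simp add: abs_mult flip: right_diff_distrib)
      also have "\<dots> \<le> mollifier s (y - z) * e"
        using close[of z] mollifier_nonneg[OF s, of "y - z"] mollifier_eq_0[OF s, of "y - z"]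
        by (cases "norm (y - z) \<le> s") (auto intro: mult_left_mono)
      finally show "norm (mollifier s (y - z) * g z - mollifier s (y - z) * c) \<le> mollifier s (y - z) * e" .
    qed (use I conv_integrable[OF k g, of y] in auto)
    then show ?thesis by simp
  qed
  also have "\<dots> = e" using integral_mollifier_shift[OF s, of y] by simp
  finally show ?thesis .
qed

lemma conv_mollifier_support:
  assumes s: "s > 0" and g: "\<And>z. norm (y - z) \<le> s \<Longrightarrow> g z = 0"
  shows "conv (mollifier s) g y = 0"
proof -
  have "mollifier s (y - z) * g z = 0" for z
    using g[of z] mollifier_eq_0[OF s, of "y - z"] by (cases "norm (y - z) \<le> s") auto
  then have "(\<lambda>z. mollifier s (y - z) * g z) = (\<lambda>z. 0)" by blast
  then show ?thesis unfolding conv_def by simp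
qed

lemma conv_mollifier_compose_integrable:
  fixes f :: "'a::euclidean_space \<Rightarrow> real" and T :: "'a \<Rightarrow> 'a"
  assumes "integrable lebesgue f" "s > 0" "continuous_on UNIV T"
    "\<And>x y. norm (x - y) \<le> 2 * norm (T x - T y)"
  shows "integrable lebesgue (\<lambda>x. conv (mollifier s) f (T x))"
proof -
  obtain B where "B \<ge> 0" and "\<forall>s (T :: 'a \<Rightarrow> 'a) z. s > 0
      \<longrightarrow> (\<forall>x y. norm (x - y) \<le> 2 * norm (T x - T y)) \<longrightarrow>
       (\<integral>\<^sup>+ x. ennreal \<bar>mollifier s (T x - z)\<bar> \<partial>lebesgue) \<le> ennreal B"
    using mollifier_nn_integral_bound[where 'a = 'a] by blast
  then have B: "B \<ge> 0" "s > 0 \<Longrightarrow> (\<And>x y. norm (x - y)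
      \<le> 2 * norm (T x - T y)) \<Longrightarrow>
       (\<integral>\<^sup>+ x. ennreal \<bar>mollifier s (T x - z)\<bar> \<partial>lebesgue)
           \<le> ennreal B" for s z and T :: "'a \<Rightarrow> 'a"
    by simp_all
  show ?thesis
    by (rule conv_L1_bound(1)[OF assms(1) mollifier_Cc_infinity[OF assms(2)] assms(3) B(1) B(2)[OF assms(2,4)]])
qed

text \<open>The operators f \<mapsto> (mollified f) \<circ> T n are uniformly bounded on L^1, so it
  is enough to know convergence for continuous g of bounded support, where uniform continuity gives
  it.\<close>

lemma conv_mollifier_L1:
  fixes f :: "'a::euclidean_space \<Rightarrow> real" and T :: "nat \<Rightarrow> 'a \<Rightarrow> 'a"
  assumes f: "integrable lebesgue f"
    and s: "\<And>n. s n > 0" "s \<longlonglongrightarrow> 0" and d: "d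
        \<longlonglongrightarrow> 0" "\<And>n x. norm (T n x - x) \<le> d n"
    and T: "\<And>n. continuous_on UNIV (T n)" "\<And>n x y. norm (x - y) \<le> 2 * norm (T n x - T n y)"
  shows "(\<lambda>n. LINT x|lebesgue. \<bar>conv (mollifier (s n)) f (T n x) - f x\<bar>) \<longlonglongrightarrow> 0"
proof -
  let ?S = "\<lambda>n f x. conv (mollifier (s n)) f (T n x)"
  obtain B where "B \<ge> 0" and "\<forall>s (T :: 'a \<Rightarrow> 'a) z. s > 0
      \<longrightarrow> (\<forall>x y. norm (x - y) \<le> 2 * norm (T x - T y)) \<longrightarrow>
       (\<integral>\<^sup>+ x. ennreal \<bar>mollifier s (T x - z)\<bar> \<partial>lebesgue) \<le> ennreal B"
    using mollifier_nn_integral_bound[where 'a = 'a] by blast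
  then have B: "B \<ge> 0" "s > 0 \<Longrightarrow> (\<And>x y. norm (x - y)
      \<le> 2 * norm (T x - T y)) \<Longrightarrow>
       (\<integral>\<^sup>+ x. ennreal \<bar>mollifier s (T x - z)\<bar> \<partial>lebesgue)
           \<le> ennreal B" for s z and T :: "'a \<Rightarrow> 'a"
    by simp_all
  have SI: "integrable lebesgue (?S n h)" and SB: "(LINT x|lebesgue. \<bar>?S n h x\<bar>)
      \<le> B * (LINT x|lebesgue. \<bar>h x\<bar>)"
    if "integrable lebesgue h" for n and h :: "'a \<Rightarrow> real"
    using conv_L1_bound[OF that mollifier_Cc_infinity[OF s(1)] T(1) B(1) B(2)[OF s(1) T(2)]] by auto
  show ?thesis
  proof (rule LIMSEQ_I)
    fix e :: real assume e: "e > 0"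
    \<comment> \<open>Three errors add up to less than (B + 2) e': the operator applied to f - g
      costs at most B e', the convergence for g costs e', and g - f costs less than e'.\<close>
    define e' where "e' = e / (B + 3)"
    have e': "e' > 0" "(B + 2) * e' < e"
      using e B(1) by (auto simp: e'_def field_simps)
    obtain g R where cg: "continuous_on UNIV g" and g0: "\<And>x. norm x > R \<Longrightarrow> g x = 0"
      and fg: "(LINT x|lebesgue. \<bar>f x - g x\<bar>) < e'"
      using integrable_approx_continuous[OF f e'(1)] by blast
    obtain Bg where "\<And>x. \<bar>g x\<bar> \<le> Bg"
      using continuous_compact_support_bounded[OF cg g0] by blast
    then have ig: "integrable lebesgue g"
      by (rule integrable_bounded_support[OF borel_measurable_continuous_lebesgue[OF cg] _ g0])
    \<comment> \<open>For indices with \<open>s n + d n < 1\<close> both g and its image vanish off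
      this ball, so a pointwise error of \<open>e' / (V + 1)\<close> integrates to at most
      e'.\<close>
    define V where "V = measure lebesgue (cball (0::'a) (\<bar>R\<bar> + 1))"
    have V: "V \<ge> 0" by (simp add: V_def)
    then have "e' / (V + 1) > 0" using e' by simp
    then obtain r where r: "r > 0" "\<And>x y. norm (x - y) < r \<Longrightarrow> \<bar>g x - g y\<bar> < e' / (V + 1)"
      using compact_support_uniform[OF cg g0] by blast
    have "(\<lambda>n. s n + d n) \<longlonglongrightarrow> 0" using tendsto_add[OF s(2) d(1)] by simp
    then have "\<forall>\<^sub>F n in sequentially. s n + d n < min r 1"
      using r(1) by (intro order_tendstoD) auto
    then obtain N where N: "\<And>n. n \<ge> N \<Longrightarrow> s n + d n < min r 1"
      by (auto simp: eventually_sequentially)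
    have "norm ((LINT x|lebesgue. \<bar>?S n f x - f x\<bar>) - 0) < e" if n: "n \<ge> N" for n
    proof -
      have gclose: "\<bar>?S n g x - g x\<bar> \<le> e' / (V + 1) * indicator (cball 0 (\<bar>R\<bar> + 1)) x" for x
      proof (cases "norm x \<le> \<bar>R\<bar> + 1")
        case True
        have "\<bar>?S n g x - g x\<bar> \<le> e' / (V + 1)"
        proof (rule conv_mollifier_close[OF s(1) ig])
          fix z assume "norm (T n x - z) \<le> s n"
          then have "norm (z - x) < r"
            using d(2)[of n x] N[OF n] norm_triangle_ineq4[of "T n x - x" "T n x - z"] by simp
          then show "\<bar>g z - g x\<bar> \<le> e' / (V + 1)" using r(2) by (simp add: less_imp_le)
        qed
        then show ?thesis using True by simp
      next
        case False
        have "?S n g x = 0"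
        proof (rule conv_mollifier_support[OF s(1)])
          fix z assume "norm (T n x - z) \<le> s n"
          then have "norm (z - x) < 1"
            using d(2)[of n x] N[OF n] norm_triangle_ineq4[of "T n x - x" "T n x - z"] by simp
          then have "norm z > R"
            using False norm_triangle_ineq2[of x z] by (simp add: norm_minus_commute)
          then show "g z = 0" by (rule g0)
        qed
        moreover have "g x = 0" using False by (intro g0) simp
        ultimately show ?thesis by (simp add: False)
      qed
      have "(LINT x|lebesgue. \<bar>?S n g x - g x\<bar>)
          \<le> (LINT x|lebesgue. e' / (V + 1) * indicator (cball (0::'a) (\<bar>R\<bar> + 1)) x)"
        by (rule integral_mono[OF _ _ gclose]) (use SI[OF ig] ig emeasure_cball_finite[of "0::'a"] in auto)
      also have "\<dots> = e' * (V / (V + 1))" by (simp add: V_def)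
      also have "\<dots> \<le> e' * 1"
        using V e' by (intro mult_left_mono) auto
      finally have 1: "(LINT x|lebesgue. \<bar>?S n g x - g x\<bar>) \<le> e'" by simp
      have ifg: "integrable lebesgue (\<lambda>x. f x - g x)" using f ig by simp
      have lin: "?S n (\<lambda>x. f x - g x) x = ?S n f x - ?S n g x" for x
        unfolding conv_def using conv_integrable[OF mollifier_Cc_infinity[OF s(1)] f] conv_integrable[OF mollifier_Cc_infinity[OF s(1)] ig]
        by (simp add: right_diff_distrib)
      have 2: "(LINT x|lebesgue. \<bar>?S n f x - ?S n g x\<bar>) \<le> B * e'"
        using SB[OF ifg, of n] fg B(1) mult_left_mono[of "LINT x|lebesgue. \<bar>f x - g x\<bar>" e' B]
        by (simp add: lin)
      have "(LINT x|lebesgue. \<bar>?S n f x - f x\<bar>) \<le>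
         (LINT x|lebesgue. \<bar>?S n f x - ?S n g x\<bar> + \<bar>?S n g x - g x\<bar> + \<bar>f x - g x\<bar>)"
        by (rule integral_mono) (use SI[OF f, of n] SI[OF ig, of n] f ig in auto)
      also have "\<dots> = (LINT x|lebesgue. \<bar>?S n f x - ?S n g x\<bar>) + (LINT x|lebesgue. \<bar>?S n g x - g x\<bar>) + (LINT x|lebesgue. \<bar>f x - g x\<bar>)"
        using SI[OF f, of n] SI[OF ig, of n] f ig by simp
      also have "\<dots> < (B + 2) * e'" using 1 2 fg by (simp add: algebra_simps)
      finally show ?thesis using e'(2) by simp
    qed
    then show "\<exists>no. \<forall>n\<ge>no. norm ((LINT x|lebesgue. \<bar>?S n f x - f x\<bar>) - 0) < e" by blast
  qed
qed

text \<open>Reflected and translated mollifiers are admissible test functions, so the mollifications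
  of f vanish near each point of \<Omega>; a subsequence of them converges to f almost everywhere.
  Working with the part of f in a compact ball makes the integrable theory applicable, and
  negligibility is a local property.\<close>

lemma fundamental_lemma_variations:
  fixes f :: "'a::euclidean_space \<Rightarrow> real"
  assumes f: "f locally_integrable_on \<Omega>" and \<Omega>: "open \<Omega>"
    and test: "\<And>\<eta>. \<eta> \<in> Cc_infinity \<Omega> \<Longrightarrow>
        (LINT x:\<Omega>|lebesgue. f x * \<eta> x) = 0"
  shows "AE x in lebesgue. x \<in> \<Omega> \<longrightarrow> f x = 0"
proof -
  let ?Z = "{x \<in> \<Omega>. f x \<noteq> 0}"
  have "negligible ?Z"
  proof (subst locally_negligible_alt, intro ballI)
    fix x assume x: "x \<in> ?Z"
    then obtain r0 where r0: "r0 > 0" "cball x r0 \<subseteq> \<Omega>"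
      using \<Omega> open_contains_cball by blast
    \<comment> \<open>Halving leaves room: for y within r of x and scale at most r, the kernel
      centred at y is supported in the ball of radius 2r, which is still inside \<Omega>.\<close>
    define r where "r = r0 / 2"
    have r: "r > 0" "cball x (2 * r) \<subseteq> \<Omega>" using r0 by (auto simp: r_def)
    let ?h = "\<lambda>z. indicator (cball x (2 * r)) z * f z"
    have h: "integrable lebesgue ?h"
      using f r(2) compact_cball unfolding locally_integrable_on_def set_integrable_def by force
    define s where "s n = r / Suc n" for n
    have s: "s n > 0" "s n \<le> r" for n using r by (auto simp: s_def divide_le_eq mult_le_cancel_left1)
    have slim: "s \<longlonglongrightarrow> 0"
      unfolding s_def by (rule LIMSEQ_Suc) (rule lim_const_over_n)
    have "(\<lambda>n. LINT y|lebesgue. \<bar>conv (mollifier (s n)) ?h y - ?h y\<bar>) \<longlonglongrightarrow> 0"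
      using conv_mollifier_L1[OF h s(1) slim tendsto_const[of 0], of "\<lambda>n x. x"] by simp
    then obtain \<sigma> :: "nat \<Rightarrow> nat" where
      ae: "AE y in lebesgue. (\<lambda>n. conv (mollifier (s (\<sigma> n))) ?h y - ?h y) \<longlonglongrightarrow> 0"
      using tendsto_L1_AE_subseq[of lebesgue "\<lambda>n y. conv (mollifier (s n)) ?h y - ?h y"]
        conv_mollifier_compose_integrable[OF h s(1), of "\<lambda>x. x"] h by auto
    have z: "conv (mollifier (s n)) ?h y = 0" if y: "y \<in> ball x r" for n y
    proof -
      have "(\<lambda>z. mollifier (s n) (y - z)) \<in> Cc_infinity \<Omega>"
        unfolding Cc_infinity_iff
      proof (intro conjI exI[of _ "cball x (2 * r)"] allI impI)
        show "smooth (\<lambda>z. mollifier (s n) (y - z))"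
          by (rule Cc_infinity_smooth[OF Cc_infinity_reflect[OF mollifier_Cc_infinity[OF s(1)]]])
        fix z assume "z \<notin> cball x (2 * r)"
        then have "norm (y - z) \<ge> s n"
          using y s(2)[of n] norm_triangle_ineq4[of "x - y" "z - y"]
          by (simp add: dist_norm norm_minus_commute)
        then show "mollifier (s n) (y - z) = 0" by (rule mollifier_eq_0[OF s(1)])
      qed (use r in auto)
      from test[OF this] have "(LINT z|lebesgue. indicator \<Omega> z * (f z * mollifier (s n) (y - z))) = 0"
        by (simp add: set_lebesgue_integral_def)
      moreover have "indicator \<Omega> z * (f z * mollifier (s n) (y - z)) = mollifier (s n) (y - z) * ?h z" for z
      proof (cases "z \<in> cball x (2 * r)")
        case True
        then show ?thesis using r(2) by (auto simp: indicator_def)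
      next
        case False
        then have "norm (y - z) \<ge> s n"
          using y s(2)[of n] norm_triangle_ineq4[of "x - y" "z - y"]
          by (simp add: dist_norm norm_minus_commute)
        from mollifier_eq_0[OF s(1) this] False show ?thesis by simp
      qed
      ultimately show ?thesis unfolding conv_def by simp
    qed
    have "AE y in lebesgue. y \<in> ball x r \<longrightarrow> f y = 0"
      using ae
    proof eventually_elim
      case (elim y)
      show ?case
      proof
        assume y: "y \<in> ball x r"
        then have "y \<in> cball x (2 * r)" using r by auto
        then have "(\<lambda>n. - f y) \<longlonglongrightarrow> 0"
          using elim z[OF y] by simp
        then show "f y = 0" by (simp add: LIMSEQ_const_iff)
      qed
    qed
    then have "negligible (ball x r \<inter> ?Z)"
      unfolding negligible_iff_null_sets completion.null_sets_iff_AE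
      by (auto elim: eventually_mono)
    then show "\<exists>U. openin (top_of_set ?Z) U \<and> x \<in> U \<and> negligible U"
      using x r(1) openin_open_Int[OF open_ball, of ?Z x r]
      by (intro exI[of _ "?Z \<inter> ball x r"]) (simp only: Int_commute[of ?Z] IntI centre_in_ball)
  qed
  then have "AE x in lebesgue. x \<notin> ?Z"
    unfolding negligible_iff_null_sets by (rule AE_not_in)
  then show ?thesis by eventually_elim auto
qed

subsection \<open>Weak gradients\<close>

definition gradient :: "('a::euclidean_space \<Rightarrow> real) \<Rightarrow> 'a \<Rightarrow> 'a" where
  "gradient f x = (\<Sum>b\<in>Basis. frechet_derivative f (at x) b *\<^sub>R b)"

lemma gradient_inner: "b \<in> Basis \<Longrightarrow> gradient f x \<bullet> b = frechet_derivative f (at x) b"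
  by (simp add: gradient_def)

text \<open>The zero extension of a function in \<open>W\<^sub>0\<^sup>1\<^sup>,\<^sup>1(\<Omega>)\<close> enters the proof only through
  this predicate.\<close>

definition global_weak_gradient :: "('a::euclidean_space \<Rightarrow> real) \<Rightarrow> ('a \<Rightarrow> 'a) \<Rightarrow> bool" where
  "global_weak_gradient u g \<longleftrightarrow> integrable lebesgue u \<and> integrable lebesgue g \<and>
     (\<forall>\<eta>\<in>Cc_infinity UNIV. \<forall>b\<in>Basis.
        (LINT x|lebesgue. u x * frechet_derivative \<eta> (at x) b)
            = - (LINT x|lebesgue. (g x \<bullet> b) * \<eta> x))"

lemma integrable_imp_locally_integrable:
  assumes "integrable lebesgue (f :: 'a::euclidean_space \<Rightarrow> 'b::euclidean_space)"
  shows "f locally_integrable_on \<Omega>"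
  unfolding locally_integrable_on_def set_integrable_def
  using assms by (auto intro!: integrable_mult_indicator fmeasurableD lmeasurable_compact)

lemma locally_integrable_lincomb:
  "f locally_integrable_on \<Omega> \<Longrightarrow> g locally_integrable_on \<Omega> \<Longrightarrow>
      (\<lambda>x. f x + c *\<^sub>R g x) locally_integrable_on \<Omega>"
  by (simp add: locally_integrable_on_def set_integral_add(1) set_integrable_scaleR_right)

lemma locally_integrable_inner:
  assumes "f locally_integrable_on \<Omega>"
  shows "(\<lambda>x. f x \<bullet> b) locally_integrable_on \<Omega>"
  unfolding locally_integrable_on_def set_integrable_def
proof (intro allI impI)
  fix K assume "compact K \<and> K \<subseteq> \<Omega>"
  then have "integrable lebesgue (\<lambda>x. (indicator K x *\<^sub>R f x) \<bullet> b)"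
    using assms unfolding locally_integrable_on_def set_integrable_def by (intro integrable_inner_left) auto
  then show "integrable lebesgue (\<lambda>x. indicat_real K x *\<^sub>R (f x \<bullet> b))" by simp
qed

lemma locally_integrable_mult_test:
  fixes f :: "'a::euclidean_space \<Rightarrow> real"
  assumes f: "f locally_integrable_on \<Omega>" and \<eta>: "\<eta> \<in> Cc_infinity \<Omega>"
  shows "integrable lebesgue (\<lambda>x. indicator \<Omega> x * (f x * \<eta> x))"
proof -
  obtain K where K: "compact K" "K \<subseteq> \<Omega>" "\<And>x. x \<notin> K \<Longrightarrow> \<eta> x = 0"
    using \<eta> unfolding Cc_infinity_iff by blast
  have "integrable lebesgue (\<lambda>x. indicator K x * f x)"
    using f K unfolding locally_integrable_on_def set_integrable_def by simp
  from Cc_infinity_integrable_mult[OF this Cc_infinity_mono[OF \<eta> subset_UNIV]]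
  have "integrable lebesgue (\<lambda>x. \<eta> x * (indicator K x * f x))" .
  moreover have "\<eta> x * (indicator K x * f x) = indicator \<Omega> x * (f x * \<eta> x)" for x
    using K(2) K(3)[of x] by (cases "x \<in> K") auto
  ultimately show ?thesis by simp
qed

lemma is_weak_gradient_lincomb:
  assumes "is_weak_gradient \<Omega> u g" "is_weak_gradient \<Omega> v h"
  shows "is_weak_gradient \<Omega> (\<lambda>x. u x + c * v x) (\<lambda>x. g x + c *\<^sub>R h x)"
  unfolding is_weak_gradient_def
proof (intro conjI ballI)
  have lu: "u locally_integrable_on \<Omega>" "v locally_integrable_on \<Omega>"
    and lg: "g locally_integrable_on \<Omega>" "h locally_integrable_on \<Omega>"
    using assms unfolding is_weak_gradient_def by blast+
  show "(\<lambda>x. u x + c * v x) locally_integrable_on \<Omega>"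
    using locally_integrable_lincomb[OF lu, of c] by simp
  show "(\<lambda>x. g x + c *\<^sub>R h x) locally_integrable_on \<Omega>"
    by (rule locally_integrable_lincomb[OF lg])
  fix \<phi> and b :: 'a assume \<phi>: "\<phi> \<in> Cc_infinity \<Omega>" and b: "b \<in> Basis"
  note i1 = lu[THEN locally_integrable_mult_test, OF Cc_infinity_frechet_derivative[OF \<phi> b]]
  note i2 = lg[THEN locally_integrable_inner, THEN locally_integrable_mult_test, OF \<phi>, of b]
  have "(LINT x:\<Omega>|lebesgue. u x * frechet_derivative \<phi> (at x) b)
      = - (LINT x:\<Omega>|lebesgue. (g x \<bullet> b) * \<phi> x)"
    "(LINT x:\<Omega>|lebesgue. v x * frechet_derivative \<phi> (at x) b)
        = - (LINT x:\<Omega>|lebesgue. (h x \<bullet> b) * \<phi> x)"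
    using assms \<phi> b unfolding is_weak_gradient_def by blast+
  moreover have "(LINT x:\<Omega>|lebesgue. (u x + c * v x) * frechet_derivative \<phi> (at x) b)
      = (LINT x:\<Omega>|lebesgue. u x * frechet_derivative \<phi> (at x) b)
        + c * (LINT x:\<Omega>|lebesgue. v x * frechet_derivative \<phi> (at x) b)"
    using i1 by (simp add: set_lebesgue_integral_def distrib_left distrib_right mult.assoc mult.left_commute[of _ c])
  moreover have "(LINT x:\<Omega>|lebesgue. ((g x + c *\<^sub>R h x) \<bullet> b) * \<phi> x)
      = (LINT x:\<Omega>|lebesgue. (g x \<bullet> b) * \<phi> x) + c * (LINT x:\<Omega>|lebesgue. (h x \<bullet> b) * \<phi> x)"
    using i2 by (simp add: set_lebesgue_integral_def inner_add_left distrib_left distrib_right mult.assoc mult.left_commute[of _ c])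
  ultimately show "(LINT x:\<Omega>|lebesgue. (u x + c * v x) * frechet_derivative \<phi> (at x) b)
      = - (LINT x:\<Omega>|lebesgue. ((g x + c *\<^sub>R h x) \<bullet> b) * \<phi> x)"
    by simp
qed

lemma is_weak_gradient_add:
  "is_weak_gradient \<Omega> u g \<Longrightarrow> is_weak_gradient \<Omega> v h \<Longrightarrow>
      is_weak_gradient \<Omega> (\<lambda>x. u x + v x) (\<lambda>x. g x + h x)"
  using is_weak_gradient_lincomb[where c = 1] by simp

lemma is_weak_gradient_diff:
  "is_weak_gradient \<Omega> u g \<Longrightarrow> is_weak_gradient \<Omega> v h \<Longrightarrow>
      is_weak_gradient \<Omega> (\<lambda>x. u x - v x) (\<lambda>x. g x - h x)"
  using is_weak_gradient_lincomb[where c = "-1"] by simp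

text \<open>The difference g - h is a weak gradient of u - u, so each of its components is
  orthogonal to all test functions.\<close>

lemma is_weak_gradient_unique:
  fixes \<Omega> :: "'a::euclidean_space set"
  assumes \<Omega>: "open \<Omega>" and g: "is_weak_gradient \<Omega> u g" and h: "is_weak_gradient \<Omega> u h"
  shows "AE x in lebesgue. x \<in> \<Omega> \<longrightarrow> g x = h x"
proof -
  have d: "is_weak_gradient \<Omega> (\<lambda>x. u x - u x) (\<lambda>x. g x - h x)"
    by (rule is_weak_gradient_diff[OF g h])
  have "AE x in lebesgue. x \<in> \<Omega> \<longrightarrow> (g x - h x) \<bullet> b = 0" if b: "b \<in> Basis" for b
  proof (rule fundamental_lemma_variations[OF _ \<Omega>])
    show "(\<lambda>x. (g x - h x) \<bullet> b) locally_integrable_on \<Omega>"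
      using d unfolding is_weak_gradient_def by (intro locally_integrable_inner) blast
    fix \<eta> assume "\<eta> \<in> Cc_infinity \<Omega>"
    then have "(LINT x:\<Omega>|lebesgue. (u x - u x) * frechet_derivative \<eta> (at x) b)
      = - (LINT x:\<Omega>|lebesgue. ((g x - h x) \<bullet> b) * \<eta> x)"
      using d b unfolding is_weak_gradient_def by blast
    then show "(LINT x:\<Omega>|lebesgue. ((g x - h x) \<bullet> b) * \<eta> x) = 0"
      by (simp add: set_lebesgue_integral_def)
  qed
  then have "AE x in lebesgue. \<forall>b\<in>Basis. x \<in> \<Omega> \<longrightarrow> (g x - h x) \<bullet> b = 0"
    by (subst AE_finite_all) auto
  then show ?thesis
    by eventually_elim (metis (no_types, lifting) euclidean_all_zero_iff right_minus_eq)
qed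

lemma weak_gradient_works: "is_weak_gradient \<Omega> u g \<Longrightarrow>
    is_weak_gradient \<Omega> u (weak_gradient \<Omega> u)"
  unfolding weak_gradient_def by (rule someI[of "is_weak_gradient \<Omega> u"])

text \<open>Makes the choice inside \<open>weak_gradient\<close> harmless: under integrals over
  \<Omega> it can be exchanged for any explicit weak gradient.\<close>

lemma weak_gradient_AE:
  assumes "open \<Omega>" "is_weak_gradient \<Omega> u g"
  shows "AE x in lebesgue. x \<in> \<Omega> \<longrightarrow> weak_gradient \<Omega> u x = g x"
  by (rule is_weak_gradient_unique[OF assms(1) weak_gradient_works[OF assms(2)] assms(2)])

lemma global_weak_gradient_restrict:
  assumes "global_weak_gradient u g"
  shows "is_weak_gradient \<Omega> u g"
  unfolding is_weak_gradient_def
proof (intro conjI ballI)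
  show "u locally_integrable_on \<Omega>" "g locally_integrable_on \<Omega>"
    using assms unfolding global_weak_gradient_def by (auto intro: integrable_imp_locally_integrable)
  fix \<phi> and b :: 'a assume \<phi>: "\<phi> \<in> Cc_infinity \<Omega>" and b: "b \<in> Basis"
  have eq1: "indicat_real \<Omega> x * (w * \<phi> x) = w * \<phi> x" for x w
    using Cc_infinity_outside[OF \<phi>, of x] by (cases "x \<in> \<Omega>") auto
  have eq2: "indicat_real \<Omega> x * (w * frechet_derivative \<phi> (at x) b)
      = w * frechet_derivative \<phi> (at x) b" for x w
    using Cc_infinity_outside[OF Cc_infinity_frechet_derivative[OF \<phi> b], of x] by (cases "x \<in> \<Omega>") auto
  show "(LINT x:\<Omega>|lebesgue. u x * frechet_derivative \<phi> (at x) b)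
      = - (LINT x:\<Omega>|lebesgue. (g x \<bullet> b) * \<phi> x)"
    unfolding set_lebesgue_integral_def real_scaleR_def eq1 eq2
    using assms Cc_infinity_mono[OF \<phi> subset_UNIV] b unfolding global_weak_gradient_def by blast
qed

lemma integrable_componentwise:
  fixes g :: "'a \<Rightarrow> 'b::euclidean_space"
  assumes "\<And>b. b \<in> Basis \<Longrightarrow> integrable M (\<lambda>x. g x \<bullet> b)"
  shows "integrable M g"
proof -
  have "integrable M (\<lambda>x. \<Sum>b\<in>Basis. (g x \<bullet> b) *\<^sub>R b)"
    using assms by (intro Bochner_Integration.integrable_sum integrable_scaleR_left) auto
  then show ?thesis by (simp add: euclidean_representation)
qed

lemma Cc_infinity_global_weak_gradient:
  assumes "\<phi> \<in> Cc_infinity \<Omega>"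
  shows "global_weak_gradient \<phi> (gradient \<phi>)"
proof -
  have \<phi>: "\<phi> \<in> Cc_infinity UNIV" by (rule Cc_infinity_mono[OF assms subset_UNIV])
  have "integrable lebesgue (gradient \<phi>)"
    by (rule integrable_componentwise)
      (simp add: gradient_inner Cc_infinity_integrable[OF Cc_infinity_frechet_derivative[OF \<phi>]])
  moreover have "(LINT x|lebesgue. \<phi> x * frechet_derivative \<eta> (at x) b)
      = - (LINT x|lebesgue. (gradient \<phi> x \<bullet> b) * \<eta> x)"
    if "\<eta> \<in> Cc_infinity UNIV" "b \<in> Basis" for \<eta> b
    using integral_by_parts[OF smooth_has_derivative[OF Cc_infinity_smooth[OF \<phi>]]
        smooth_continuous[OF Cc_infinity_smooth[OF Cc_infinity_frechet_derivative[OF \<phi> that(2)]]] that]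
    by (simp add: gradient_inner that)
  ultimately show ?thesis
    using Cc_infinity_integrable[OF \<phi>] unfolding global_weak_gradient_def by blast
qed

lemma null_squeeze:
  fixes a :: "nat \<Rightarrow> real"
  assumes "\<And>n. 0 \<le> a n" "\<And>n. a n \<le> b n" "b \<longlonglongrightarrow> 0"
  shows "a \<longlonglongrightarrow> 0"
  by (rule tendsto_sandwich[OF _ _ tendsto_const assms(3)]) (simp_all add: assms)

lemma integral_mult_L1_limit:
  fixes f :: "'a::euclidean_space \<Rightarrow> real"
  assumes f: "integrable M f" "\<And>n. integrable M (g n)"
    and lim: "(\<lambda>n. LINT x|M. \<bar>g n x - f x\<bar>) \<longlonglongrightarrow> 0"
    and k: "k \<in> borel_measurable M" "\<And>x. \<bar>k x\<bar> \<le> B"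
  shows "(\<lambda>n. LINT x|M. g n x * k x) \<longlonglongrightarrow> (LINT x|M. f x * k x)"
proof (rule LIM_zero_cancel, rule Lim_null_comparison)
  have i: "integrable M (\<lambda>x. h x * k x)" if "integrable M h" for h
    using integrable_bounded_mult[OF that k] by (simp add: mult.commute)
  have "norm ((LINT x|M. g n x * k x) - (LINT x|M. f x * k x)) \<le> B * (LINT x|M. \<bar>g n x - f x\<bar>)" for n
  proof -
    have "norm (LINT x|M. g n x * k x - f x * k x) \<le> (LINT x|M. B * \<bar>g n x - f x\<bar>)"
    proof (rule Bochner_Integration.integral_norm_bound_integral)
      fix x
      have "norm (g n x * k x - f x * k x) = \<bar>k x\<bar> * \<bar>g n x - f x\<bar>"
        by (simp add: abs_mult[symmetric] algebra_simps)
      also have "\<dots> \<le> B * \<bar>g n x - f x\<bar>" by (rule mult_right_mono[OF k(2)]) simp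
      finally show "norm (g n x * k x - f x * k x) \<le> B * \<bar>g n x - f x\<bar>" .
    qed (use f i in auto)
    then show ?thesis using i f by simp
  qed
  then show "\<forall>\<^sub>F n in sequentially. norm ((LINT x|M. g n x * k x) - (LINT x|M. f x * k x))
      \<le> B * (LINT x|M. \<bar>g n x - f x\<bar>)"
    by simp
  show "(\<lambda>n. B * (LINT x|M. \<bar>g n x - f x\<bar>)) \<longlonglongrightarrow> 0"
    using tendsto_mult_left[OF lim, of B] by simp
qed

text \<open>Both sides of the defining identity are continuous under L^1 convergence, since test
  functions and their partials are bounded.\<close>

lemma global_weak_gradient_limit:
  fixes u :: "'a::euclidean_space \<Rightarrow> real"
  assumes u: "integrable lebesgue u" and g: "integrable lebesgue g"
    and wg: "\<And>n. global_weak_gradient (U n) (H n)"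
    and lu: "(\<lambda>n. LINT x|lebesgue. \<bar>U n x - u x\<bar>) \<longlonglongrightarrow> 0"
    and lg: "\<And>b. b \<in> Basis \<Longrightarrow>
        (\<lambda>n. LINT x|lebesgue. \<bar>H n x \<bullet> b - g x \<bullet> b\<bar>) \<longlonglongrightarrow> 0"
  shows "global_weak_gradient u g"
  unfolding global_weak_gradient_def
proof (intro conjI ballI u g)
  fix \<eta> :: "'a \<Rightarrow> real" and b :: 'a assume \<eta>: "\<eta> \<in> Cc_infinity UNIV"
      and b: "b \<in> Basis"
  have U: "integrable lebesgue (U n)" "integrable lebesgue (H n)" for n
    using wg[of n] unfolding global_weak_gradient_def by auto
  obtain B where B: "\<And>x. \<bar>\<eta> x\<bar> \<le> B"
    using Cc_infinity_UNIV_bounded[OF \<eta>] by blast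
  note D = Cc_infinity_frechet_derivative[OF \<eta> b]
  obtain B' where B': "\<And>x. \<bar>frechet_derivative \<eta> (at x) b\<bar> \<le> B'"
    using Cc_infinity_UNIV_bounded[OF D] by blast
  have l1: "(\<lambda>n. LINT x|lebesgue. U n x * frechet_derivative \<eta> (at x) b)
      \<longlonglongrightarrow> (LINT x|lebesgue. u x * frechet_derivative \<eta> (at x) b)"
    by (rule integral_mult_L1_limit[OF u U(1) lu Cc_infinity_UNIV_measurable[OF D] B'])
  have l2: "(\<lambda>n. LINT x|lebesgue. (H n x \<bullet> b) * \<eta> x)
      \<longlonglongrightarrow> (LINT x|lebesgue. (g x \<bullet> b) * \<eta> x)"
    by (rule integral_mult_L1_limit[OF _ _ lg[OF b] Cc_infinity_UNIV_measurable[OF \<eta>] B]) (use g U in auto)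
  have eq: "(LINT x|lebesgue. U n x * frechet_derivative \<eta> (at x) b)
      = - (LINT x|lebesgue. (H n x \<bullet> b) * \<eta> x)" for n
    using wg[of n] \<eta> b unfolding global_weak_gradient_def by blast
  show "(LINT x|lebesgue. u x * frechet_derivative \<eta> (at x) b) = - (LINT x|lebesgue. (g x \<bullet> b) * \<eta> x)"
    by (rule LIMSEQ_unique[OF l1[unfolded eq] tendsto_minus[OF l2]])
qed

text \<open>The approximating test functions are their own zero extensions and have classical
  gradients on the whole space, so the defining identity holds for them globally and survives the
  limit.\<close>

lemma W11_0_zero_extension:
  fixes \<Omega> :: "'a::euclidean_space set"
  assumes \<Omega>: "open \<Omega>" and \<phi>: "\<phi> \<in> W11_0 \<Omega>"
  shows "global_weak_gradient (\<lambda>x. indicator \<Omega> x * \<phi> x) (\<lambda>x. indicator \<Omega> x *\<^sub>R weak_gradient \<Omega> \<phi> x)"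
proof -
  let ?g = "weak_gradient \<Omega> \<phi>"
  have \<Omega>m: "\<Omega> \<in> sets lebesgue" using \<Omega> by auto
  obtain g where \<phi>i: "\<phi> absolutely_integrable_on \<Omega>"
      and g: "is_weak_gradient \<Omega> \<phi> g" "g absolutely_integrable_on \<Omega>"
    using \<phi> unfolding W11_0_def W11_def by blast
  obtain \<psi> where \<psi>: "\<And>k. \<psi> k \<in> Cc_infinity \<Omega>"
      and lim: "(\<lambda>k. W11_norm \<Omega> (\<lambda>x. \<phi> x - \<psi> k x)) \<longlonglongrightarrow> 0"
    using \<phi> unfolding W11_0_def by blast
  have gae: "AE x in lebesgue. indicator \<Omega> x *\<^sub>R g x = indicator \<Omega> x *\<^sub>R ?g x"
    using weak_gradient_AE[OF \<Omega> g(1)] by eventually_elim (auto simp: indicator_def)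
  have gi: "integrable lebesgue (\<lambda>x. indicator \<Omega> x *\<^sub>R g x)"
    using g(2) unfolding set_integrable_def .
  have gi': "integrable lebesgue (\<lambda>x. indicator \<Omega> x *\<^sub>R ?g x)"
    by (rule integrable_cong_AE_imp[OF gi _ gae]) (rule borel_measurable_AE[OF _ gae], use gi in auto)
  have \<phi>i': "integrable lebesgue (\<lambda>x. indicator \<Omega> x * \<phi> x)"
    using \<phi>i unfolding set_integrable_def by simp
  have \<psi>U: "\<psi> k \<in> Cc_infinity UNIV" for k by (rule Cc_infinity_mono[OF \<psi> subset_UNIV])
  note wg\<psi> = Cc_infinity_global_weak_gradient[OF \<psi>]
  have ig\<psi>: "integrable lebesgue (gradient (\<psi> k))" for k
    using wg\<psi>[of k] unfolding global_weak_gradient_def by blast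
  have z: "indicator \<Omega> x * \<psi> k x = \<psi> k x" "indicator \<Omega> x *\<^sub>R gradient (\<psi> k) x
      = gradient (\<psi> k) x" for x k
    using Cc_infinity_outside[OF \<psi>, of x] Cc_infinity_outside[OF Cc_infinity_frechet_derivative[OF \<psi>], of _ x]
    by (auto simp: indicator_def gradient_def)
  let ?A = "\<lambda>k. LINT x|lebesgue. \<bar>\<psi> k x - indicator \<Omega> x * \<phi> x\<bar>"
  let ?B = "\<lambda>k. LINT x|lebesgue. norm (gradient (\<psi> k) x - indicator \<Omega> x *\<^sub>R ?g x)"
  \<comment> \<open>As \<psi> k and its gradient vanish off \<Omega>, the norm on \<Omega> is a sum
    of two L^1 distances on the whole space.\<close>
  have norm_eq: "W11_norm \<Omega> (\<lambda>x. \<phi> x - \<psi> k x) = ?A k + ?B k" for k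
  proof -
    have "(LINT x:\<Omega>|lebesgue. \<bar>\<phi> x - \<psi> k x\<bar>) = ?A k"
      unfolding set_lebesgue_integral_def
    proof (rule Bochner_Integration.integral_cong)
      show "indicat_real \<Omega> x *\<^sub>R \<bar>\<phi> x - \<psi> k x\<bar>
          = \<bar>\<psi> k x - indicator \<Omega> x * \<phi> x\<bar>" for x
        using z(1)[of x k] by (cases "x \<in> \<Omega>") auto
    qed simp
    moreover have "(LINT x:\<Omega>|lebesgue. norm (weak_gradient \<Omega> (\<lambda>x. \<phi> x - \<psi> k x) x)) = ?B k"
      unfolding set_lebesgue_integral_def
    proof (rule integral_cong_AE)
      have "AE x in lebesgue. x \<in> \<Omega>
          \<longrightarrow> weak_gradient \<Omega> (\<lambda>x. \<phi> x - \<psi> k x) x = ?g x - gradient (\<psi> k) x"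
        by (intro weak_gradient_AE[OF \<Omega>] is_weak_gradient_diff weak_gradient_works[OF g(1)]
            global_weak_gradient_restrict[OF wg\<psi>])
      then show ae: "AE x in lebesgue. indicat_real \<Omega> x *\<^sub>R norm (weak_gradient \<Omega> (\<lambda>x. \<phi> x - \<psi> k x) x)
          = norm (gradient (\<psi> k) x - indicator \<Omega> x *\<^sub>R ?g x)"
      proof eventually_elim
        case (elim x)
        then show ?case
          using z(2)[of x k] by (cases "x \<in> \<Omega>") (auto simp: norm_minus_commute)
      qed
      show m: "(\<lambda>x. norm (gradient (\<psi> k) x - indicator \<Omega> x *\<^sub>R ?g x)) \<in> borel_measurable lebesgue"
        using ig\<psi>[of k] gi' by auto
      show "(\<lambda>x. indicat_real \<Omega> x *\<^sub>R norm (weak_gradient \<Omega> (\<lambda>x. \<phi> x - \<psi> k x) x)) \<in> borel_measurable lebesgue"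
        by (rule borel_measurable_AE[OF m]) (use ae in \<open>auto elim: eventually_mono\<close>)
    qed
    ultimately show ?thesis by (simp add: W11_norm_def)
  qed
  have AB: "?A k \<ge> 0" "?B k \<ge> 0" for k by simp_all
  have A0: "?A \<longlonglongrightarrow> 0" and B0: "?B \<longlonglongrightarrow> 0"
    using lim AB unfolding norm_eq
    by (auto intro!: tendsto_sandwich[OF _ _ tendsto_const[of 0] lim[unfolded norm_eq]])
  show ?thesis
  proof (rule global_weak_gradient_limit[OF \<phi>i' gi' wg\<psi> A0])
    fix b :: 'a assume b: "b \<in> Basis"
    show "(\<lambda>n. LINT x|lebesgue. \<bar>gradient (\<psi> n) x \<bullet> b - indicator \<Omega> x *\<^sub>R ?g x \<bullet> b\<bar>) \<longlonglongrightarrow> 0"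
    proof (rule tendsto_sandwich[OF _ _ tendsto_const[of 0] B0])
      show "\<forall>\<^sub>F n in sequentially. (LINT x|lebesgue. \<bar>gradient (\<psi> n) x \<bullet> b - indicator \<Omega> x *\<^sub>R ?g x \<bullet> b\<bar>) \<le> ?B n"
      proof (intro always_eventually allI integral_mono)
        fix n x
        show "\<bar>gradient (\<psi> n) x \<bullet> b - indicator \<Omega> x *\<^sub>R ?g x \<bullet> b\<bar>
            \<le> norm (gradient (\<psi> n) x - indicator \<Omega> x *\<^sub>R ?g x)"
          using Basis_le_norm[OF b, of "gradient (\<psi> n) x - indicator \<Omega> x *\<^sub>R ?g x"]
              by (simp add: inner_diff_left)
        show "integrable lebesgue (\<lambda>x. \<bar>gradient (\<psi> n) x \<bullet> b - indicator \<Omega> x *\<^sub>R ?g x \<bullet> b\<bar>)"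
          by (intro integrable_abs Bochner_Integration.integrable_diff integrable_inner_left ig\<psi> gi')
      qed (use ig\<psi> gi' in auto)
    qed auto
  qed
qed

text \<open>The kernel z \<mapsto> k(x - z) is itself a test function. The minus sign from its inner
  derivative cancels the one in the definition of the weak gradient.\<close>

lemma conv_global_weak_gradient:
  assumes wg: "global_weak_gradient u g" and k: "k \<in> Cc_infinity UNIV" and b: "b \<in> Basis"
  shows "frechet_derivative (conv k u) (at x) b = conv k (\<lambda>z. g z \<bullet> b) x"
proof -
  have u: "integrable lebesgue u" using wg by (simp add: global_weak_gradient_def)
  have "((\<lambda>z. k (x - z)) has_derivative (\<lambda>h. frechet_derivative k (at (x - z)) (- h))) (at z)" for z
    by (rule has_derivative_compose[OF _ smooth_has_derivative[OF Cc_infinity_smooth[OF k]], of "\<lambda>z. x - z"])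
      (auto intro!: derivative_eq_intros)
  then have "frechet_derivative (\<lambda>z. k (x - z)) (at z) b = frechet_derivative k (at (x - z)) (- b)" for z
    using frechet_derivative_at by metis
  then have d: "frechet_derivative (\<lambda>z. k (x - z)) (at z) b = - frechet_derivative k (at (x - z)) b" for z
    using linear_neg[OF has_derivative_linear[OF smooth_has_derivative[OF Cc_infinity_smooth[OF k]]]] by simp
  have "(LINT z|lebesgue. u z * frechet_derivative (\<lambda>z. k (x - z)) (at z) b)
      = - (LINT z|lebesgue. (g z \<bullet> b) * k (x - z))"
    using wg Cc_infinity_reflect[OF k] b unfolding global_weak_gradient_def by blast
  then have "(LINT z|lebesgue. u z * frechet_derivative k (at (x - z)) b)
      = (LINT z|lebesgue. (g z \<bullet> b) * k (x - z))"
    by (simp add: d)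
  then show ?thesis
    unfolding frechet_derivative_conv[OF k u b] conv_def by (simp add: mult.commute)
qed

lemma bounded_derivative_lipschitz:
  fixes \<theta> :: "real \<Rightarrow> real"
  assumes "\<And>t. (\<theta> has_real_derivative \<theta>' t) (at t)" "\<And>t. \<bar>\<theta>' t\<bar> \<le> K"
  shows "\<bar>\<theta> s - \<theta> t\<bar> \<le> K * \<bar>s - t\<bar>"
  using field_differentiable_bound[of UNIV \<theta> \<theta>' K s t] assms by (simp add: abs_minus_commute)

text \<open>The classical chain rule holds for mollifications of u. The limit is taken along a
  subsequence converging a.e., since L^1 convergence alone does not control \<theta>' of the
  mollified functions.\<close>

lemma global_weak_gradient_chain:
  fixes u :: "'a::euclidean_space \<Rightarrow> real"
  assumes wg: "global_weak_gradient u g"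
    and \<theta>: "\<And>t. (\<theta> has_real_derivative \<theta>' t) (at t)" "continuous_on UNIV \<theta>'" "\<And>t. \<bar>\<theta>' t\<bar> \<le> K" "\<theta> 0 = 0"
  shows "global_weak_gradient (\<lambda>x. \<theta> (u x)) (\<lambda>x. \<theta>' (u x) *\<^sub>R g x)"
proof -
  have u: "integrable lebesgue u" and g: "integrable lebesgue g"
    using wg by (auto simp: global_weak_gradient_def)
  have [measurable]: "u \<in> borel_measurable lebesgue" "g \<in> borel_measurable lebesgue" using u g by auto
  have K: "K \<ge> 0" using \<theta>(3)[of 0] by linarith
  have lip: "\<bar>\<theta> s - \<theta> t\<bar> \<le> K * \<bar>s - t\<bar>" for s t
    by (rule bounded_derivative_lipschitz[OF \<theta>(1,3)])
  have cont\<theta>: "continuous_on UNIV \<theta>"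
    by (intro continuous_at_imp_continuous_on ballI DERIV_isCont[OF \<theta>(1)])
  have [measurable]: "\<theta> \<in> borel_measurable borel" "\<theta>' \<in> borel_measurable borel"
    using cont\<theta> \<theta>(2) by (auto intro: borel_measurable_continuous_onI)
  have i\<theta>: "integrable lebesgue (\<lambda>x. \<theta> (h x))" if "integrable lebesgue h" for h :: "'a \<Rightarrow> real"
  proof (rule Bochner_Integration.integrable_bound[of _ "\<lambda>x. K * h x"])
    have "h \<in> borel_measurable lebesgue" using that by auto
    then show "(\<lambda>x. \<theta> (h x)) \<in> borel_measurable lebesgue" by measurable
    show "AE x in lebesgue. norm (\<theta> (h x)) \<le> norm (K * h x)"
      using lip[of _ 0] \<theta>(4) K by (intro AE_I2) (simp add: abs_mult)
  qed (use that in simp)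
  have i\<theta>': "integrable lebesgue (\<lambda>x. \<theta>' (h x) * w x)"
    if "h \<in> borel_measurable lebesgue" "integrable lebesgue w" for h w :: "'a \<Rightarrow> real"
    by (rule integrable_bounded_mult[OF that(2) _ \<theta>(3)]) (use that in measurable)
  define s where "s n = 1 / real (Suc n)" for n
  have s: "s n > 0" for n by (simp add: s_def)
  have s0: "s \<longlonglongrightarrow> 0"
    using LIMSEQ_inverse_real_of_nat unfolding s_def by (simp add: inverse_eq_divide)
  let ?m = "\<lambda>n. mollifier (s n) :: 'a \<Rightarrow> real"
  have m: "?m n \<in> Cc_infinity UNIV" for n by (rule mollifier_Cc_infinity[OF s])
  have L1: "(\<lambda>n. LINT y|lebesgue. \<bar>conv (?m n) h y - h y\<bar>) \<longlonglongrightarrow> 0"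
    and IC: "integrable lebesgue (conv (?m n) h)"
    if "integrable lebesgue h" for h and n
    using conv_mollifier_L1[OF that s s0 tendsto_const[of 0], of "\<lambda>n x. x"]
      conv_mollifier_compose_integrable[OF that s, of "\<lambda>x. x"] by simp_all
  obtain \<sigma> :: "nat \<Rightarrow> nat" where \<sigma>: "strict_mono \<sigma>"
    and ae: "AE y in lebesgue. (\<lambda>n. conv (?m (\<sigma> n)) u y - u y) \<longlonglongrightarrow> 0"
    using tendsto_L1_AE_subseq[of lebesgue "\<lambda>n y. conv (?m n) u y - u y"] IC[OF u] u L1[OF u] by auto
  define U where "U n = conv (?m (\<sigma> n)) u" for n
  define H where "H b n = conv (?m (\<sigma> n)) (\<lambda>z. g z \<bullet> b)" for b n
  have gb: "integrable lebesgue (\<lambda>z. g z \<bullet> b)" for b using g by simp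
  have U: "integrable lebesgue (U n)" "(\<lambda>n. LINT y|lebesgue. \<bar>U n y - u y\<bar>) \<longlonglongrightarrow> 0" for n
    unfolding U_def using IC[OF u] LIMSEQ_subseq_LIMSEQ[OF L1[OF u] \<sigma>] by (auto simp: comp_def)
  have H: "integrable lebesgue (H b n)" "(\<lambda>n. LINT y|lebesgue. \<bar>H b n y - g y \<bullet> b\<bar>) \<longlonglongrightarrow> 0" for b n
    unfolding H_def using IC[OF gb] LIMSEQ_subseq_LIMSEQ[OF L1[OF gb] \<sigma>] by (auto simp: comp_def)
  have mU: "U n \<in> borel_measurable lebesgue" for n using U by auto
  have sU: "smooth (U n)" for n unfolding U_def by (rule conv_smooth[OF m u])
  have aeU: "AE y in lebesgue. (\<lambda>n. U n y) \<longlonglongrightarrow> u y"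
    using ae by eventually_elim (auto simp: U_def LIM_zero_iff)
  show ?thesis
    unfolding global_weak_gradient_def
  proof (intro conjI ballI)
    show "integrable lebesgue (\<lambda>x. \<theta> (u x))" by (rule i\<theta>[OF u])
    show "integrable lebesgue (\<lambda>x. \<theta>' (u x) *\<^sub>R g x)"
      by (rule integrable_componentwise) (simp add: i\<theta>' g)
    fix \<eta> :: "'a \<Rightarrow> real" and b :: 'a assume \<eta>: "\<eta> \<in> Cc_infinity UNIV"
        and b: "b \<in> Basis"
    note D = Cc_infinity_frechet_derivative[OF \<eta> b]
    obtain B where B: "\<And>x. \<bar>\<eta> x\<bar> \<le> B"
      using Cc_infinity_UNIV_bounded[OF \<eta>] by blast
    obtain B' where B': "\<And>x. \<bar>frechet_derivative \<eta> (at x) b\<bar> \<le> B'"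
      using Cc_infinity_UNIV_bounded[OF D] by blast
    have parts: "(LINT x|lebesgue. \<theta> (U n x) * frechet_derivative \<eta> (at x) b)
        = - (LINT x|lebesgue. (\<theta>' (U n x) * H b n x) * \<eta> x)" for n
    proof -
      have fd: "frechet_derivative (U n) (at x) b = H b n x" for x
        unfolding U_def H_def by (rule conv_global_weak_gradient[OF wg m b])
      have der: "((\<lambda>x. \<theta> (U n x)) has_derivative (\<lambda>h. \<theta>' (U n x) * frechet_derivative (U n) (at x) h)) (at x)" for x
        by (rule has_derivative_compose[OF smooth_has_derivative[OF sU]])
          (use \<theta>(1) in \<open>simp add: has_field_derivative_def\<close>)
      have "continuous_on UNIV (\<lambda>x. \<theta>' (U n x) * frechet_derivative (U n) (at x) b)"
        by (intro continuous_intros continuous_on_compose2[OF \<theta>(2)] smooth_continuous sU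
            smooth_frechet_derivative b) auto
      from integral_by_parts[OF der this \<eta> b] show ?thesis unfolding fd .
    qed
    have l1: "(\<lambda>n. LINT x|lebesgue. \<theta> (U n x) * frechet_derivative \<eta> (at x) b)
        \<longlonglongrightarrow> (LINT x|lebesgue. \<theta> (u x) * frechet_derivative \<eta> (at x) b)"
    proof (rule integral_mult_L1_limit[OF i\<theta>[OF u] i\<theta>[OF U(1)] _ Cc_infinity_UNIV_measurable[OF D] B'])
      have le: "(LINT x|lebesgue. \<bar>\<theta> (U n x) - \<theta> (u x)\<bar>)
          \<le> K * (LINT x|lebesgue. \<bar>U n x - u x\<bar>)" for n
      proof -
        have "(LINT x|lebesgue. \<bar>\<theta> (U n x) - \<theta> (u x)\<bar>)
            \<le> (LINT x|lebesgue. K * \<bar>U n x - u x\<bar>)"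
          by (rule integral_mono[OF _ _ lip]) (use i\<theta>[OF u] i\<theta>[OF U(1)] u U in auto)
        then show ?thesis by simp
      qed
      have lim: "(\<lambda>n. K * (LINT x|lebesgue. \<bar>U n x - u x\<bar>)) \<longlonglongrightarrow> 0"
        using tendsto_mult_left[OF U(2), of K] by simp
      show "(\<lambda>n. LINT x|lebesgue. \<bar>\<theta> (U n x) - \<theta> (u x)\<bar>) \<longlonglongrightarrow> 0"
        by (rule null_squeeze[OF _ le lim]) simp
    qed
    have l2: "(\<lambda>n. LINT x|lebesgue. (\<theta>' (U n x) * H b n x) * \<eta> x)
        \<longlonglongrightarrow> (LINT x|lebesgue. (\<theta>' (u x) * (g x \<bullet> b)) * \<eta> x)"
    proof (rule integral_mult_L1_limit[OF i\<theta>' i\<theta>' _ Cc_infinity_UNIV_measurable[OF \<eta>] B])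
      have i3: "integrable lebesgue (\<lambda>x. \<bar>\<theta>' (u x) * (g x \<bullet> b) - \<theta>' (U n x) * (g x \<bullet> b)\<bar>)" for n
        using i\<theta>'[OF mU gb] i\<theta>'[OF _ gb] by auto
      \<comment> \<open>The difference of products is split so that L^1 convergence of the gradients
        meets the bound K on \<theta>', while the other part has the fixed factor g and is handled
        by dominated convergence.\<close>
      have le: "(LINT x|lebesgue. \<bar>\<theta>' (U n x) * H b n x - \<theta>' (u x) * (g x \<bullet> b)\<bar>)
          \<le> K * (LINT x|lebesgue. \<bar>H b n x - g x \<bullet> b\<bar>) + (LINT x|lebesgue. \<bar>\<theta>' (u x) * (g x \<bullet> b) - \<theta>' (U n x) * (g x \<bullet> b)\<bar>)" for n
      proof -
        have "(LINT x|lebesgue. \<bar>\<theta>' (U n x) * H b n x - \<theta>' (u x) * (g x \<bullet> b)\<bar>)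
          \<le> (LINT x|lebesgue. K * \<bar>H b n x - g x \<bullet> b\<bar> + \<bar>\<theta>' (u x) * (g x \<bullet> b) - \<theta>' (U n x) * (g x \<bullet> b)\<bar>)"
        proof (rule integral_mono)
          fix x
          have "\<bar>\<theta>' (U n x) * H b n x - \<theta>' (u x) * (g x \<bullet> b)\<bar>
             \<le> \<bar>\<theta>' (U n x)\<bar> * \<bar>H b n x - g x \<bullet> b\<bar> + \<bar>\<theta>' (u x) * (g x \<bullet> b) - \<theta>' (U n x) * (g x \<bullet> b)\<bar>"
            unfolding abs_mult[symmetric] by (simp add: right_diff_distrib)
          also have "\<bar>\<theta>' (U n x)\<bar> * \<bar>H b n x - g x \<bullet> b\<bar>
              \<le> K * \<bar>H b n x - g x \<bullet> b\<bar>"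
            by (rule mult_right_mono[OF \<theta>(3)]) simp
          finally show "\<bar>\<theta>' (U n x) * H b n x - \<theta>' (u x) * (g x \<bullet> b)\<bar>
             \<le> K * \<bar>H b n x - g x \<bullet> b\<bar> + \<bar>\<theta>' (u x) * (g x \<bullet> b) - \<theta>' (U n x) * (g x \<bullet> b)\<bar>" by simp
        qed (use i3 H gb i\<theta>'[OF mU H(1)] i\<theta>'[OF _ gb] in auto)
        also have "\<dots> = K * (LINT x|lebesgue. \<bar>H b n x - g x \<bullet> b\<bar>) + (LINT x|lebesgue. \<bar>\<theta>' (u x) * (g x \<bullet> b) - \<theta>' (U n x) * (g x \<bullet> b)\<bar>)"
          using i3 H gb by simp
        finally show ?thesis .
      qed
      have t2: "(\<lambda>n. LINT x|lebesgue. \<bar>\<theta>' (u x) * (g x \<bullet> b) - \<theta>' (U n x) * (g x \<bullet> b)\<bar>) \<longlonglongrightarrow> 0"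
      proof (rule integral_norm_bound_LIMSEQ[where w = "\<lambda>x. K * \<bar>g x \<bullet> b\<bar>"])
        show "AE x in lebesgue. (\<lambda>n. \<theta>' (U n x) * (g x \<bullet> b))
            \<longlonglongrightarrow> \<theta>' (u x) * (g x \<bullet> b)"
          using aeU
        proof eventually_elim
          case (elim x)
          have "isCont \<theta>' (u x)" using \<theta>(2) continuous_on_eq_continuous_at open_UNIV by blast
          from isCont_tendsto_compose[OF this elim] show ?case by (intro tendsto_intros)
        qed
        show "(\<lambda>x. \<theta>' (U n x) * (g x \<bullet> b)) \<in> borel_measurable lebesgue" for n
            using i\<theta>'[OF mU gb] by auto
        show "AE x in lebesgue. \<bar>\<theta>' (U n x) * (g x \<bullet> b)\<bar>
            \<le> K * \<bar>g x \<bullet> b\<bar>" for n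
          unfolding abs_mult by (intro AE_I2 mult_right_mono \<theta>(3)) simp
      qed (use gb in auto)
      have "(\<lambda>n. K * (LINT x|lebesgue. \<bar>H b n x - g x \<bullet> b\<bar>) + (LINT x|lebesgue. \<bar>\<theta>' (u x) * (g x \<bullet> b) - \<theta>' (U n x) * (g x \<bullet> b)\<bar>)) \<longlonglongrightarrow> K * 0 + 0"
        by (intro tendsto_add tendsto_mult tendsto_const H(2) t2)
      then have lim: "(\<lambda>n. K * (LINT x|lebesgue. \<bar>H b n x - g x \<bullet> b\<bar>) + (LINT x|lebesgue. \<bar>\<theta>' (u x) * (g x \<bullet> b) - \<theta>' (U n x) * (g x \<bullet> b)\<bar>)) \<longlonglongrightarrow> 0"
        by simp
      show "(\<lambda>n. LINT x|lebesgue. \<bar>\<theta>' (U n x) * H b n x - \<theta>' (u x) * (g x \<bullet> b)\<bar>) \<longlonglongrightarrow> 0"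
        by (rule null_squeeze[OF _ le lim]) simp
    qed (use mU gb H in auto)
    have "(\<lambda>n. - (LINT x|lebesgue. (\<theta>' (U n x) * H b n x) * \<eta> x))
        \<longlonglongrightarrow> (LINT x|lebesgue. \<theta> (u x) * frechet_derivative \<eta> (at x) b)"
      using l1 unfolding parts .
    from LIMSEQ_unique[OF this tendsto_minus[OF l2]]
    show "(LINT x|lebesgue. \<theta> (u x) * frechet_derivative \<eta> (at x) b)
        = - (LINT x|lebesgue. (\<theta>' (u x) *\<^sub>R g x \<bullet> b) * \<eta> x)"
      by simp
  qed
qed

subsection \<open>A vector field pushing the boundary out of a Lipschitz domain\<close>

lemma norm_minus_projection_le:
  fixes w e :: "'a::euclidean_space"
  assumes "norm e = 1"
  shows "norm (w - (w \<bullet> e) *\<^sub>R e) \<le> norm w"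
proof -
  have "e \<bullet> e = 1" using assms by (simp add: norm_eq_1)
  then have "(norm (w - (w \<bullet> e) *\<^sub>R e))\<^sup>2 = (norm w)\<^sup>2 - (w \<bullet> e)\<^sup>2"
    unfolding power2_norm_eq_inner inner_diff_left inner_diff_right inner_scaleR_left inner_scaleR_right
    by (simp only: inner_commute[of e w] power2_eq_square) (simp add: algebra_simps)
  then have "(norm (w - (w \<bullet> e) *\<^sub>R e))\<^sup>2 \<le> (norm w)\<^sup>2" by simp
  then show ?thesis by (rule power2_le_imp_le) simp
qed

text \<open>Moving by -t (e + w) lowers the height by t (1 + w \<bullet> e), while the graph drops
  by at most t M |w|. With C = M + 1 the condition on w gives M |w| \<le> 1 - |w| \<le> 1 + w
  \<bullet> e, so a point on or below the graph stays there. The cone is available at every exterior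
  point of the ball, which allows moves to be concatenated.\<close>

lemma lipschitz_domain_exterior_cone:
  fixes \<Omega> :: "'a::euclidean_space set"
  assumes \<Omega>: "lipschitz_domain \<Omega>" and z: "z \<in> frontier \<Omega>"
  shows "\<exists>r>0. \<exists>e C. norm e = 1 \<and> 1
      \<le> C \<and> (\<forall>x t w. x \<in> ball z r \<longrightarrow> x \<notin> \<Omega>
          \<longrightarrow> 0 \<le> t \<longrightarrow>
    C * norm w \<le> 1 \<longrightarrow> x - t *\<^sub>R (e + w) \<in> ball z r
        \<longrightarrow> x - t *\<^sub>R (e + w) \<notin> \<Omega>)"
proof -
  obtain r e \<psi> M where r: "r > 0" and e: "norm e = 1" and lip: "M-lipschitz_on {y. y \<bullet> e = 0} \<psi>"
    and eq: "\<Omega> \<inter> ball z r = {x \<in> ball z r. \<psi> (x - (x \<bullet> e) *\<^sub>R e) < x \<bullet> e}"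
    using \<Omega> z unfolding lipschitz_domain_def by blast
  have ee: "e \<bullet> e = 1" using e by (simp add: norm_eq_1)
  have M: "M \<ge> 0" using lip by (rule lipschitz_on_nonneg)
  have "x - t *\<^sub>R (e + w) \<notin> \<Omega>"
    if x: "x \<in> ball z r" "x \<notin> \<Omega>" and t: "0 \<le> t" and w: "(M + 1) * norm w \<le> 1"
      and y: "x - t *\<^sub>R (e + w) \<in> ball z r" for x t w
  proof -
    define y where "y = x - t *\<^sub>R (e + w)"
    define px where "px = x - (x \<bullet> e) *\<^sub>R e"
    define py where "py = y - (y \<bullet> e) *\<^sub>R e"
    have ye: "y \<bullet> e = x \<bullet> e - t * (1 + w \<bullet> e)"
      by (simp add: y_def inner_diff_left inner_add_left ee)
    have d: "py - px = - t *\<^sub>R (w - (w \<bullet> e) *\<^sub>R e)"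
      unfolding py_def px_def ye by (simp add: y_def algebra_simps)
    have "dist (\<psi> py) (\<psi> px) \<le> M * dist py px"
      by (rule lipschitz_onD[OF lip]) (simp_all add: py_def px_def inner_diff_left ee)
    also have "dist py px = t * norm (w - (w \<bullet> e) *\<^sub>R e)"
      using t unfolding dist_norm d by simp
    also have "M * \<dots> \<le> M * (t * norm w)"
      by (intro mult_left_mono norm_minus_projection_le e t M)
    finally have \<psi>: "\<psi> py \<ge> \<psi> px - t * (M * norm w)" by (simp add: dist_real_def algebra_simps)
    have "\<bar>w \<bullet> e\<bar> \<le> norm w" using Cauchy_Schwarz_ineq2[of w e] e by simp
    then have "M * norm w \<le> 1 + w \<bullet> e" using w by (simp add: algebra_simps)
    then have "t * (M * norm w) \<le> t * (1 + w \<bullet> e)" using t by (rule mult_left_mono)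
    moreover have "\<psi> px \<ge> x \<bullet> e" using eq x unfolding px_def by force
    ultimately have "\<psi> py \<ge> y \<bullet> e" using \<psi> ye by linarith
    then have "y \<notin> {x \<in> ball z r. \<psi> (x - (x \<bullet> e) *\<^sub>R e) < x \<bullet> e}"
        by (simp add: py_def)
    then have "y \<notin> \<Omega> \<inter> ball z r" by (simp only: eq not_False_eq_True)
    then show ?thesis using y unfolding y_def by blast
  qed
  then show ?thesis
    using r e M by (intro exI[of _ r] conjI exI[of _ e] exI[of _ "M + 1"]) auto
qed

lemma Cc_infinity_sum:
  assumes "finite I" "\<And>i. i \<in> I \<Longrightarrow> f i \<in> Cc_infinity A"
  shows "(\<lambda>x. \<Sum>i\<in>I. f i x) \<in> Cc_infinity A"
  using assms
proof (induction I rule: finite_induct)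
  case empty
  show ?case
    unfolding Cc_infinity_iff
    by (intro conjI exI[of _ "{}"]) (simp_all add: smooth_def Ck_fun_const)
next
  case (insert i I)
  obtain K where K: "smooth (f i)" "compact K" "K \<subseteq> A" "\<And>x. x \<notin> K \<Longrightarrow> f i x = 0"
    using insert.prems[of i] unfolding Cc_infinity_iff by auto
  have "(\<lambda>x. \<Sum>i\<in>I. f i x) \<in> Cc_infinity A" using insert by simp
  then obtain K' where K': "smooth (\<lambda>x. \<Sum>i\<in>I. f i x)" "compact K'" "K' \<subseteq> A" "\<And>x. x \<notin> K' \<Longrightarrow> (\<Sum>i\<in>I. f i x) = 0"
    unfolding Cc_infinity_iff by blast
  have "smooth (\<lambda>x. f i x + (\<Sum>i\<in>I. f i x))"
    by (rule smooth_add[OF K(1) K'(1)])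
  then have "(\<lambda>x. f i x + (\<Sum>i\<in>I. f i x)) \<in> Cc_infinity A"
    unfolding Cc_infinity_iff using K(2-4) K'(2-4)
    by (intro conjI exI[of _ "K \<union> K'"] compact_Un) auto
  then show ?case using insert.hyps by simp
qed

lemma Cc_infinity_cmult: "f \<in> Cc_infinity A \<Longrightarrow> (\<lambda>x. f x * c) \<in> Cc_infinity A"
  by (rule Cc_infinity_mult) (auto simp: smooth_def Ck_fun_const)

text \<open>The field is minus a finite sum of bumps times local cone axes. From f outside \<Omega>,
  a point y near x + \<delta> h x is reached by one move per centre, each inside the exterior cone
  of that centre, so the path of positions never enters \<Omega>. The discrepancy caused by f
  \<noteq> x and y \<noteq> x + \<delta> h x is absorbed in a single move.\<close>

lemma lipschitz_domain_outward_field: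
  fixes \<Omega> :: "'a::euclidean_space set"
  assumes \<Omega>: "lipschitz_domain \<Omega>" and bd: "bounded \<Omega>"
  obtains h \<epsilon> \<delta>0 where "\<And>c. c \<in> Basis \<Longrightarrow>
      (\<lambda>x. h x \<bullet> c) \<in> Cc_infinity UNIV" "\<epsilon> > 0" "\<delta>0 > 0"
    "\<And>\<delta> x f y. 0 < \<delta> \<Longrightarrow> \<delta> < \<delta>0 \<Longrightarrow>
        f \<notin> \<Omega> \<Longrightarrow> norm (x - f) \<le> \<epsilon> * \<delta> \<Longrightarrow>
       norm (y - (x + \<delta> *\<^sub>R h x)) \<le> \<epsilon> * \<delta> \<Longrightarrow> y \<notin> \<Omega>"
proof -
  have op: "open \<Omega>" "\<Omega> \<noteq> {}" using \<Omega> by (auto simp: lipschitz_domain_def)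
  have "\<Omega> \<noteq> UNIV" using bd not_bounded_UNIV by blast
  then have F: "frontier \<Omega> \<noteq> {}" using op frontier_eq_empty by blast
  have "\<forall>z\<in>frontier \<Omega>. \<exists>r e C. r > 0 \<and> norm e = 1 \<and> 1
      \<le> C \<and> (\<forall>x t w. x \<in> ball z r \<longrightarrow> x \<notin> \<Omega>
          \<longrightarrow> 0 \<le> t \<longrightarrow>
    C * norm w \<le> 1 \<longrightarrow> x - t *\<^sub>R (e + w) \<in> ball z r
        \<longrightarrow> x - t *\<^sub>R (e + w) \<notin> \<Omega>)"
    using lipschitz_domain_exterior_cone[OF \<Omega>] by blast
  then obtain r e C where rec: "\<forall>z\<in>frontier \<Omega>. r z > 0 \<and> norm (e z) = 1 \<and> 1
      \<le> C z \<and> (\<forall>x t w. x \<in> ball z (r z)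
          \<longrightarrow> x \<notin> \<Omega> \<longrightarrow> 0 \<le> t \<longrightarrow>
    C z * norm w \<le> 1 \<longrightarrow> x - t *\<^sub>R (e z + w) \<in> ball z (r z)
        \<longrightarrow> x - t *\<^sub>R (e z + w) \<notin> \<Omega>)"
    unfolding bchoice_iff by (elim exE) (rule that)
  then have rp: "\<And>z. z \<in> frontier \<Omega> \<Longrightarrow> r z > 0"
    and en: "\<And>z. z \<in> frontier \<Omega> \<Longrightarrow> norm (e z) = 1"
        and C1: "\<And>z. z \<in> frontier \<Omega> \<Longrightarrow> 1 \<le> C z"
    and cone: "\<And>z x t w. z \<in> frontier \<Omega> \<Longrightarrow> x \<in> ball z (r z) \<Longrightarrow>
        x \<notin> \<Omega> \<Longrightarrow> 0 \<le> t \<Longrightarrow>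
      C z * norm w \<le> 1 \<Longrightarrow> x - t *\<^sub>R (e z + w) \<in> ball z (r z) \<Longrightarrow>
          x - t *\<^sub>R (e z + w) \<notin> \<Omega>"
    by blast+
  \<comment> \<open>Nested radii: balls of radius r/4 cover the frontier, the bumps are at least m
    up to 3r/8 = (3/4)(r/2), vanish from r/2 on, and the cone condition holds up to r.\<close>
  have "frontier \<Omega> \<subseteq> (\<Union>z\<in>frontier \<Omega>. ball z (r z / 4))"
    using rp by force
  then obtain Z where Z: "Z \<subseteq> frontier \<Omega>" "finite Z" "frontier \<Omega> \<subseteq> (\<Union>z\<in>Z. ball z (r z / 4))"
    using compactE_image[OF compact_frontier_bounded[OF bd], of "frontier \<Omega>" "\<lambda>z. ball z (r z / 4)"] by (metis open_ball)
  have Zne: "Z \<noteq> {}" using Z(3) F by auto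
  define r0 where "r0 = Min (r ` Z)"
  have r0: "r0 > 0" "\<And>z. z \<in> Z \<Longrightarrow> r0 \<le> r z"
    using Z Zne rp by (auto simp: r0_def)
  define C0 where "C0 = Max (C ` Z)"
  have C0: "\<And>z. z \<in> Z \<Longrightarrow> C z \<le> C0" using Z by (auto simp: C0_def)
  have C01: "C0 \<ge> 1" using Zne C0 C1 Z(1) by (metis all_not_in_conv order_trans subsetD)
  define m :: real where "m = exp (- 16/7)"
  have m: "0 < m" "m \<le> 1" by (auto simp: m_def)
  \<comment> \<open>The discrepancy is at most 2 \<epsilon> \<delta>, and the absorbing move has
    length at least \<delta> m; their ratio 2 \<epsilon> / m = 1 / C0 is the aperture common to all
    cones.\<close>
  define \<epsilon> where "\<epsilon> = m / (2 * C0)"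
  have \<epsilon>: "\<epsilon> > 0" "2 * \<epsilon> \<le> 1" "2 * \<epsilon> / m = 1 / C0"
    using m C01 by (auto simp: \<epsilon>_def field_simps)
  define N where "N = real (card Z)"
  have N: "N \<ge> 0" by (simp add: N_def)
  \<comment> \<open>All displacements together, at most \<delta> (N + 2), stay below r0/8, the gap
    between consecutive nested radii r/4, 3r/8 and r/2.\<close>
  define \<delta>0 where "\<delta>0 = r0 / (8 * (N + 2))"
  have \<delta>0: "\<delta>0 > 0" using r0 N by (simp add: \<delta>0_def)
  define \<theta> where "\<theta> z x = bump ((x - z) /\<^sub>R (r z / 2))" for z x
  have \<theta>01: "0 \<le> \<theta> z x" "\<theta> z x \<le> 1" for z x
      by (auto simp: \<theta>_def bump_nonneg bump_le)
  have \<theta>pos: "norm (x - z) < r z / 2" if "\<theta> z x \<noteq> 0" "z \<in> Z" for z x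
  proof -
    have "norm ((x - z) /\<^sub>R (r z / 2)) < 1"
      using that(1) bump_eq_0[of "(x - z) /\<^sub>R (r z / 2)"] unfolding \<theta>_def by force
    moreover have "r z / 2 > 0" using rp[of z] that(2) Z(1) by auto
    ultimately show ?thesis by (simp only: norm_scaleR_inverse divide_less_eq_1_pos)
  qed
  have \<theta>m: "m \<le> \<theta> z x" if "norm (x - z) \<le> 3/8 * r z" "z \<in> Z" for z x
  proof -
    have "r z / 2 > 0" using rp[of z] that(2) Z(1) by auto
    then have "norm ((x - z) /\<^sub>R (r z / 2)) \<le> 3/4"
      unfolding norm_scaleR_inverse[OF \<open>r z / 2 > 0\<close>] using that(1) by (subst pos_divide_le_eq) simp_all
    then show ?thesis unfolding \<theta>_def m_def by (rule bump_ge)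
  qed
  define h where "h x = - (\<Sum>z\<in>Z. \<theta> z x *\<^sub>R e z)" for x
  have hN: "norm (h x) \<le> N" for x
  proof -
    have "norm (h x) \<le> (\<Sum>z\<in>Z. norm (\<theta> z x *\<^sub>R e z))" unfolding h_def norm_minus_cancel
        by (rule norm_sum)
    also have "\<dots> \<le> (\<Sum>z\<in>Z. 1)"
      using \<theta>01 en Z(1) by (intro sum_mono) auto
    finally show ?thesis by (simp add: N_def)
  qed
  show thesis
  proof (rule that[of h \<epsilon> \<delta>0])
    fix c :: 'a
    have "(\<lambda>x. \<Sum>z\<in>Z. \<theta> z x * (- (e z \<bullet> c))) \<in> Cc_infinity UNIV"
    proof (intro Cc_infinity_sum[OF Z(2)] Cc_infinity_cmult)
      fix z assume "z \<in> Z"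
      then have rz: "r z > 0" using rp Z by auto
      have "(\<lambda>x. bump (- (z /\<^sub>R (r z / 2)) + (inverse (r z / 2)) *\<^sub>R x)) \<in> Cc_infinity UNIV"
        using rz by (intro Cc_infinity_UNIV_affine bump_Cc_infinity) simp
      then show "(\<lambda>x. \<theta> z x) \<in> Cc_infinity UNIV"
        by (simp add: \<theta>_def[abs_def] scaleR_diff_right)
    qed
    then show "(\<lambda>x. h x \<bullet> c) \<in> Cc_infinity UNIV"
      by (simp add: h_def inner_sum_left sum_negf)
  next
    fix \<delta> x f y
    assume \<delta>: "0 < \<delta>" "\<delta> < \<delta>0" and f: "f \<notin> \<Omega>" and xf: "norm (x - f)
        \<le> \<epsilon> * \<delta>"
      and yx: "norm (y - (x + \<delta> *\<^sub>R h x)) \<le> \<epsilon> * \<delta>"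
    have small: "\<delta> * (N + 2) < r0 / 8"
      using \<delta>(2) N by (simp add: \<delta>0_def field_simps)
    define q where "q = f + \<delta> *\<^sub>R h x - y"
    have "q = - (x - f) - (y - (x + \<delta> *\<^sub>R h x))" by (simp add: q_def algebra_simps)
    then have "norm q \<le> norm (x - f) + norm (y - (x + \<delta> *\<^sub>R h x))"
      using norm_triangle_ineq4[of "- (x - f)" "y - (x + \<delta> *\<^sub>R h x)"] by (metis norm_minus_cancel)
    then have q: "norm q \<le> 2 * \<epsilon> * \<delta>" using xf yx by linarith
    have qd: "norm q \<le> \<delta>" 
    proof -
      have "2 * \<epsilon> * \<delta> \<le> 1 * \<delta>" using \<epsilon>(2) \<delta> by (intro mult_right_mono) auto
      then show ?thesis using q by linarith
    qed
    have xfd: "norm (x - f) \<le> \<delta>"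
    proof -
      have "\<epsilon> * \<delta> \<le> 1 * \<delta>" using \<epsilon> \<delta> by (intro mult_right_mono) auto
      then show ?thesis using xf by simp
    qed
    show "y \<notin> \<Omega>"
    proof (cases "\<exists>i\<in>Z. norm (x - i) \<le> 3/8 * r i")
      case False
      \<comment> \<open>Here all bumps may be small, but the frontier is out of reach: a frontier
        point on the segment from f to y would be closer than r0/8 to x and closer than r/4 to some
        centre, contradicting the distance 3r/8.\<close>
      show ?thesis
      proof
        assume "y \<in> \<Omega>"
        then have "closed_segment f y \<inter> frontier \<Omega> \<noteq> {}"
          using f by (intro connected_Int_frontier) auto
        then obtain p where p: "p \<in> closed_segment f y" "p \<in> frontier \<Omega>" by blast
        have "norm (f - y) \<le> norm q + norm (\<delta> *\<^sub>R h x)"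
          using norm_triangle_ineq4[of q "\<delta> *\<^sub>R h x"] by (simp add: q_def)
        also have "\<dots> \<le> \<delta> + \<delta> * N"
        proof -
          have "\<delta> * norm (h x) \<le> \<delta> * N" using hN[of x] \<delta>(1) by (intro mult_left_mono) auto
          moreover have "norm (\<delta> *\<^sub>R h x) = \<delta> * norm (h x)" using \<delta>(1) by simp
          ultimately show ?thesis using qd by linarith
        qed
        finally have "norm (p - f) \<le> \<delta> + \<delta> * N"
          using segment_bound(1)[OF p(1)] by (simp add: norm_minus_commute)
        then have px: "norm (x - p) \<le> \<delta> * (N + 2)"
          using xfd norm_triangle_ineq4[of "x - f" "p - f"] by (simp add: algebra_simps)
        obtain i where i: "i \<in> Z" "norm (p - i) < r i / 4"
          using p(2) Z(3) by (auto simp: dist_norm norm_minus_commute)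
        have "norm (x - i) \<le> 3/8 * r i"
          using px i small r0(2)[OF i(1)] norm_triangle_ineq[of "x - p" "p - i"] by simp
        then show False using False i by blast
      qed
    next
      case True
      then obtain i where i: "i \<in> Z" "norm (x - i) \<le> 3/8 * r i" by blast
      have mi: "m \<le> \<theta> i x" by (rule \<theta>m[OF i(2,1)])
      \<comment> \<open>The vector f - y is split into one move per centre. Index i takes the whole
        discrepancy q, as its bump is at least m at x.\<close>
      define v where "v j = (\<delta> * \<theta> j x) *\<^sub>R e j + (if j = i then q else 0)" for j
      have out: "J \<subseteq> Z \<Longrightarrow> f - (\<Sum>j\<in>J. v j) \<notin> \<Omega>" if "finite J" for J
        using that
      proof (induction J rule: finite_induct)
        case empty
        then show ?case using f by simp
      next
        case (insert j J)
        have near: "norm ((f - (\<Sum>k\<in>I. v k)) - f) \<le> \<delta> * (N + 1)" if "I \<subseteq> Z" for I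
        proof -
          have fin: "finite I" using that Z(2) finite_subset by blast
          have Sv: "(\<Sum>k\<in>I. v k)
              = (\<Sum>k\<in>I. (\<delta> * \<theta> k x) *\<^sub>R e k) + (if i \<in> I then q else 0)"
            unfolding v_def sum.distrib using fin by simp
          have "norm ((f - (\<Sum>k\<in>I. v k)) - f)
              = norm ((\<Sum>k\<in>I. (\<delta> * \<theta> k x) *\<^sub>R e k) + (if i \<in> I then q else 0))"
            unfolding Sv[symmetric] by simp
          also have "\<dots> \<le> norm (\<Sum>k\<in>I. (\<delta> * \<theta> k x) *\<^sub>R e k) + norm (if i \<in> I then q else 0)"
            by (rule norm_triangle_ineq)
          finally have 1: "norm ((f - (\<Sum>k\<in>I. v k)) - f)
              \<le> norm (\<Sum>k\<in>I. (\<delta> * \<theta> k x) *\<^sub>R e k) + norm (if i \<in> I then q else 0)" .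
          have "norm (\<Sum>k\<in>I. (\<delta> * \<theta> k x) *\<^sub>R e k) \<le> (\<Sum>k\<in>I. \<delta>)"
            by (rule order.trans[OF norm_sum], rule sum_mono)
              (use \<theta>01 en Z(1) that \<delta> in \<open>auto simp: subset_iff mult_left_le\<close>)
          also have "(\<Sum>k\<in>I. \<delta>) \<le> \<delta> * N"
            using card_mono[OF Z(2) that] \<delta>(1) by (simp add: N_def)
          finally have "norm (\<Sum>k\<in>I. (\<delta> * \<theta> k x) *\<^sub>R e k) \<le> \<delta> * N" .
          moreover note 1
          moreover have "norm (if i \<in> I then q else 0) \<le> \<delta>" using qd \<delta>(1) by simp
          moreover have "\<delta> * (N + 1) = \<delta> * N + \<delta>" by (simp add: algebra_simps)
          ultimately show ?thesis by linarith
        qed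
        have jZ: "j \<in> Z" "J \<subseteq> Z" using insert.prems by auto
        have IH: "f - (\<Sum>k\<in>J. v k) \<notin> \<Omega>" using insert jZ by blast
        have eq: "f - (\<Sum>k\<in>insert j J. v k) = (f - (\<Sum>k\<in>J. v k)) - v j"
          using insert.hyps by simp
        show ?case
        proof (cases "\<theta> j x = 0")
          case True
          then have "j \<noteq> i" using mi m by auto
          with True have "v j = 0" by (simp add: v_def)
          with eq IH show ?thesis by simp
        next
          case False
          have th: "\<theta> j x > 0" using False \<theta>01[of j x] by linarith
          \<comment> \<open>A nonzero bump puts x within r j / 2 of j, and every intermediate
            position differs from x by at most \<delta> (N + 2), so both ends of the move lie where
            the cone at j is valid.\<close>
          have inb: "f - (\<Sum>k\<in>I. v k) \<in> ball j (r j)" if "I \<subseteq> Z" for I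
          proof -
            have "norm (P - j) \<le> norm (P - f) + norm (f - j)" for P
              using norm_triangle_ineq[of "P - f" "f - j"] by simp
            then have "norm ((f - (\<Sum>k\<in>I. v k)) - j)
                \<le> norm ((f - (\<Sum>k\<in>I. v k)) - f) + norm (f - j)" .
            also have "\<dots> \<le> \<delta> * (N + 1) + (norm (x - f) + norm (x - j))"
              using near[OF that] norm_triangle_ineq4[of "x - j" "x - f"] by simp
            also have "\<dots> < r j"
              using xfd \<theta>pos[OF False jZ(1)] small r0(2)[OF jZ(1)] r0(1) by (simp add: algebra_simps)
            finally show ?thesis by (simp add: dist_norm norm_minus_commute)
          qed
          define w where "w = (if j = i then q /\<^sub>R (\<delta> * \<theta> j x) else 0)"
          have nz: "\<delta> * \<theta> j x \<noteq> 0" using th \<delta>(1) by simp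
          have vj: "v j = (\<delta> * \<theta> j x) *\<^sub>R (e j + w)"
            using nz by (auto simp: v_def w_def scaleR_add_right right_inverse[OF nz] simp del: inverse_mult_distrib)
          have Cw: "C j * norm w \<le> 1"
          proof (cases "j = i")
            case True
            have "norm w = norm q / (\<delta> * \<theta> i x)"
              using True th \<delta>(1) by (simp add: w_def divide_inverse mult.commute)
            also have "\<dots> \<le> (2 * \<epsilon> * \<delta>) / (\<delta> * m)"
              using q mi m \<delta>(1) \<epsilon>(1) by (intro frac_le mult_left_mono) auto
            also have "\<dots> = 1 / C0" using \<epsilon>(3) \<delta>(1) by simp
            finally have "norm w \<le> 1 / C0" .
            then have "C j * norm w \<le> C0 * (1 / C0)"
              using C0[OF jZ(1)] C01 by (intro mult_mono) auto
            then show ?thesis using C01 by simp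
          qed (simp add: w_def)
          have "(f - (\<Sum>k\<in>J. v k)) - (\<delta> * \<theta> j x) *\<^sub>R (e j + w) \<notin> \<Omega>"
          proof (rule cone)
            show "(f - (\<Sum>k\<in>J. v k)) - (\<delta> * \<theta> j x) *\<^sub>R (e j + w) \<in> ball j (r j)"
              using inb[OF insert.prems] unfolding eq vj .
          qed (use jZ Z(1) inb IH Cw \<delta>(1) th in auto)
          then show ?thesis unfolding eq vj .
        qed
      qed
      have "f - (\<Sum>j\<in>Z. v j) = y"
        unfolding v_def sum.distrib using Z(2) i(1)
        by (simp add: h_def q_def scaleR_sum_right)
      then show ?thesis using out[OF Z(2)] by simp
    qed
  qed (use \<epsilon> \<delta>0 in auto)
qed

section \<open>Uniform bounds for test functions and for the pushing field\<close>

lemma Cc_infinity_lipschitz: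
  fixes k :: "'a::euclidean_space \<Rightarrow> real"
  assumes k: "k \<in> Cc_infinity UNIV"
  obtains L where "L \<ge> 0" "\<And>x y. \<bar>k x - k y\<bar> \<le> L * norm (x - y)"
    "\<And>x b. b \<in> Basis \<Longrightarrow> \<bar>frechet_derivative k (at x) b\<bar> \<le> L"
proof -
  have "\<exists>B>0. \<forall>x. \<bar>frechet_derivative k (at x) b\<bar> \<le> B" if "b \<in> Basis" for b
    using Cc_infinity_UNIV_bounded[OF Cc_infinity_frechet_derivative[OF k that]] by metis
  then obtain B where B: "\<And>b. b \<in> Basis \<Longrightarrow>
      B b > 0" "\<And>b x. b \<in> Basis \<Longrightarrow> \<bar>frechet_derivative k (at x) b\<bar> \<le> B b"
    by metis
  define L where "L = (\<Sum>b\<in>(Basis::'a set). B b)"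
  have L: "L \<ge> 0" unfolding L_def using B(1) by (intro sum_nonneg) (auto intro: less_imp_le)
  have der: "(k has_derivative frechet_derivative k (at x)) (at x)" for x
    by (rule smooth_has_derivative[OF Cc_infinity_smooth[OF k]])
  have on: "onorm (frechet_derivative k (at x)) \<le> L" for x
  proof (rule onorm_le)
    fix h
    have "norm (frechet_derivative k (at x) h)
        = \<bar>\<Sum>b\<in>Basis. (h \<bullet> b) * frechet_derivative k (at x) b\<bar>"
      by (subst linear_eq_sum_Basis[OF has_derivative_linear[OF der]]) simp
    also have "\<dots> \<le> (\<Sum>b\<in>Basis. \<bar>(h \<bullet> b) * frechet_derivative k (at x) b\<bar>)"
        by (rule sum_abs)
    also have "\<dots> \<le> (\<Sum>b\<in>Basis. norm h * B b)"
      unfolding abs_mult by (intro sum_mono mult_mono Basis_le_norm B) auto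
    also have "\<dots> = L * norm h" by (simp add: L_def sum_distrib_left mult.commute)
    finally show "norm (frechet_derivative k (at x) h) \<le> L * norm h" .
  qed
  show thesis
  proof (rule that[OF L])
    fix x y
    have "norm (k x - k y) \<le> L * norm (x - y)"
      by (rule differentiable_bound[of UNIV k "\<lambda>x. frechet_derivative k (at x)"]) (use der on in auto)
    then show "\<bar>k x - k y\<bar> \<le> L * norm (x - y)" by simp
  next
    fix x b :: 'a assume b: "b \<in> Basis"
    have "B b \<le> L" unfolding L_def using b B(1) by (intro member_le_sum) (auto intro: less_imp_le)
    then show "\<bar>frechet_derivative k (at x) b\<bar> \<le> L" using B(2)[OF b, of x] by linarith
  qed
qed

lemma Cc_infinity_field_bounds:
  fixes h :: "'a::euclidean_space \<Rightarrow> 'a"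
  assumes h: "\<And>c. c \<in> Basis \<Longrightarrow> (\<lambda>x. h x \<bullet> c) \<in> Cc_infinity UNIV"
  obtains L where "L > 0" "\<And>x. norm (h x) \<le> L" "\<And>x y. norm (h x - h y) \<le> L * norm (x - y)"
    "\<And>x b c. b \<in> Basis \<Longrightarrow> c \<in> Basis \<Longrightarrow>
        \<bar>frechet_derivative (\<lambda>x. h x \<bullet> c) (at x) b\<bar> \<le> L"
proof -
  have "\<exists>L. L \<ge> 0 \<and> (\<forall>x y. \<bar>h x \<bullet> c - h y \<bullet> c\<bar>
      \<le> L * norm (x - y)) \<and>
      (\<forall>x. \<forall>b\<in>Basis. \<bar>frechet_derivative (\<lambda>x. h x \<bullet> c) (at x) b\<bar> \<le> L)" if "c \<in> Basis" for c
    using Cc_infinity_lipschitz[OF h[OF that]] by metis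
  then obtain L where L: "\<And>c. c \<in> Basis \<Longrightarrow> L c \<ge> 0"
    "\<And>c x y. c \<in> Basis \<Longrightarrow> \<bar>h x \<bullet> c - h y \<bullet> c\<bar>
        \<le> L c * norm (x - y)"
    "\<And>c x b. c \<in> Basis \<Longrightarrow> b \<in> Basis \<Longrightarrow>
        \<bar>frechet_derivative (\<lambda>x. h x \<bullet> c) (at x) b\<bar> \<le> L c"
    by metis
  have "\<exists>B>0. \<forall>x. \<bar>h x \<bullet> c\<bar> \<le> B" if "c \<in> Basis" for c
    using Cc_infinity_UNIV_bounded[OF h[OF that]] by metis
  then obtain B where B: "\<And>c. c \<in> Basis \<Longrightarrow>
      B c > 0" "\<And>c x. c \<in> Basis \<Longrightarrow> \<bar>h x \<bullet> c\<bar> \<le> B c"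
    by metis
  let ?S = "\<Sum>c\<in>(Basis::'a set). L c" and ?T = "\<Sum>c\<in>(Basis::'a set). B c"
  have S: "?S \<ge> 0" "?T \<ge> 0" using L(1) B(1) by (simp_all add: sum_nonneg less_imp_le)
  show thesis
  proof (rule that[of "?S + ?T + 1"])
    show "?S + ?T + 1 > 0" using S by simp
    fix x y
    have "norm (h x) \<le> (\<Sum>c\<in>Basis. \<bar>h x \<bullet> c\<bar>)" by (rule norm_le_l1)
    also have "\<dots> \<le> ?T" by (intro sum_mono B)
    finally show "norm (h x) \<le> ?S + ?T + 1" using S by simp
    have "norm (h x - h y) \<le> (\<Sum>c\<in>Basis. \<bar>(h x - h y) \<bullet> c\<bar>)" by (rule norm_le_l1)
    also have "\<dots> \<le> (\<Sum>c\<in>Basis. L c * norm (x - y))"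
      unfolding inner_diff_left by (intro sum_mono L)
    also have "\<dots> = ?S * norm (x - y)" by (simp add: sum_distrib_right)
    also have "\<dots> \<le> (?S + ?T + 1) * norm (x - y)" using S by (intro mult_right_mono) auto
    finally show "norm (h x - h y) \<le> (?S + ?T + 1) * norm (x - y)" .
  next
    fix x b c :: 'a assume bc: "b \<in> Basis" "c \<in> Basis"
    have "L c \<le> ?S" using bc L(1) by (intro member_le_sum) auto
    then show "\<bar>frechet_derivative (\<lambda>x. h x \<bullet> c) (at x) b\<bar> \<le> ?S + ?T + 1"
      using L(3)[OF bc(2,1), of x] S by linarith
  qed
qed

subsection \<open>Boundary values of Hoelder continuous functions in \<open>W\<^sub>0\<^sup>1\<^sup>,\<^sup>1(\<Omega>)\<close>\<close>

text \<open>Squaring the positive part removes the kink; this gives a C^1 cutoff of elementary form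
  for the chain rule.\<close>

lemma positive_part_square_deriv:
  "((\<lambda>s::real. (max 0 s)\<^sup>2) has_real_derivative 2 * max 0 s) (at s)"
proof -
  consider "s > 0" | "s < 0" | "s = 0" by linarith
  then show ?thesis
  proof cases
    case 1
    have "\<forall>\<^sub>F t in nhds s. (max 0 t)\<^sup>2 = t\<^sup>2"
      using eventually_nhds_in_open[of "{0<..}" s] 1 by (auto elim!: eventually_mono)
    moreover have "((\<lambda>t. t\<^sup>2) has_real_derivative 2 * max 0 s) (at s)"
      using 1 by (auto intro!: derivative_eq_intros)
    ultimately show ?thesis by (subst DERIV_cong_ev) auto
  next
    case 2
    have ev: "\<forall>\<^sub>F t in nhds s. (max 0 t)\<^sup>2 = (\<lambda>_. 0) t"
      using eventually_nhds_in_open[of "{..<0}" s] 2 by (auto elim!: eventually_mono)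
    have "((\<lambda>_. 0) has_real_derivative 2 * max 0 s) (at s)" using 2 by simp
    then show ?thesis by (simp only: DERIV_cong_ev[where g = "\<lambda>_. 0", OF refl ev refl])
  next
    case 3
    have "((\<lambda>h. (max 0 h)\<^sup>2 / h) \<longlongrightarrow> (0::real)) (at 0)"
    proof (rule Lim_null_comparison)
      show "\<forall>\<^sub>F h in at 0. norm ((max 0 h)\<^sup>2 / h) \<le> \<bar>h :: real\<bar>"
      proof (intro always_eventually allI)
        fix h :: real show "norm ((max 0 h)\<^sup>2 / h) \<le> \<bar>h\<bar>"
          by (cases "h > 0") (auto simp: power2_eq_square max_def)
      qed
      show "((\<lambda>h. \<bar>h\<bar>) \<longlongrightarrow> (0::real)) (at 0)"
          by (intro tendsto_rabs_zero tendsto_ident_at)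
    qed
    then show ?thesis using 3 by (simp add: DERIV_def)
  qed
qed

text \<open>If \<open>u\<close> did not tend to \<open>0\<close> at a boundary point, a cutoff of \<open>u\<close> would near that point
  coincide with the indicator function of \<open>\<Omega>\<close>, with vanishing weak gradient.\<close>

lemma holder_boundary_value:
  fixes u :: "'a::euclidean_space \<Rightarrow> real"
  assumes \<Omega>: "lipschitz_domain \<Omega>" and wg: "global_weak_gradient u g"
      and out: "\<And>x. x \<notin> \<Omega> \<Longrightarrow> u x = 0"
    and hol: "\<And>x y. x \<in> \<Omega> \<Longrightarrow> y \<in> \<Omega> \<Longrightarrow>
        \<bar>u x - u y\<bar> \<le> A * norm (x - y) powr \<gamma>" and A: "A \<ge> 0" and \<gamma>: "\<gamma> > 0"
    and z: "z \<in> frontier \<Omega>" and \<epsilon>: "\<epsilon> > 0"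
  shows "\<exists>\<rho>>0. \<forall>x\<in>\<Omega> \<inter> ball z \<rho>. \<bar>u x\<bar> \<le> \<epsilon>"
proof (rule ccontr)
  assume neg: "\<not> ?thesis"
  have op: "open \<Omega>" using \<Omega> by (auto simp: lipschitz_domain_def)
  have zn: "z \<notin> \<Omega>" "z \<in> closure \<Omega>" using z op by (auto simp: frontier_def interior_open)
  \<comment> \<open>The radius is chosen so that u oscillates by less than \<epsilon>/2 on the part
    of \<Omega> in the ball; one value above \<epsilon> then keeps |u| above \<epsilon>/2
    there.\<close>
  have "((\<lambda>t. A * (2 * t) powr \<gamma>) \<longlongrightarrow> A * (2 * 0) powr \<gamma>) (at_right 0)"
    using \<gamma> by (intro tendsto_intros tendsto_powr' tendsto_ident_at)
      (auto simp: eventually_at_filter)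
  then have "\<forall>\<^sub>F t in at_right 0. A * (2 * t) powr \<gamma> < \<epsilon> / 2"
    using \<epsilon> by (intro order_tendstoD) auto
  then obtain \<rho> where \<rho>: "\<rho> > 0" "A * (2 * \<rho>) powr \<gamma> < \<epsilon> / 2"
    by (auto simp: eventually_at_right_field dest: dense)
  obtain x0 where x0: "x0 \<in> \<Omega>" "x0 \<in> ball z \<rho>" "\<bar>u x0\<bar> > \<epsilon>"
    using neg \<rho>(1) by (meson Int_iff not_le)
  have big: "\<bar>u x\<bar> \<ge> \<epsilon> / 2" if "x \<in> \<Omega>" "x \<in> ball z \<rho>" for x
  proof -
    have "norm (x - x0) \<le> 2 * \<rho>"
      using that(2) x0(2) norm_triangle_ineq4[of "x - z" "x0 - z"] by (simp add: dist_norm norm_minus_commute)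
    then have "norm (x - x0) powr \<gamma> \<le> (2 * \<rho>) powr \<gamma>" using \<gamma> by (intro powr_mono2) auto
    then have "\<bar>u x - u x0\<bar> \<le> A * (2 * \<rho>) powr \<gamma>"
      using hol[OF that(1) x0(1)] mult_left_mono[OF _ A] by (meson order_trans)
    then show ?thesis using \<rho>(2) x0(3) by linarith
  qed
  define c where "c = \<epsilon> / 2"
  have c: "c > 0" using \<epsilon> by (simp add: c_def)
  \<comment> \<open>A C^1 function with value 0 at 0 and value 1 for |t| \<ge> c. Near z the
    function u is either 0 or at least c in modulus, so the composition is the indicator of \<Omega>
    and the factor \<theta>' of its gradient vanishes.\<close>
  define \<theta> where "\<theta> t = 1 - (max 0 (1 - (t / c)\<^sup>2))\<^sup>2" for t :: real
  define \<theta>' where "\<theta>' t = 2 * max 0 (1 - (t / c)\<^sup>2) * (2 * t / c\<^sup>2)" for t :: real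
  have d\<theta>: "(\<theta> has_real_derivative \<theta>' t) (at t)" for t
  proof -
    have "((\<lambda>t. 1 - (t / c)\<^sup>2) has_real_derivative - (2 * t / c\<^sup>2)) (at t)"
      using c by (auto intro!: derivative_eq_intros simp: field_simps power2_eq_square)
    from DERIV_chain2[OF positive_part_square_deriv this]
    have "((\<lambda>t. (max 0 (1 - (t / c)\<^sup>2))\<^sup>2) has_real_derivative 2 * max 0 (1 - (t / c)\<^sup>2) * - (2 * t / c\<^sup>2)) (at t)" .
    from DERIV_diff[OF DERIV_const[of 1] this] show ?thesis
      by (simp add: \<theta>_def[abs_def] \<theta>'_def)
  qed
  have c\<theta>: "continuous_on UNIV \<theta>'"
    unfolding \<theta>'_def using c by (intro continuous_intros) auto
  have big1: "\<theta> t = 1" "\<theta>' t = 0" if "\<bar>t\<bar> \<ge> c" for t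
  proof -
    have "(t / c)\<^sup>2 \<ge> 1"
      using that c abs_le_square_iff[of 1 "t / c"] by (simp add: abs_divide)
    then show "\<theta> t = 1" "\<theta>' t = 0" by (auto simp: \<theta>_def \<theta>'_def max_def)
  qed
  have b\<theta>: "\<bar>\<theta>' t\<bar> \<le> 4 / c" for t
  proof (cases "\<bar>t\<bar> \<ge> c")
    case False
    have "\<bar>\<theta>' t\<bar> = 2 * max 0 (1 - (t / c)\<^sup>2) * (2 * \<bar>t\<bar> / c\<^sup>2)"
      by (simp add: \<theta>'_def abs_mult)
    also have "\<dots> \<le> 2 * 1 * (2 * c / c\<^sup>2)"
      using False c by (intro mult_mono divide_right_mono) auto
    also have "\<dots> = 4 / c" using c by (simp add: power2_eq_square)
    finally show ?thesis .
  qed (use big1 c in auto)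
  have wg2: "global_weak_gradient (\<lambda>x. \<theta> (u x)) (\<lambda>x. \<theta>' (u x) *\<^sub>R g x)"
    by (rule global_weak_gradient_chain[OF wg d\<theta> c\<theta> b\<theta>]) (simp add: \<theta>_def)
  have v: "\<theta> (u x) = indicator \<Omega> x" "\<theta>' (u x) = 0" if "x \<in> ball z \<rho>" for x
  proof -
    show "\<theta> (u x) = indicator \<Omega> x"
      using big1(1)[of "u x"] big[OF _ that] out[of x] by (cases "x \<in> \<Omega>") (auto simp: c_def \<theta>_def)
    show "\<theta>' (u x) = 0"
      using big1(2)[of "u x"] big[OF _ that] out[of x] by (cases "x \<in> \<Omega>") (auto simp: c_def \<theta>'_def)
  qed
  obtain x1 where x1: "x1 \<in> \<Omega>" "dist x1 z < \<rho> / 2"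
    using zn(2) \<rho>(1) closure_approachable by (metis half_gt_zero)
  have "open (\<Omega> \<inter> ball z (\<rho> / 2))" using op by auto
  moreover have "x1 \<in> \<Omega> \<inter> ball z (\<rho> / 2)" using x1 by (simp add: dist_commute)
  ultimately obtain s1 where s1: "s1 > 0" "cball x1 s1 \<subseteq> \<Omega> \<inter> ball z (\<rho> / 2)"
    using open_contains_cball by metis
  obtain x2 s2 where s2: "s2 > 0" "cball x2 s2 \<subseteq> ball z (\<rho> / 2)" "cball x2 s2 \<inter> \<Omega> = {}"
  proof -
    obtain r e C where r: "r > 0" "norm e = 1" "1 \<le> C"
        and cone: "\<And>x t w. x \<in> ball z r \<Longrightarrow> x \<notin> \<Omega> \<Longrightarrow> 0
            \<le> t \<Longrightarrow>
        C * norm w \<le> 1 \<Longrightarrow> x - t *\<^sub>R (e + w) \<in> ball z r \<Longrightarrow>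
            x - t *\<^sub>R (e + w) \<notin> \<Omega>"
      using lipschitz_domain_exterior_cone[OF \<Omega> z] by blast
    \<comment> \<open>The ball of radius t / C around z - t e consists of the points z - t (e + w)
      with |w| \<le> 1/C, so it lies in the exterior cone; t is small enough to remain in both balls
      around z.\<close>
    define t where "t = min r (\<rho> / 2) / 4"
    have t: "t > 0" "2 * t < r" "2 * t < \<rho> / 2" using r \<rho> by (auto simp: t_def)
    have st: "t / C \<le> t" using t r by (simp add: divide_le_eq)
    have in2: "norm (y - z) \<le> 2 * t" if "y \<in> cball (z - t *\<^sub>R e) (t / C)" for y
    proof -
      have "norm (y - z) \<le> norm (y - (z - t *\<^sub>R e)) + norm (t *\<^sub>R e)"
        using norm_triangle_ineq4[of "y - (z - t *\<^sub>R e)" "t *\<^sub>R e"] by simp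
      then show ?thesis using that st t r(2) by (simp add: dist_norm norm_minus_commute)
    qed
    show thesis
    proof (rule that[of "t / C" "z - t *\<^sub>R e"])
      show "t / C > 0" using t r by simp
      show "cball (z - t *\<^sub>R e) (t / C) \<subseteq> ball z (\<rho> / 2)"
      proof
        fix y assume "y \<in> cball (z - t *\<^sub>R e) (t / C)"
        from in2[OF this] t(3) show "y \<in> ball z (\<rho> / 2)" by (simp add: dist_norm norm_minus_commute)
      qed
      have "y \<notin> \<Omega>" if y: "y \<in> cball (z - t *\<^sub>R e) (t / C)" for y
      proof -
        define w where "w = ((z - t *\<^sub>R e) - y) /\<^sub>R t"
        have yw: "y = z - t *\<^sub>R (e + w)" using t by (simp add: w_def algebra_simps)
        have "norm w = norm ((z - t *\<^sub>R e) - y) / t"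
          unfolding w_def by (rule norm_scaleR_inverse[OF t(1)])
        also have "\<dots> \<le> (t / C) / t" 
          using y t(1) by (intro divide_right_mono) (simp_all add: dist_norm)
        also have "\<dots> = 1 / C" using t by simp
        finally have "C * norm w \<le> 1" using r(3) by (simp add: field_simps)
        moreover have "y \<in> ball z r" using in2[OF y] t by (simp add: dist_norm norm_minus_commute)
        ultimately show ?thesis unfolding yw using r(1) zn(1) t(1) by (intro cone) auto
      qed
      then show "cball (z - t *\<^sub>R e) (t / C) \<inter> \<Omega> = {}" by blast
    qed
  qed
  \<comment> \<open>At this scale the mollified indicator sees, from the smaller ball around z, only
    the region with zero gradient. It is therefore constant there, yet equals 1 at x1 and 0 at
    x2.\<close>
  define s where "s = min (min s1 s2) (\<rho> / 2)"
  have s: "s > 0" "s \<le> s1" "s \<le> s2" "s \<le> \<rho> / 2" using s1 s2 \<rho> by (auto simp: s_def)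
  have iv: "integrable lebesgue (\<lambda>x. \<theta> (u x))" using wg2 by (simp add: global_weak_gradient_def)
  let ?w = "conv (mollifier s) (\<lambda>x. \<theta> (u x))"
  have sm: "smooth ?w" by (rule conv_mollifier_smooth[OF s(1) iv])
  have "(?w has_derivative (\<lambda>h. 0)) (at x)" if x: "x \<in> ball z (\<rho> / 2)" for x
  proof -
    have "frechet_derivative ?w (at x) b = 0" if "b \<in> Basis" for b
      unfolding conv_global_weak_gradient[OF wg2 mollifier_Cc_infinity[OF s(1)] that]
    proof (rule conv_mollifier_support[OF s(1)])
      fix y assume "norm (x - y) \<le> s"
      then have "y \<in> ball z \<rho>"
        using x s(4) norm_triangle_ineq4[of "x - z" "x - y"] by (simp add: dist_norm norm_minus_commute)
      then show "\<theta>' (u y) *\<^sub>R g y \<bullet> b = 0" using v(2) by simp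
    qed
    then have "frechet_derivative ?w (at x) h = 0" for h
      by (subst linear_eq_sum_Basis[OF has_derivative_linear[OF smooth_has_derivative[OF sm]]]) simp
    then show ?thesis
      by (rule has_derivative_eq_rhs[OF smooth_has_derivative[OF sm] ext])
  qed
  then obtain K where K: "\<And>x. x \<in> ball z (\<rho> / 2) \<Longrightarrow> ?w x = K"
    using has_derivative_zero_constant[of "ball z (\<rho> / 2)" ?w] by (metis convex_ball has_derivative_at_withinI)
  have sub: "ball z (\<rho> / 2) \<subseteq> ball z \<rho>" using \<rho> by (intro subset_ball) simp
  have "\<bar>?w x1 - 1\<bar> \<le> 0"
  proof (rule conv_mollifier_close[OF s(1) iv])
    fix y assume "norm (x1 - y) \<le> s"
    then have "y \<in> cball x1 s1" using s(2) by (simp add: dist_norm)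
    then have "y \<in> \<Omega>" "y \<in> ball z \<rho>" using s1(2) sub by blast+
    then show "\<bar>\<theta> (u y) - 1\<bar> \<le> 0" using v(1) by simp
  qed
  moreover have "?w x2 = 0"
  proof (rule conv_mollifier_support[OF s(1)])
    fix y assume "norm (x2 - y) \<le> s"
    then have "y \<in> cball x2 s2" using s(3) by (simp add: dist_norm)
    then have "y \<notin> \<Omega>" "y \<in> ball z \<rho>" using s2(2,3) sub by blast+
    then show "\<theta> (u y) = 0" using v(1) by simp
  qed
  moreover have "x1 \<in> cball x1 s1" "x2 \<in> cball x2 s2" using s1(1) s2(1) by auto
  then have "x1 \<in> ball z (\<rho> / 2)" "x2 \<in> ball z (\<rho> / 2)" using s1(2) s2(2) by blast+
  then have "?w x1 = ?w x2" using K by simp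
  ultimately show False by simp
qed

text \<open>For x inside and y outside, the segment meets the frontier in a point p with |x - p|
  \<le> |x - y|, and u tends to 0 along points of \<Omega> converging to p. The constant A is
  preserved.\<close>

lemma holder_zero_extension:
  fixes u :: "'a::euclidean_space \<Rightarrow> real"
  assumes \<Omega>: "lipschitz_domain \<Omega>" and wg: "global_weak_gradient u g"
      and out: "\<And>x. x \<notin> \<Omega> \<Longrightarrow> u x = 0"
    and hol: "\<And>x y. x \<in> \<Omega> \<Longrightarrow> y \<in> \<Omega> \<Longrightarrow>
        \<bar>u x - u y\<bar> \<le> A * norm (x - y) powr \<gamma>" and A: "A \<ge> 0" and \<gamma>: "\<gamma> > 0"
  shows "\<bar>u x - u y\<bar> \<le> A * norm (x - y) powr \<gamma>"
proof -
  have op: "open \<Omega>" using \<Omega> by (auto simp: lipschitz_domain_def)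
  have key: "\<bar>u x\<bar> \<le> A * norm (x - y) powr \<gamma>" if x: "x \<in> \<Omega>"
      and y: "y \<notin> \<Omega>" for x y
  proof -
    have "closed_segment x y \<inter> frontier \<Omega> \<noteq> {}"
      using x y by (intro connected_Int_frontier) auto
    then obtain p where p: "p \<in> closed_segment x y" "p \<in> frontier \<Omega>" by blast
    have "p \<notin> \<Omega>" "p \<in> closure \<Omega>" using p(2) op by (auto simp: frontier_def interior_open)
    then obtain X where X: "\<And>n. X n \<in> \<Omega>" "X \<longlonglongrightarrow> p"
        by (auto simp: closure_sequential)
    have "(\<lambda>n. u (X n)) \<longlonglongrightarrow> 0"
    proof (rule LIMSEQ_I)
      fix e :: real assume e: "e > 0"
      then obtain \<rho> where \<rho>: "\<rho> > 0" "\<forall>x\<in>\<Omega> \<inter> ball p \<rho>. \<bar>u x\<bar> \<le> e / 2"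
        using holder_boundary_value[OF \<Omega> wg out hol A \<gamma> p(2), of "e / 2"] by auto
      obtain N where "\<And>n. n \<ge> N \<Longrightarrow> dist (X n) p < \<rho>"
        using X(2) \<rho>(1) unfolding lim_sequentially by blast
      then have "\<bar>u (X n)\<bar> \<le> e / 2" if "n \<ge> N" for n
        using that X(1) \<rho>(2) by (simp add: dist_commute)
      then show "\<exists>no. \<forall>n\<ge>no. norm (u (X n) - 0) < e" using e by (intro exI[of _ N]) fastforce
    qed
    then have l1: "(\<lambda>n. \<bar>u x - u (X n)\<bar>) \<longlonglongrightarrow> \<bar>u x - 0\<bar>"
      by (intro tendsto_intros)
    have "norm (x - p) \<noteq> 0" using x \<open>p \<notin> \<Omega>\<close> by auto
    then have l2: "(\<lambda>n. A * norm (x - X n) powr \<gamma>)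
        \<longlonglongrightarrow> A * norm (x - p) powr \<gamma>"
      by (intro tendsto_intros X(2)) auto
    have "\<bar>u x - 0\<bar> \<le> A * norm (x - p) powr \<gamma>"
      by (rule LIMSEQ_le[OF l1 l2]) (use hol[OF x X(1)] in auto)
    also have "\<dots> \<le> A * norm (x - y) powr \<gamma>"
      using segment_bound(1)[OF p(1)] \<gamma> A
      by (intro mult_left_mono powr_mono2) (auto simp: norm_minus_commute)
    finally show ?thesis by simp
  qed
  show ?thesis
  proof (cases "x \<in> \<Omega>"; cases "y \<in> \<Omega>")
    assume "x \<in> \<Omega>" "y \<in> \<Omega>" then show ?thesis by (rule hol)
  next
    assume "x \<in> \<Omega>" "y \<notin> \<Omega>" then show ?thesis using key[of x y] out[of y] by simp
  next
    assume "x \<notin> \<Omega>" "y \<in> \<Omega>" then show ?thesis using key[of y x] out[of x]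
        by (simp add: norm_minus_commute)
  next
    assume "x \<notin> \<Omega>" "y \<notin> \<Omega>" then show ?thesis using out A by simp
  qed
qed

subsection \<open>Jensen's inequality for the double phase integrand\<close>

text \<open>Convexity is used on the open half-line, so t = 0 and m = 0 are separate. For m = 0 the
  left side is 0, also when e = 1, by the convention that \<open>0 powr 0 = 0\<close>.\<close>

lemma powr_above_tangent:
  fixes t m e :: real
  assumes t: "t \<ge> 0" and m: "m \<ge> 0" and e: "e \<ge> 1"
  shows "m powr e + e * m powr (e - 1) * (t - m) \<le> t powr e"
proof -
  consider "m = 0" | "m > 0" "t = 0" | "m > 0" "t > 0" using t m by linarith
  then show ?thesis
  proof cases
    case 2
    have "m powr (e - 1) * m = m powr e"
      using powr_add[of m "e - 1" 1] 2 by simp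
    moreover have "m powr e \<le> e * m powr e" using e by (simp add: mult_le_cancel_right1)
    ultimately show ?thesis using 2 by (simp add: mult.assoc)
  next
    case 3
    have "e * m powr (e - 1) * (t - m) \<le> t powr e - m powr e"
    proof (rule convex_on_imp_above_tangent[where A = "{0<..}"])
      show "convex_on {0<..} (\<lambda>x. x powr e)" by (rule powr_convex[OF e])
      show "((\<lambda>x. x powr e) has_real_derivative e * m powr (e - 1)) (at m within {0<..})"
        using 3 by (auto intro!: derivative_eq_intros)
    qed (use 3 in \<open>auto simp: interior_open\<close>)
    then show ?thesis by simp
  qed simp
qed

text \<open>The tangent of t^p + \<alpha> t^q at the mean m is integrated against the probability
  density k. The majorant F, rather than the exact integrand, allows the constant \<alpha> to be
  below the true weight.\<close>

lemma double_phase_jensen: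
  fixes k t F :: "'a \<Rightarrow> real"
  assumes k: "integrable M k" "(LINT z|M. k z) = 1" "\<And>z. k z \<ge> 0"
    and kt: "integrable M (\<lambda>z. k z * t z)" and t: "\<And>z. t z \<ge> 0"
    and F: "integrable M F" "\<And>z. k z * (t z powr p + \<alpha> * t z powr q) \<le> F z"
    and pq: "p \<ge> 1" "q \<ge> 1" and \<alpha>: "\<alpha> \<ge> 0" and m: "m = (LINT z|M. k z * t z)"
  shows "m powr p + \<alpha> * m powr q \<le> (LINT z|M. F z)"
proof -
  have m0: "m \<ge> 0" unfolding m using k t by (intro integral_nonneg_AE) simp
  define c where "c = m powr p + \<alpha> * m powr q"
  define D where "D = p * m powr (p - 1) + \<alpha> * (q * m powr (q - 1))"
  have tangent: "c + D * (t z - m) \<le> t z powr p + \<alpha> * t z powr q" for z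
  proof -
    have "m powr p + p * m powr (p - 1) * (t z - m) \<le> t z powr p"
      by (rule powr_above_tangent[OF t m0 pq(1)])
    moreover have "\<alpha> * (m powr q + q * m powr (q - 1) * (t z - m)) \<le> \<alpha> * t z powr q"
      by (intro mult_left_mono powr_above_tangent t m0 pq \<alpha>)
    ultimately show ?thesis by (simp add: c_def D_def algebra_simps)
  qed
  have "c = (LINT z|M. (c - D * m) * k z + D * (k z * t z))"
    using k kt by (simp add: m[symmetric])
  also have "\<dots> \<le> (LINT z|M. F z)"
  proof (rule integral_mono)
    fix z
    have "(c - D * m) * k z + D * (k z * t z) = k z * (c + D * (t z - m))"
      by (simp add: algebra_simps)
    also have "\<dots> \<le> k z * (t z powr p + \<alpha> * t z powr q)"
      by (intro mult_left_mono tangent k)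
    also have "\<dots> \<le> F z" by (rule F)
    finally show "(c - D * m) * k z + D * (k z * t z) \<le> F z" .
  qed (use k kt F in auto)
  finally show ?thesis by (simp add: c_def)
qed

subsection \<open>Convolution of a Sobolev function with a mollifier\<close>

text \<open>Pairing the mollified gradient v with itself gives |v|^2 as an average of g \<bullet> v,
  which Cauchy-Schwarz bounds by |v| times the average of |g|.\<close>

lemma conv_gradient_le:
  fixes u :: "'a::euclidean_space \<Rightarrow> real"
  assumes wg: "global_weak_gradient u g" and s: "s > 0"
  shows "norm (gradient (conv (mollifier s) u) y) \<le> conv (mollifier s) (\<lambda>z. norm (g z)) y"
proof -
  let ?v = "gradient (conv (mollifier s) u) y"
  have k: "mollifier s \<in> Cc_infinity (UNIV :: 'a set)" by (rule mollifier_Cc_infinity[OF s])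
  have g: "integrable lebesgue g" using wg by (simp add: global_weak_gradient_def)
  have ng: "integrable lebesgue (\<lambda>z. norm (g z))" using g by simp
  have ib: "integrable lebesgue (\<lambda>z. mollifier s (y - z) * (g z \<bullet> b))" for b
    by (rule conv_integrable[OF k]) (use g in simp)
  have comp: "?v \<bullet> b = conv (mollifier s) (\<lambda>z. g z \<bullet> b) y" if "b \<in> Basis" for b
    using that by (simp add: gradient_inner conv_global_weak_gradient[OF wg k])
  have "norm ?v * norm ?v = ?v \<bullet> ?v" by (simp add: dot_square_norm power2_eq_square)
  also have "\<dots> = (\<Sum>b\<in>Basis. (?v \<bullet> b) * (?v \<bullet> b))" by (rule euclidean_inner)
  also have "\<dots> = (\<Sum>b\<in>Basis. (LINT z|lebesgue. (mollifier s (y - z) * (g z \<bullet> b)) * (?v \<bullet> b)))"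
    using ib by (intro sum.cong) (simp_all add: comp conv_def)
  also have "\<dots> = (LINT z|lebesgue. (\<Sum>b\<in>Basis. (mollifier s (y - z) * (g z \<bullet> b)) * (?v \<bullet> b)))"
    using ib by (intro Bochner_Integration.integral_sum[symmetric]) auto
  also have "\<dots> = (LINT z|lebesgue. mollifier s (y - z) * (g z \<bullet> ?v))"
    by (intro Bochner_Integration.integral_cong) (simp_all add: euclidean_inner[of _ ?v] sum_distrib_left mult.assoc)
  also have "\<dots> \<le> (LINT z|lebesgue. mollifier s (y - z) * norm (g z) * norm ?v)"
  proof (rule integral_mono)
    show "integrable lebesgue (\<lambda>z. mollifier s (y - z) * (g z \<bullet> ?v))" by (rule ib)
    show "integrable lebesgue (\<lambda>z. mollifier s (y - z) * norm (g z) * norm ?v)"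
      using conv_integrable[OF k ng, of y] by simp
    show "mollifier s (y - z) * (g z \<bullet> ?v) \<le> mollifier s (y - z) * norm (g z) * norm ?v" for z
      unfolding mult.assoc by (intro mult_left_mono norm_cauchy_schwarz mollifier_nonneg s)
  qed
  also have "\<dots> = conv (mollifier s) (\<lambda>z. norm (g z)) y * norm ?v"
    by (simp add: conv_def)
  finally have le: "norm ?v * norm ?v \<le> conv (mollifier s) (\<lambda>z. norm (g z)) y * norm ?v" .
  have nn: "conv (mollifier s) (\<lambda>z. norm (g z)) y \<ge> 0"
    unfolding conv_def by (intro integral_nonneg_AE AE_I2 mult_nonneg_nonneg mollifier_nonneg s norm_ge_zero)
  show ?thesis
    using le nn by (cases "?v = 0") (auto simp: mult_le_cancel_right)
qed

text \<open>A partial derivative of the kernel has integral zero, so u(y) may be subtracted from u.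
  The powers of s are s^(-n-1) from the kernel, s^\<gamma> from u and s^n from the ball. For
  \<gamma> = 0 the hypothesis says that the oscillation of u is at most A, because
  \<open>powr 0\<close> is 1 off the diagonal.\<close>

lemma conv_gradient_holder:
  obtains C :: real where "C \<ge> 0"
    "\<And>s (u :: 'a::euclidean_space \<Rightarrow> real) A \<gamma> y. s > 0 \<Longrightarrow>
        integrable lebesgue u \<Longrightarrow> A \<ge> 0 \<Longrightarrow> \<gamma> \<ge> 0 \<Longrightarrow>
      (\<And>x y. \<bar>u x - u y\<bar> \<le> A * norm (x - y) powr \<gamma>) \<Longrightarrow>
      norm (gradient (conv (mollifier s) u) y) \<le> C * A * s powr (\<gamma> - 1)"
proof -
  obtain C0 :: real where C0: "C0 > 0"
    "\<And>s b (x::'a). s > 0 \<Longrightarrow> b \<in> Basis \<Longrightarrow>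
        \<bar>frechet_derivative (mollifier s) (at x) b\<bar> \<le> C0 / s ^ (DIM('a) + 1)"
    by (rule mollifier_bounds[where 'a = 'a]) (rule that, assumption+)
  let ?n = "DIM('a)"
  define C where "C = ?n * (C0 * unit_ball_vol ?n)"
  have C: "C \<ge> 0" using C0 by (simp add: C_def unit_ball_vol_def)
  show thesis
  proof (rule that[OF C])
    fix s :: real and u :: "'a \<Rightarrow> real" and A \<gamma> :: real and y :: 'a
    assume s: "s > 0" and u: "integrable lebesgue u" and A: "A \<ge> 0" and \<gamma>: "\<gamma> \<ge> 0"
      and hol: "\<And>x y. \<bar>u x - u y\<bar> \<le> A * norm (x - y) powr \<gamma>"
    have k: "mollifier s \<in> Cc_infinity (UNIV :: 'a set)" by (rule mollifier_Cc_infinity[OF s])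
    have comp: "\<bar>gradient (conv (mollifier s) u) y \<bullet> b\<bar>
        \<le> C0 * unit_ball_vol ?n * A * s powr (\<gamma> - 1)"
      if b: "b \<in> Basis" for b
    proof -
      let ?D = "\<lambda>x::'a. frechet_derivative (mollifier s) (at x) b"
      have kD: "?D \<in> Cc_infinity UNIV" by (rule Cc_infinity_frechet_derivative[OF k b])
      have iD: "integrable lebesgue (\<lambda>z. ?D (y - z))"
        by (rule Cc_infinity_integrable[OF Cc_infinity_reflect[OF kD]])
      have zero: "(LINT z|lebesgue. ?D (y - z)) = 0"
        using integral_affine_unit[OF smooth_continuous[OF Cc_infinity_smooth[OF kD]], of "-1" y]
          integral_frechet_derivative_eq_0[OF k b] by simp
      have "gradient (conv (mollifier s) u) y \<bullet> b = conv ?D u y"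
        by (simp add: gradient_inner b frechet_derivative_conv[OF k u b])
      also have "\<dots> = (LINT z|lebesgue. ?D (y - z) * u z - ?D (y - z) * u y)"
        unfolding conv_def using iD conv_integrable[OF kD u, of y] zero by simp
      finally have "\<bar>gradient (conv (mollifier s) u) y \<bullet> b\<bar>
          = norm (LINT z|lebesgue. ?D (y - z) * u z - ?D (y - z) * u y)"
        by simp
      also have "\<dots> \<le> (LINT z|lebesgue. C0 / s ^ (?n + 1) * (A * s powr \<gamma>) * indicator (cball y s) z)"
      proof (rule Bochner_Integration.integral_norm_bound_integral)
        show "integrable lebesgue (\<lambda>z. ?D (y - z) * u z - ?D (y - z) * u y)"
          using iD conv_integrable[OF kD u, of y] by simp
        show "integrable lebesgue (\<lambda>z. C0 / s ^ (?n + 1) * (A * s powr \<gamma>) * indicator (cball y s) z)"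
          using emeasure_cball_finite[of y s] by simp
        fix z
        have eq: "norm (?D (y - z) * u z - ?D (y - z) * u y) = \<bar>?D (y - z)\<bar> * \<bar>u z - u y\<bar>"
          by (simp add: abs_mult flip: right_diff_distrib)
        show "norm (?D (y - z) * u z - ?D (y - z) * u y)
            \<le> C0 / s ^ (?n + 1) * (A * s powr \<gamma>) * indicator (cball y s) z"
        proof (cases "z \<in> cball y s")
          case True
          then have "norm (z - y) powr \<gamma> \<le> s powr \<gamma>"
            using \<gamma> by (intro powr_mono2) (auto simp: dist_norm norm_minus_commute)
          then have "\<bar>u z - u y\<bar> \<le> A * s powr \<gamma>"
            using hol[of z y] mult_left_mono[OF _ A] by (meson order_trans)
          then have "\<bar>?D (y - z)\<bar> * \<bar>u z - u y\<bar> \<le> C0 / s ^ (?n + 1) * (A * s powr \<gamma>)"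
            using C0 s A by (intro mult_mono C0(2) b) auto
          then show ?thesis using True eq by simp
        next
          case False
          have "?D (y - z) = 0"
          proof (rule frechet_derivative_outside_support[where K = "cball 0 s"])
            show "y - z \<notin> cball 0 s" using False by (simp add: dist_norm norm_minus_commute)
            show "mollifier s x = 0" if "x \<notin> cball 0 s" for x :: 'a
              using that by (intro mollifier_eq_0[OF s]) simp
          qed simp
          then show ?thesis using False by simp
        qed
      qed
      also have "\<dots> = C0 / s ^ (?n + 1) * (A * s powr \<gamma>) * measure lebesgue (cball y s)" by simp
      also have "measure lebesgue (cball y s) = unit_ball_vol ?n * s ^ ?n"
        using s by (intro content_cball_DIM) simp
      also have "C0 / s ^ (?n + 1) * (A * s powr \<gamma>) * (unit_ball_vol ?n * s ^ ?n)
          = C0 * unit_ball_vol ?n * A * (s powr \<gamma> / s)"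
        using s by (simp add: field_simps)
      also have "s powr \<gamma> / s = s powr (\<gamma> - 1)" using s by (simp add: powr_diff)
      finally show ?thesis .
    qed
    have "norm (gradient (conv (mollifier s) u) y)
        \<le> (\<Sum>b\<in>Basis. \<bar>gradient (conv (mollifier s) u) y \<bullet> b\<bar>)"
      by (rule norm_le_l1)
    also have "\<dots> \<le> (\<Sum>b\<in>(Basis::'a set). C0 * unit_ball_vol ?n * A * s powr (\<gamma> - 1))"
      by (intro sum_mono comp)
    also have "\<dots> = C * A * s powr (\<gamma> - 1)" by (simp add: C_def)
    finally show "norm (gradient (conv (mollifier s) u) y) \<le> C * A * s powr (\<gamma> - 1)" .
  qed
qed

text \<open>The lower bound \<open>\<alpha>\<close> of the weight on the ball of integration allows
  Jensen's inequality; the error \<open>(c s)\<^sup>\<kappa>\<close> it leaves is compensated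
      by the gradient bound \<open>w \<le> B s\<^sup>\<gamma>\<^sup>-\<^sup>1\<close>.\<close>

lemma double_phase_pointwise:
  fixes a :: "'a::euclidean_space \<Rightarrow> real" and g :: "'a \<Rightarrow> 'a"
  assumes p: "1 \<le> p" "p < q" and C: "C > 0"
    and a: "\<And>x. x \<in> \<Omega> \<Longrightarrow> 0 \<le> a x" "\<And>x y. x \<in> \<Omega> \<Longrightarrow>
        y \<in> \<Omega> \<Longrightarrow> a x \<le> C * (a y + norm (x - y) powr \<kappa>)"
    and \<kappa>: "\<kappa> > 0" "\<kappa> \<ge> (q - p) * (1 - \<gamma>)"
    and g: "integrable lebesgue g" "\<And>x. x \<notin> \<Omega> \<Longrightarrow> g x = 0"
    and M: "integrable lebesgue (\<lambda>z. indicator \<Omega> z * (norm (g z) powr p + a z * norm (g z) powr q))"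
    and s: "0 < s" "s \<le> 1" and c: "c > 0" "\<And>z. norm (y - z) \<le> s \<Longrightarrow> norm (x - z) \<le> c * s"
    and x: "x \<in> \<Omega>" and w: "0 \<le> w" "w \<le> conv (mollifier s) (\<lambda>z. norm (g z)) y" "w
        \<le> B * s powr (\<gamma> - 1)" and B: "B \<ge> 0"
  shows "w powr p + a x * w powr q \<le> (1 + C + C * c powr \<kappa> * B powr (q - p)) *
    conv (mollifier s) (\<lambda>z. indicator \<Omega> z * (norm (g z) powr p + a z * norm (g z) powr q)) y"
proof -
  let ?k = "\<lambda>z. mollifier s (y - z)"
  let ?M = "\<lambda>z. indicator \<Omega> z * (norm (g z) powr p + a z * norm (g z) powr q)"
  \<comment> \<open>The class inequality at x and z, solved for a z and estimated over the ball; the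
    maximum with 0 keeps the coefficient in Jensen's inequality nonnegative. The radius is c s
    rather than s because the ball is centred at y and not at x.\<close>
  define \<alpha> where "\<alpha> = max 0 (a x / C - (c * s) powr \<kappa>)"
  define m where "m = conv (mollifier s) (\<lambda>z. norm (g z)) y"
  have \<alpha>: "\<alpha> \<ge> 0" by (simp add: \<alpha>_def)
  have k: "mollifier s \<in> Cc_infinity (UNIV :: 'a set)" by (rule mollifier_Cc_infinity[OF s(1)])
  have \<alpha>le: "\<alpha> \<le> a z" if z: "z \<in> \<Omega>" "norm (y - z) \<le> s" for z
  proof -
    have "norm (x - z) powr \<kappa> \<le> (c * s) powr \<kappa>" using c(2)[OF z(2)] \<kappa>(1)
        by (intro powr_mono2) auto
    then have "C * (a z + norm (x - z) powr \<kappa>) \<le> C * (a z + (c * s) powr \<kappa>)" using C by simp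
    then have "a x \<le> C * (a z + (c * s) powr \<kappa>)" using a(2)[OF x z(1)] by linarith
    then have "a x / C \<le> a z + (c * s) powr \<kappa>" using C by (simp add: pos_divide_le_eq mult.commute)
    then show ?thesis using a(1)[OF z(1)] by (simp add: \<alpha>_def)
  qed
  have ax: "a x \<le> C * (\<alpha> + (c * s) powr \<kappa>)"
  proof -
    have "a x / C \<le> \<alpha> + (c * s) powr \<kappa>" by (simp add: \<alpha>_def)
    then show ?thesis using C by (simp add: pos_divide_le_eq mult.commute)
  qed
  have J: "m powr p + \<alpha> * m powr q \<le> conv (mollifier s) ?M y"
    unfolding conv_def
  proof (rule double_phase_jensen[where k = ?k and t = "\<lambda>z. norm (g z)"])
    show "integrable lebesgue ?k" by (rule Cc_infinity_integrable[OF Cc_infinity_reflect[OF k]])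
    show "(LINT z|lebesgue. ?k z) = 1" by (rule integral_mollifier_shift[OF s(1)])
    show "?k z \<ge> 0" for z by (rule mollifier_nonneg[OF s(1)])
    show "integrable lebesgue (\<lambda>z. ?k z * norm (g z))" using g(1) by (intro conv_integrable[OF k]) simp
    show "integrable lebesgue (\<lambda>z. ?k z * ?M z)" by (rule conv_integrable[OF k M])
    \<comment> \<open>The lower bound on the weight is needed only where it applies: off \<Omega>
      the gradient vanishes, off the ball the kernel does.\<close>
    show "?k z * (norm (g z) powr p + \<alpha> * norm (g z) powr q) \<le> ?k z * ?M z" for z
    proof (cases "z \<in> \<Omega> \<and> norm (y - z) \<le> s")
      case True
      then have "\<alpha> * norm (g z) powr q \<le> a z * norm (g z) powr q"
        using \<alpha>le by (intro mult_right_mono) auto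
      then show ?thesis using True mollifier_nonneg[OF s(1), of "y - z"] by (auto intro!: mult_left_mono)
    next
      case False
      then show ?thesis
        using g(2)[of z] mollifier_eq_0[OF s(1), of "y - z"] by (cases "z \<in> \<Omega>") auto
    qed
    show "m = (LINT z|lebesgue. ?k z * norm (g z))" by (simp add: m_def conv_def)
  qed (use p \<alpha> in auto)
  \<comment> \<open>Only the surplus power w^(q-p) is traded for the gradient bound. What remains is
    s to the exponent \<kappa> - (q - p)(1 - \<gamma>), which is nonnegative, and s \<le> 1.\<close>
  have s\<kappa>: "(c * s) powr \<kappa> * w powr q \<le> c powr \<kappa> * B powr (q - p) * w powr p"
  proof -
    have "w powr q = w powr p * w powr (q - p)" by (simp flip: powr_add)
    also have "\<dots> \<le> w powr p * (B * s powr (\<gamma> - 1)) powr (q - p)"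
      using w p by (intro mult_left_mono powr_mono2) auto
    also have "(B * s powr (\<gamma> - 1)) powr (q - p) = B powr (q - p) * s powr ((\<gamma> - 1) * (q - p))"
      using B by (simp add: powr_mult powr_powr)
    finally have "(c * s) powr \<kappa> * w powr q \<le>
        (c powr \<kappa> * s powr \<kappa>) * (w powr p * (B powr (q - p) * s powr ((\<gamma> - 1) * (q - p))))"
      using c s by (simp add: powr_mult mult_left_mono)
    also have "\<dots> = c powr \<kappa> * B powr (q - p) * w powr p * (s powr \<kappa> * s powr ((\<gamma> - 1) * (q - p)))"
      by (simp add: algebra_simps)
    also have "s powr \<kappa> * s powr ((\<gamma> - 1) * (q - p)) = s powr (\<kappa> - (q - p) * (1 - \<gamma>))"
      by (simp add: algebra_simps flip: powr_add)
    also have "\<dots> \<le> 1 powr (\<kappa> - (q - p) * (1 - \<gamma>))"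
      using s \<kappa> by (intro powr_mono2) auto
    also have "c powr \<kappa> * B powr (q - p) * w powr p * 1 powr (\<kappa> - (q - p) * (1 - \<gamma>))
        = c powr \<kappa> * B powr (q - p) * w powr p"
      by simp
    finally show ?thesis by (simp add: mult_left_mono)
  qed
  have "a x * w powr q \<le> C * (\<alpha> + (c * s) powr \<kappa>) * w powr q"
    by (rule mult_right_mono[OF ax]) simp
  also have "\<dots> = C * (\<alpha> * w powr q) + C * ((c * s) powr \<kappa> * w powr q)" by (simp add: algebra_simps)
  also have "\<dots> \<le> C * (\<alpha> * w powr q) + C * (c powr \<kappa> * B powr (q - p) * w powr p)"
    using s\<kappa> C by simp
  finally have "w powr p + a x * w powr q \<le>
      (1 + C * c powr \<kappa> * B powr (q - p)) * w powr p + C * (\<alpha> * w powr q)" by (simp add: algebra_simps)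
  also have "\<dots> \<le> (1 + C + C * c powr \<kappa> * B powr (q - p)) * w powr p + (1 + C + C * c powr \<kappa> * B powr (q - p)) * (\<alpha> * w powr q)"
    using C \<alpha> by (intro add_mono mult_right_mono) auto
  also have "\<dots> = (1 + C + C * c powr \<kappa> * B powr (q - p)) * (w powr p + \<alpha> * w powr q)"
    by (simp add: distrib_left)
  also have "w powr p + \<alpha> * w powr q \<le> m powr p + \<alpha> * m powr q"
    using w p \<alpha> unfolding m_def by (intro add_mono mult_left_mono powr_mono2) auto
  also note J
  finally show ?thesis using C by (simp add: mult_left_mono)
qed

subsection \<open>The recovery sequence\<close>

text \<open>A point closer than s to the complement is sent to a point whose s-ball misses \<Omega>,
  so the mollification vanishes there. The points at distance at least s from the complement form a
  compact subset of \<Omega>.\<close>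

lemma conv_pushed_Cc_infinity:
  fixes \<Omega> :: "'a::euclidean_space set" and T :: "'a \<Rightarrow> 'a"
  assumes bd: "bounded \<Omega>" and u: "integrable lebesgue u" "\<And>x. x \<notin> \<Omega> \<Longrightarrow>
      u x = 0" and s: "s > 0"
    and T: "\<And>c. c \<in> Basis \<Longrightarrow> smooth (\<lambda>x. T x \<bullet> c)"
    and push: "\<And>x f y. f \<notin> \<Omega> \<Longrightarrow> norm (x - f) \<le> s \<Longrightarrow>
        norm (y - T x) \<le> s \<Longrightarrow> y \<notin> \<Omega>"
  shows "(\<lambda>x. conv (mollifier s) u (T x)) \<in> Cc_infinity \<Omega>"
proof -
  have ne: "- \<Omega> \<noteq> {}" using bd not_bounded_UNIV by (metis Compl_empty_eq double_complement)
  define K where "K = {x. s \<le> infdist x (- \<Omega>)}"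
  have sub: "K \<subseteq> \<Omega>"
  proof
    fix x assume "x \<in> K"
    then have "infdist x (- \<Omega>) \<noteq> 0" using s by (auto simp: K_def)
    then show "x \<in> \<Omega>" by (metis ComplI infdist_zero)
  qed
  have "closed K"
    unfolding K_def by (intro closed_Collect_le continuous_intros)
  then have K: "compact K"
    using bounded_subset[OF bd sub] by (simp add: compact_eq_bounded_closed)
  have "conv (mollifier s) u (T x) = 0" if "x \<notin> K" for x
  proof -
    have "infdist x (- \<Omega>) < s" using that by (simp add: K_def)
    then obtain f where f: "f \<in> - \<Omega>" "dist x f < s"
      using infdist_notempty[OF ne, of x] cINF_less_iff[OF ne, of "dist x" s] by (auto intro: bdd_belowI2[of _ 0])
    show ?thesis
    proof (rule conv_mollifier_support[OF s])
      fix z assume "norm (T x - z) \<le> s"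
      then have "z \<notin> \<Omega>"
        using f by (intro push[of f x z]) (auto simp: dist_norm norm_minus_commute)
      then show "u z = 0" by (rule u)
    qed
  qed
  moreover have "smooth (\<lambda>x. conv (mollifier s) u (T x))"
    by (rule smooth_compose[OF conv_mollifier_smooth[OF s u(1)] T])
  ultimately show ?thesis
    using K sub unfolding Cc_infinity_iff by blast
qed

text \<open>The derivative of the push is the identity plus \<delta> times that of h; summing over
  components twice gives the crude factor n^2 L.\<close>

lemma gradient_compose_perturbation:
  fixes h :: "'a::euclidean_space \<Rightarrow> 'a"
  assumes f: "smooth f" and h: "\<And>c. c \<in> Basis \<Longrightarrow> smooth (\<lambda>x. h x \<bullet> c)"
    and L: "\<And>x b c. b \<in> Basis \<Longrightarrow> c \<in> Basis \<Longrightarrow>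
        \<bar>frechet_derivative (\<lambda>x. h x \<bullet> c) (at x) b\<bar> \<le> L"
    and \<delta>: "\<delta> \<ge> 0"
  shows "norm (gradient (\<lambda>x. f (x + \<delta> *\<^sub>R h x)) x - gradient f (x + \<delta> *\<^sub>R h x))
     \<le> \<delta> * (real DIM('a) * real DIM('a) * L) * norm (gradient f (x + \<delta> *\<^sub>R h x))"
proof -
  let ?T = "\<lambda>x. x + \<delta> *\<^sub>R h x" and ?v = "gradient f (x + \<delta> *\<^sub>R h x)"
  define h' where "h' k
      = (\<Sum>c\<in>Basis. frechet_derivative (\<lambda>x. h x \<bullet> c) (at x) k *\<^sub>R c)" for k
  have "(h has_derivative h') (at x)"
  proof (subst has_derivative_componentwise_within, intro ballI)
    fix c :: 'a assume "c \<in> Basis"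
    then show "((\<lambda>x. h x \<bullet> c) has_derivative (\<lambda>k. h' k \<bullet> c)) (at x)"
      using smooth_has_derivative[OF h] unfolding h'_def by simp
  qed
  then have "(?T has_derivative (\<lambda>k. k + \<delta> *\<^sub>R h' k)) (at x)"
    by (intro derivative_intros)
  from has_derivative_compose[OF this smooth_has_derivative[OF f]]
  have D: "frechet_derivative (\<lambda>x. f (?T x)) (at x)
      = (\<lambda>k. frechet_derivative f (at (?T x)) (k + \<delta> *\<^sub>R h' k))"
    by (rule frechet_derivative_at[symmetric])
  have inn: "frechet_derivative f (at y) k = gradient f y \<bullet> k" for y k
    by (subst linear_eq_sum_Basis[OF has_derivative_linear[OF smooth_has_derivative[OF f]]])
      (simp add: gradient_def inner_sum_left inner_sum_right inner_commute mult.commute)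
  have nh: "norm (h' b) \<le> DIM('a) * L" if "b \<in> Basis" for b
  proof -
    have "norm (h' b) \<le> (\<Sum>c\<in>(Basis::'a set). norm (frechet_derivative (\<lambda>x. h x \<bullet> c) (at x) b *\<^sub>R c))"
      unfolding h'_def by (rule norm_sum)
    also have "\<dots> \<le> (\<Sum>c\<in>(Basis::'a set). L)"
      using L[OF that] by (intro sum_mono) simp
    finally show ?thesis by simp
  qed
  have "norm (gradient (\<lambda>x. f (?T x)) x - ?v)
      \<le> (\<Sum>b\<in>Basis. \<bar>(gradient (\<lambda>x. f (?T x)) x - ?v) \<bullet> b\<bar>)"
    by (rule norm_le_l1)
  also have "\<dots> \<le> (\<Sum>b\<in>(Basis::'a set). norm ?v * (\<delta> * (DIM('a) * L)))"
  proof (rule sum_mono)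
    fix b :: 'a assume b: "b \<in> Basis"
    have "(gradient (\<lambda>x. f (?T x)) x - ?v) \<bullet> b
        = ?v \<bullet> (b + \<delta> *\<^sub>R h' b) - ?v \<bullet> b"
      unfolding inner_diff_left gradient_inner[OF b, of "\<lambda>x. f (?T x)"] D inn ..
    also have "\<dots> = ?v \<bullet> (\<delta> *\<^sub>R h' b)" by (simp only: inner_add_right add_diff_cancel_left')
    finally have eq: "(gradient (\<lambda>x. f (?T x)) x - ?v) \<bullet> b = ?v \<bullet> (\<delta> *\<^sub>R h' b)" .
    have "\<bar>?v \<bullet> (\<delta> *\<^sub>R h' b)\<bar> \<le> norm ?v * norm (\<delta> *\<^sub>R h' b)"
        by (rule Cauchy_Schwarz_ineq2)
    also have "\<dots> \<le> norm ?v * (\<delta> * (DIM('a) * L))"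
      using nh[OF b] \<delta> by (intro mult_left_mono) (auto intro: mult_left_mono)
    finally show "\<bar>(gradient (\<lambda>x. f (?T x)) x - ?v) \<bullet> b\<bar>
        \<le> norm ?v * (\<delta> * (DIM('a) * L))"
      unfolding eq .
  qed
  also have "\<dots> = \<delta> * (real DIM('a) * real DIM('a) * L) * norm ?v" by simp
  finally show ?thesis .
qed

text \<open>Passing to the sum of the absolute values yields one subsequence for all members of a
  finite family.\<close>

lemma tendsto_L1_sum_AE_subseq:
  fixes F :: "'i \<Rightarrow> nat \<Rightarrow> 'a \<Rightarrow> real"
  assumes I: "finite I" and int: "\<And>i n. i \<in> I \<Longrightarrow> integrable M (F i n)"
    and lim: "\<And>i. i \<in> I \<Longrightarrow>
        (\<lambda>n. LINT x|M. \<bar>F i n x\<bar>) \<longlonglongrightarrow> 0"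
  obtains \<sigma> :: "nat \<Rightarrow> nat" where "strict_mono \<sigma>"
    "AE x in M. \<forall>i\<in>I. (\<lambda>n. F i (\<sigma> n) x) \<longlonglongrightarrow> 0"
proof -
  let ?Y = "\<lambda>n x. \<Sum>i\<in>I. \<bar>F i n x\<bar>"
  have Y: "integrable M (?Y n)" for n using int by auto
  have "(\<lambda>n. LINT x|M. norm (?Y n x)) \<longlonglongrightarrow> 0"
  proof -
    have "(LINT x|M. norm (?Y n x)) = (\<Sum>i\<in>I. LINT x|M. \<bar>F i n x\<bar>)" for n
      using int by (simp add: sum_nonneg)
    then show ?thesis using tendsto_sum[of I "\<lambda>i n. LINT x|M. \<bar>F i n x\<bar>" "\<lambda>_. 0"] lim by simp
  qed
  then obtain \<sigma> :: "nat \<Rightarrow> nat" where \<sigma>: "strict_mono \<sigma>" "AE x in M. (\<lambda>n. ?Y (\<sigma> n) x) \<longlonglongrightarrow> 0"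
    using tendsto_L1_AE_subseq[of M ?Y, OF Y] by blast
  from \<sigma>(2) have "AE x in M. \<forall>i\<in>I. (\<lambda>n. F i (\<sigma> n) x) \<longlonglongrightarrow> 0"
  proof eventually_elim
    case (elim x)
    show ?case
    proof
      fix i assume i: "i \<in> I"
      have "(\<lambda>n. \<bar>F i (\<sigma> n) x\<bar>) \<longlonglongrightarrow> 0"
        by (rule null_squeeze[OF _ _ elim]) (use i I in \<open>auto intro: member_le_sum\<close>)
      then show "(\<lambda>n. F i (\<sigma> n) x) \<longlonglongrightarrow> 0" by (simp add: tendsto_rabs_zero_iff)
    qed
  qed
  with \<sigma>(1) show ?thesis by (rule that)
qed

text \<open>The majorants D n are the mollified and pushed M. They are returned together with the
  test functions because they converge only in L^1 and are not dominated by a single known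
  function.\<close>

lemma recovery_sequence:
  fixes \<Omega> :: "'a::euclidean_space set" and u a M :: "'a \<Rightarrow> real" and g :: "'a \<Rightarrow> 'a"
  assumes \<Omega>: "lipschitz_domain \<Omega>" "bounded \<Omega>" and p: "1 < p" "p < q" and C: "C > 0"
    and a: "\<And>x. x \<in> \<Omega> \<Longrightarrow> 0 \<le> a x" "\<And>x y. x \<in> \<Omega> \<Longrightarrow>
        y \<in> \<Omega> \<Longrightarrow> a x \<le> C * (a y + norm (x - y) powr \<kappa>)"
    and \<kappa>: "\<kappa> > 0" "\<kappa> \<ge> (q - p) * (1 - \<gamma>)" and \<gamma>: "\<gamma> \<ge> 0"
    and wg: "global_weak_gradient u g" and out: "\<And>x. x \<notin> \<Omega> \<Longrightarrow> u x
        = 0" "\<And>x. x \<notin> \<Omega> \<Longrightarrow> g x = 0"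
    and hol: "\<And>x y. \<bar>u x - u y\<bar> \<le> A * norm (x - y) powr \<gamma>" and A: "A \<ge> 0"
    and M_def: "M = (\<lambda>z. indicator \<Omega> z * (norm (g z) powr p + a z * norm (g z) powr q))"
        and Mi: "integrable lebesgue M"
  obtains \<phi> D K where "\<And>n. \<phi> n \<in> Cc_infinity \<Omega>" "K \<ge> 0"
    "\<And>n. integrable lebesgue (D n)" "(\<lambda>n. LINT x|lebesgue. \<bar>D n x - M x\<bar>) \<longlonglongrightarrow> 0"
    "\<And>n x. x \<in> \<Omega> \<Longrightarrow>
        norm (gradient (\<phi> n) x) powr p + a x * norm (gradient (\<phi> n) x) powr q \<le> K * D n x"
    "AE x in lebesgue. (\<lambda>n. \<phi> n x) \<longlonglongrightarrow> u x"
    "AE x in lebesgue. (\<lambda>n. gradient (\<phi> n) x) \<longlonglongrightarrow> g x"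
proof -
  have u: "integrable lebesgue u" and g: "integrable lebesgue g"
    using wg by (auto simp: global_weak_gradient_def)
  have gb: "integrable lebesgue (\<lambda>z. g z \<bullet> b)" for b using g by simp
  obtain h \<epsilon> \<delta>0 where h: "\<And>c. c \<in> Basis \<Longrightarrow>
      (\<lambda>x. h x \<bullet> c) \<in> Cc_infinity UNIV" and \<epsilon>: "\<epsilon> > 0"
          and \<delta>0: "\<delta>0 > 0"
    and push: "\<And>\<delta> x f y. 0 < \<delta> \<Longrightarrow> \<delta> < \<delta>0 \<Longrightarrow>
        f \<notin> \<Omega> \<Longrightarrow> norm (x - f) \<le> \<epsilon> * \<delta> \<Longrightarrow>
       norm (y - (x + \<delta> *\<^sub>R h x)) \<le> \<epsilon> * \<delta> \<Longrightarrow> y \<notin> \<Omega>"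
    using lipschitz_domain_outward_field[OF \<Omega>] by blast
  obtain L where L: "L > 0" "\<And>x. norm (h x) \<le> L" "\<And>x y. norm (h x - h y) \<le> L * norm (x - y)"
    "\<And>x b c. b \<in> Basis \<Longrightarrow> c \<in> Basis \<Longrightarrow>
        \<bar>frechet_derivative (\<lambda>x. h x \<bullet> c) (at x) b\<bar> \<le> L"
    using Cc_infinity_field_bounds[of h, OF h] by blast
  obtain C1 :: real where C1: "C1 \<ge> 0"
    "\<And>s (u :: 'a \<Rightarrow> real) A \<gamma> y. s > 0 \<Longrightarrow>
        integrable lebesgue u \<Longrightarrow> A \<ge> 0 \<Longrightarrow> \<gamma> \<ge> 0 \<Longrightarrow>
      (\<And>x y. \<bar>u x - u y\<bar> \<le> A * norm (x - y) powr \<gamma>) \<Longrightarrow>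
      norm (gradient (conv (mollifier s) u) y) \<le> C1 * A * s powr (\<gamma> - 1)"
    using conv_gradient_holder by blast
  define P where "P = real DIM('a) * real DIM('a) * L"
  have P: "P > 0" "L \<le> P"
  proof -
    have "1 * 1 \<le> real DIM('a) * real DIM('a)" by (intro mult_mono) auto
    then have "1 * L \<le> P" unfolding P_def using L(1) by (intro mult_right_mono) auto
    then show "L \<le> P" "P > 0" using L(1) by auto
  qed
  \<comment> \<open>Three constraints: the push must be admissible, \<delta> P \<le> 1/2 keeps both
    the gradient and the lower Lipschitz bound of T within a factor 2, and \<epsilon> \<delta> \<le>
    1 gives s \<le> 1.\<close>
  define \<delta>1 where "\<delta>1 = min (\<delta>0 / 2) (min (1 / (2 * P)) (1 / \<epsilon>))"
  have \<delta>1: "\<delta>1 > 0" "\<delta>1 < \<delta>0" "\<delta>1 * P \<le> 1/2" "\<delta>1 * \<epsilon> \<le> 1"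
  proof -
    show "\<delta>1 > 0" "\<delta>1 < \<delta>0" using \<delta>0 P \<epsilon> by (auto simp: \<delta>1_def)
    have "\<delta>1 \<le> 1 / (2 * P)" "\<delta>1 \<le> 1 / \<epsilon>" by (auto simp: \<delta>1_def)
    then show "\<delta>1 * P \<le> 1/2" "\<delta>1 * \<epsilon> \<le> 1" using P \<epsilon> by (auto simp: field_simps)
  qed
  define \<delta> where "\<delta> n = \<delta>1 / real (Suc n)" for n
  have \<delta>: "\<delta> n > 0" "\<delta> n \<le> \<delta>1" for n
    using \<delta>1(1) by (auto simp: \<delta>_def divide_le_eq mult_le_cancel_left1)
  have \<delta>lim: "\<delta> \<longlonglongrightarrow> 0" unfolding \<delta>_def
      by (rule LIMSEQ_Suc) (rule lim_const_over_n)
  have \<delta>P: "\<delta> n * P \<le> 1/2" "\<delta> n * L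
      \<le> 1/2" "\<delta> n < \<delta>0" "\<delta> n * \<epsilon> \<le> 1" for n
  proof -
    show "\<delta> n * P \<le> 1/2" using mult_right_mono[OF \<delta>(2), of P n] \<delta>1(3) P(1) by linarith
    then show "\<delta> n * L \<le> 1/2" using mult_left_mono[OF P(2), of "\<delta> n"] \<delta>(1)[of n] by linarith
    show "\<delta> n < \<delta>0" using \<delta>(2)[of n] \<delta>1(2) by linarith
    show "\<delta> n * \<epsilon> \<le> 1"
        using mult_right_mono[OF \<delta>(2), of \<epsilon> n] \<delta>1(4) \<epsilon> by linarith
  qed
  define s where "s n = \<epsilon> * \<delta> n" for n
  have s: "s n > 0" "s n \<le> 1" for n using \<delta>(1) \<epsilon> \<delta>P(4)[of n]
      by (auto simp: s_def mult.commute)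
  have slim: "s \<longlonglongrightarrow> 0" unfolding s_def
      using tendsto_mult_left[OF \<delta>lim, of \<epsilon>] by simp
  define T where "T n x = x + \<delta> n *\<^sub>R h x" for n x
  have sh: "c \<in> Basis \<Longrightarrow> smooth (\<lambda>x. h x \<bullet> c)" for c
      by (rule Cc_infinity_smooth[OF h])
  have sT: "smooth (\<lambda>x. T n x \<bullet> c)" if "c \<in> Basis" for n c
  proof -
    have "Ck_fun k (\<lambda>x. x \<bullet> c + \<delta> n * (h x \<bullet> c))" for k
      using sh[OF that] by (intro Ck_fun_add Ck_fun_mult Ck_fun_inner Ck_fun_const smooth_Ck)
    then show ?thesis by (simp add: smooth_def T_def inner_add_left)
  qed
  have cT: "continuous_on UNIV (T n)" for n
    by (subst continuous_on_componentwise) (use sT smooth_continuous in blast)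
  have Tx: "norm (T n x - x) \<le> \<delta> n * L" for n x
    using L(2)[of x] \<delta>(1)[of n] by (simp add: T_def mult_left_mono)
  \<comment> \<open>The perturbation changes differences by at most half of |x - y|, which is
    absorbed on the left.\<close>
  have Tlip: "norm (x - y) \<le> 2 * norm (T n x - T n y)" for n x y
  proof -
    have "x - y = (T n x - T n y) - \<delta> n *\<^sub>R (h x - h y)" by (simp add: T_def algebra_simps)
    then have "norm (x - y) \<le> norm (T n x - T n y) + norm (\<delta> n *\<^sub>R (h x - h y))"
      by (metis norm_triangle_ineq4)
    also have "norm (\<delta> n *\<^sub>R (h x - h y)) \<le> \<delta> n * (L * norm (x - y))"
      using L(3)[of x y] \<delta>(1)[of n] by (simp add: mult_left_mono)
    also have "\<dots> \<le> 1/2 * norm (x - y)"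
      unfolding mult.assoc[symmetric] by (rule mult_right_mono[OF \<delta>P(2)]) simp
    finally show ?thesis by linarith
  qed
  have dlim: "(\<lambda>n. \<delta> n * L) \<longlonglongrightarrow> 0"
      using tendsto_mult_right[OF \<delta>lim, of L] by simp
  let ?S = "\<lambda>n f x. conv (mollifier (s n)) f (T n x)"
  have SI: "integrable lebesgue (?S n f)" if "integrable lebesgue f" for n f
    by (rule conv_mollifier_compose_integrable[OF that s(1) cT Tlip])
  have SL: "(\<lambda>n. LINT x|lebesgue. \<bar>?S n f x - f x\<bar>)
      \<longlonglongrightarrow> 0" if "integrable lebesgue f" for f
    by (rule conv_mollifier_L1[OF that s(1) slim dlim Tx cT Tlip])
  define \<phi> where "\<phi> n x = ?S n u x" for n x
  define v where "v n x = gradient (conv (mollifier (s n)) u) (T n x)" for n x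
  have \<phi>: "\<phi> n \<in> Cc_infinity \<Omega>" for n
    unfolding \<phi>_def[abs_def]
  proof (rule conv_pushed_Cc_infinity[OF \<Omega>(2) u out(1) s(1) sT])
    fix x f y assume "f \<notin> \<Omega>" "norm (x - f) \<le> s n" "norm (y - T n x) \<le> s n"
    then show "y \<notin> \<Omega>"
      using push[OF \<delta>(1) \<delta>P(3)] unfolding s_def T_def by blast
  qed
  have grad: "norm (gradient (\<phi> n) x - v n x) \<le> \<delta> n * P * norm (v n x)" for n x
    using gradient_compose_perturbation[OF conv_mollifier_smooth[OF s(1) u] sh L(4) less_imp_le[OF \<delta>(1)]]
    unfolding \<phi>_def[abs_def] v_def T_def P_def .
  have grad2: "norm (gradient (\<phi> n) x) \<le> 2 * norm (v n x)" for n x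
  proof -
    have "norm (gradient (\<phi> n) x) \<le> norm (v n x) + norm (gradient (\<phi> n) x - v n x)"
      using norm_triangle_ineq[of "v n x" "gradient (\<phi> n) x - v n x"] by simp
    also have "norm (gradient (\<phi> n) x - v n x) \<le> 1/2 * norm (v n x)"
      by (rule order_trans[OF grad]) (rule mult_right_mono[OF \<delta>P(1)], simp)
    finally show ?thesis using norm_ge_zero[of "v n x"] by linarith
  qed
  have vb: "v n x \<bullet> b = ?S n (\<lambda>z. g z \<bullet> b) x" if "b \<in> Basis" for n x b
    unfolding v_def by (simp add: that gradient_inner conv_global_weak_gradient[OF wg mollifier_Cc_infinity[OF s(1)]])
  \<comment> \<open>Index \<open>None\<close> stands for the function itself and
    \<open>Some b\<close> for its partial derivatives, so that one subsequence serves all.\<close>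
  define F where "F i n x
      = (case i of None \<Rightarrow> \<phi> n x - u x | Some b \<Rightarrow> ?S n (\<lambda>z. g z \<bullet> b) x - g x \<bullet> b)" for i n x
  have "finite (insert None (Some ` (Basis :: 'a set)))" by simp
  moreover have "integrable lebesgue (F i n)" for i n
    using SI[OF u] SI[OF gb] u gb by (cases i) (auto simp: F_def[abs_def] \<phi>_def)
  moreover have "(\<lambda>n. LINT x|lebesgue. \<bar>F i n x\<bar>) \<longlonglongrightarrow> 0" for i
    using SL[OF u] SL[OF gb] by (cases i) (auto simp: F_def \<phi>_def)
  ultimately obtain \<sigma> :: "nat \<Rightarrow> nat" where \<sigma>: "strict_mono \<sigma>"
    and ae: "AE x in lebesgue. \<forall>i\<in>insert None (Some ` (Basis :: 'a set)). (\<lambda>n. F i (\<sigma> n) x) \<longlonglongrightarrow> 0"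
    using tendsto_L1_sum_AE_subseq[of "insert None (Some ` (Basis :: 'a set))" lebesgue F] by blast
  \<comment> \<open>A point within s of T x has distance at most \<delta> L + s = (L / \<epsilon> +
    1) s from x.\<close>
  define c where "c = L / \<epsilon> + 1"
  have c: "c > 0" using L(1) \<epsilon> by (simp add: c_def add_pos_pos)
  \<comment> \<open>The factor \<open>2 powr q\<close> pays for replacing the gradient of the
    composition by at most twice the gradient at the pushed point.\<close>
  define K where "K = 2 powr q * (1 + C + C * c powr \<kappa> * (C1 * A) powr (q - p))"
  have near: "norm (x - z) \<le> c * s n" if "norm (T n x - z) \<le> s n" for n x z
  proof -
    have "norm (x - z) \<le> norm (T n x - x) + norm (T n x - z)"
      using norm_triangle_ineq4[of "T n x - z" "T n x - x"] by simp
    also have "\<dots> \<le> \<delta> n * L + s n" using Tx[of n x] that by simp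
    also have "\<dots> = c * s n" using \<epsilon> by (simp add: c_def s_def field_simps)
    finally show ?thesis .
  qed
  have est: "norm (gradient (\<phi> n) x) powr p + a x * norm (gradient (\<phi> n) x) powr q \<le> K * ?S n M x"
    if x: "x \<in> \<Omega>" for n x
  proof -
    let ?w = "norm (v n x)"
    have pt: "?w powr p + a x * ?w powr q \<le> (1 + C + C * c powr \<kappa> * (C1 * A) powr (q - p)) * ?S n M x"
      unfolding M_def
    proof (rule double_phase_pointwise[OF less_imp_le[OF p(1)] p(2) C a \<kappa> g out(2) _ s c near x])
      show "integrable lebesgue (\<lambda>z. indicator \<Omega> z * (norm (g z) powr p + a z * norm (g z) powr q))"
        using Mi unfolding M_def .
      show "?w \<le> conv (mollifier (s n)) (\<lambda>z. norm (g z)) (T n x)"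
        unfolding v_def by (rule conv_gradient_le[OF wg s(1)])
      show "?w \<le> C1 * A * s n powr (\<gamma> - 1)"
        unfolding v_def by (rule C1(2)[OF s(1) u A \<gamma> hol])
      show "0 \<le> C1 * A" using C1 A by simp
    qed (use p in auto)
    have pow: "norm (gradient (\<phi> n) x) powr e \<le> 2 powr q * ?w powr e" if "0 \<le> e" "e \<le> q" for e
    proof -
      have "norm (gradient (\<phi> n) x) powr e \<le> (2 * ?w) powr e"
        using grad2 that by (intro powr_mono2) auto
      also have "\<dots> = 2 powr e * ?w powr e" by (simp add: powr_mult)
      also have "\<dots> \<le> 2 powr q * ?w powr e"
        using that by (intro mult_right_mono powr_mono) auto
      finally show ?thesis .
    qed
    have "norm (gradient (\<phi> n) x) powr p + a x * norm (gradient (\<phi> n) x) powr q \<le>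
        2 powr q * ?w powr p + a x * (2 powr q * ?w powr q)"
      using p by (intro add_mono mult_left_mono pow a(1)[OF x]) auto
    also have "\<dots> = 2 powr q * (?w powr p + a x * ?w powr q)" by (simp add: algebra_simps)
    also have "\<dots> \<le> 2 powr q * ((1 + C + C * c powr \<kappa> * (C1 * A) powr (q - p)) * ?S n M x)"
      by (intro mult_left_mono pt) simp
    finally show ?thesis by (simp add: K_def mult.assoc)
  qed
  have conv\<phi>: "AE x in lebesgue. (\<lambda>n. \<phi> (\<sigma> n) x) \<longlonglongrightarrow> u x"
    using ae
  proof eventually_elim
    case (elim x)
    then have "(\<lambda>n. F None (\<sigma> n) x) \<longlonglongrightarrow> 0" by blast
    then show ?case by (simp add: F_def LIM_zero_iff)
  qed
  have convg: "AE x in lebesgue. (\<lambda>n. gradient (\<phi> (\<sigma> n)) x) \<longlonglongrightarrow> g x"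
    using ae
  proof eventually_elim
    case (elim x)
    have vlim: "(\<lambda>n. v (\<sigma> n) x) \<longlonglongrightarrow> g x"
    proof (rule tendsto_componentwise_iff[THEN iffD2], intro ballI)
      fix b :: 'a assume b: "b \<in> Basis"
      then have "(\<lambda>n. F (Some b) (\<sigma> n) x) \<longlonglongrightarrow> 0" using elim by blast
      then show "(\<lambda>n. v (\<sigma> n) x \<bullet> b) \<longlonglongrightarrow> g x \<bullet> b"
          by (simp add: F_def vb[OF b] LIM_zero_iff)
    qed
    have "(\<lambda>n. \<delta> (\<sigma> n) * P * norm (v (\<sigma> n) x))
        \<longlonglongrightarrow> 0 * P * norm (g x)"
      using LIMSEQ_subseq_LIMSEQ[OF \<delta>lim \<sigma>] by (intro tendsto_intros vlim) (simp add: comp_def)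
    then have "(\<lambda>n. gradient (\<phi> (\<sigma> n)) x - v (\<sigma> n) x) \<longlonglongrightarrow> 0"
      by (intro Lim_null_comparison[OF always_eventually[OF allI[OF grad]]]) simp
    from tendsto_add[OF this vlim] show ?case by simp
  qed
  show thesis
  proof (rule that[of "\<lambda>n. \<phi> (\<sigma> n)" K "\<lambda>n. ?S (\<sigma> n) M"])
    show "K \<ge> 0" using C by (simp add: K_def)
    show "(\<lambda>n. LINT x|lebesgue. \<bar>?S (\<sigma> n) M x - M x\<bar>) \<longlonglongrightarrow> 0"
      using LIMSEQ_subseq_LIMSEQ[OF SL[OF Mi] \<sigma>] by (simp add: comp_def)
  qed (use \<phi> SI[OF Mi] est conv\<phi> convg in auto)
qed

subsection \<open>Convergence of the energies\<close>

text \<open>Along a simple function the composition is a countable patchwork of measurable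
  functions; continuity in the second argument carries measurability to the limit.\<close>

lemma caratheodory_measurable:
  fixes G :: "'a \<Rightarrow> 'b::{second_countable_topology, metric_space} \<Rightarrow> real"
  assumes G: "\<And>w. (\<lambda>x. G x w) \<in> borel_measurable M" "\<And>x. x \<in> space M \<Longrightarrow>
      continuous_on UNIV (G x)"
    and w: "w \<in> borel_measurable M"
  shows "(\<lambda>x. G x (w x)) \<in> borel_measurable M"
proof -
  obtain F where F: "\<And>i. simple_function M (F i)" "\<And>x. x \<in> space M \<Longrightarrow>
      (\<lambda>i. F i x) \<longlonglongrightarrow> w x"
    using borel_measurable_implies_sequence_metric[OF w] by blast
  have "(\<lambda>x. G x (F i x)) \<in> borel_measurable M" for i
  proof (rule measurable_compose_countable'[where g = "F i" and I = "F i ` space M"])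
    show "countable (F i ` space M)"
      using F(1) by (intro countable_finite) (simp add: simple_function_def)
    show "F i \<in> measurable M (count_space (F i ` space M))"
      using F(1)[of i] by (subst measurable_count_space_eq2) (auto simp: simple_function_def)
  qed (rule G(1))
  moreover have "(\<lambda>i. G x (F i x)) \<longlonglongrightarrow> G x (w x)" if "x \<in> space M" for x
    using G(2)[OF that] F(2)[OF that] continuous_on_tendsto_compose[of UNIV "G x"] by fastforce
  ultimately show ?thesis by (rule borel_measurable_LIMSEQ_real[rotated])
qed

text \<open>Dominated convergence with majorants depending on n: the part of F n below D' has a
  fixed majorant, and the excess is at most |D n - D'|, whose integral tends to zero.\<close>

lemma nn_integral_limit_ge:
  fixes F D :: "nat \<Rightarrow> 'a \<Rightarrow> real"
  assumes F: "\<And>n. F n \<in> borel_measurable N" "F' \<in> borel_measurable N"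
    and lim: "AE x in N. (\<lambda>n. F n x) \<longlonglongrightarrow> F' x"
    and bd: "\<And>n x. x \<in> space N \<Longrightarrow> 0
        \<le> F n x" "\<And>n x. x \<in> space N \<Longrightarrow> F n x \<le> D n x"
    and D: "\<And>n. integrable N (D n)" "integrable N D'" "(\<lambda>n. LINT x|N. \<bar>D n x - D' x\<bar>) \<longlonglongrightarrow> 0"
    and c: "\<And>n. c \<le> (\<integral>\<^sup>+x. ennreal (F n x) \<partial>N)"
  shows "c \<le> (\<integral>\<^sup>+x. ennreal (F' x) \<partial>N)"
proof -
  have [measurable]: "F n \<in> borel_measurable N" "F' \<in> borel_measurable N"
    "D n \<in> borel_measurable N" "D' \<in> borel_measurable N" for n
    using F D by auto
  let ?A = "\<lambda>n. \<integral>\<^sup>+x. ennreal (min (F n x) (D' x)) \<partial>N"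
  let ?B = "\<lambda>n. ennreal (LINT x|N. \<bar>D n x - D' x\<bar>)"
  have le: "c \<le> ?A n + ?B n" for n
  proof -
    have "(\<integral>\<^sup>+x. ennreal (F n x) \<partial>N)
        \<le> (\<integral>\<^sup>+x. ennreal (min (F n x) (D' x)) + ennreal \<bar>D n x - D' x\<bar> \<partial>N)"
    proof (rule nn_integral_mono)
      fix x assume x: "x \<in> space N"
      show "ennreal (F n x) \<le> ennreal (min (F n x) (D' x)) + ennreal \<bar>D n x - D' x\<bar>"
      proof (cases "D' x \<ge> 0")
        case True
        then have "ennreal (min (F n x) (D' x)) + ennreal \<bar>D n x - D' x\<bar>
            = ennreal (min (F n x) (D' x) + \<bar>D n x - D' x\<bar>)"
          using bd(1)[OF x] by simp
        moreover have "F n x \<le> min (F n x) (D' x) + \<bar>D n x - D' x\<bar>"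
          using bd(2)[OF x, of n] by linarith
        ultimately show ?thesis by (simp add: ennreal_leI)
      next
        \<comment> \<open>D' is only assumed integrable; where it is negative,
          \<open>ennreal\<close> sends the minimum to 0 and the excess alone bounds F n.\<close>
        case False
        then have "F n x \<le> \<bar>D n x - D' x\<bar>" using bd(2)[OF x, of n] by linarith
        then show ?thesis by (simp add: ennreal_leI add_increasing)
      qed
    qed
    also have "\<dots> = ?A n + (\<integral>\<^sup>+x. ennreal \<bar>D n x - D' x\<bar> \<partial>N)"
        by (rule nn_integral_add) auto
    also have "(\<integral>\<^sup>+x. ennreal \<bar>D n x - D' x\<bar> \<partial>N) = ?B n"
      using D by (intro nn_integral_eq_integral) auto
    finally show ?thesis using c[of n] by (rule order_trans[rotated])
  qed
  have "?A \<longlonglongrightarrow> (\<integral>\<^sup>+x. ennreal (min (F' x) (D' x)) \<partial>N)"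
  proof (rule nn_integral_dominated_convergence[where w = "\<lambda>x. ennreal \<bar>D' x\<bar>"])
    show "(\<integral>\<^sup>+x. ennreal \<bar>D' x\<bar> \<partial>N) < \<infinity>"
      using D(2) by (simp add: integrable_iff_bounded)
    show "AE x in N. ennreal (min (F n x) (D' x)) \<le> ennreal \<bar>D' x\<bar>" for n
      by (intro AE_I2 ennreal_leI) linarith
    show "AE x in N. (\<lambda>n. ennreal (min (F n x) (D' x))) \<longlonglongrightarrow> ennreal (min (F' x) (D' x))"
      using lim by eventually_elim (intro tendsto_ennrealI tendsto_intros)
  qed auto
  moreover have "?B \<longlonglongrightarrow> 0" using tendsto_ennrealI[OF D(3)] by simp
  ultimately have "(\<lambda>n. ?A n + ?B n)
      \<longlonglongrightarrow> (\<integral>\<^sup>+x. ennreal (min (F' x) (D' x)) \<partial>N) + 0"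
    by (rule tendsto_add)
  then have "c \<le> (\<integral>\<^sup>+x. ennreal (min (F' x) (D' x)) \<partial>N)"
    using le by (intro LIMSEQ_le_const) auto
  also have "\<dots> \<le> (\<integral>\<^sup>+x. ennreal (F' x) \<partial>N)"
      by (intro nn_integral_mono ennreal_leI) simp
  finally show ?thesis .
qed

lemma powr_add_le:
  fixes x y e :: real
  assumes "x \<ge> 0" "y \<ge> 0" "e \<ge> 0"
  shows "(x + y) powr e \<le> 2 powr e * (x powr e + y powr e)"
proof -
  have "(x + y) powr e \<le> (2 * max x y) powr e" using assms by (intro powr_mono2) auto
  also have "\<dots> = 2 powr e * max x y powr e" using assms by (simp add: powr_mult)
  also have "\<dots> \<le> 2 powr e * (x powr e + y powr e)" by (intro mult_left_mono) (auto simp: max_def)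
  finally show ?thesis .
qed

text \<open>The terms are difference quotients at 0 of s \<mapsto> arctan(t s), with increments
  1/(n+1).\<close>

lemma arctan_truncation_lim: "(\<lambda>n. real (Suc n) * arctan (t / real (Suc n))) \<longlonglongrightarrow> t"
proof -
  have "((\<lambda>s. arctan (t * s)) has_real_derivative t) (at 0)"
    by (auto intro!: derivative_eq_intros)
  then have "((\<lambda>h. arctan (t * h) / h) \<longlongrightarrow> t) (at 0)" by (simp add: DERIV_def)
  moreover have "filterlim (\<lambda>n. 1 / real (Suc n)) (at 0) sequentially"
    by (rule filterlim_atI) (use LIMSEQ_inverse_real_of_nat in \<open>auto simp: inverse_eq_divide\<close>)
  ultimately have "(\<lambda>n. arctan (t * (1 / real (Suc n))) / (1 / real (Suc n))) \<longlonglongrightarrow> t"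
    by (rule filterlim_compose)
  then show ?thesis by (simp add: mult.commute)
qed

lemma arctan_truncation_deriv_lim: "(\<lambda>n. inverse (1 + (t / real (Suc n))\<^sup>2)) \<longlonglongrightarrow> (1 :: real)"
proof -
  have lim: "(\<lambda>n. t * inverse (real (Suc n))) \<longlonglongrightarrow> t * 0"
    by (rule tendsto_mult[OF tendsto_const LIMSEQ_inverse_real_of_nat])
  have "(\<lambda>n. inverse (1 + (t * inverse (real (Suc n)))\<^sup>2))
      \<longlonglongrightarrow> inverse (1 + (t * 0)\<^sup>2)"
    by (rule tendsto_inverse[OF tendsto_add[OF tendsto_const tendsto_power[OF lim]]]) simp
  then show ?thesis by (simp add: divide_inverse)
qed

section \<open>The functional under the standing hypotheses of the theorem\<close>

locale double_phase =
  fixes \<Omega> :: "'a::euclidean_space set"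
    and p q \<kappa> \<nu> L :: real
    and a \<Lambda> u\<^sub>0 :: "'a \<Rightarrow> real"
    and G :: "'a \<Rightarrow> real \<Rightarrow> 'a \<Rightarrow> real"
  assumes bounded_\<Omega>: "bounded \<Omega>" and lipschitz_\<Omega>: "lipschitz_domain \<Omega>"
    and p: "1 < p" and pq: "p < q" and \<kappa>: "0 < \<kappa>"
    and a: "a \<in> Z_class \<kappa> \<Omega>"
    and G_measurable: "\<And>z \<xi>. (\<lambda>x. G x z \<xi>) \<in> borel_measurable (lebesgue_on \<Omega>)"
    and G_continuous: "\<And>x. x \<in> \<Omega> \<Longrightarrow>
        continuous_on UNIV (\<lambda>(z, \<xi>). G x z \<xi>)"
    and \<nu>: "0 < \<nu>" and L: "1 < L"
    and \<Lambda>: "\<Lambda> absolutely_integrable_on \<Omega>" "\<And>x. x \<in> \<Omega> \<Longrightarrow>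
        0 \<le> \<Lambda> x"
    and G_ge: "\<And>x z \<xi>. x \<in> \<Omega> \<Longrightarrow>
        \<nu> * (norm \<xi> powr p + a x * norm \<xi> powr q) \<le> G x z \<xi>"
    and G_le: "\<And>x z \<xi>. x \<in> \<Omega> \<Longrightarrow> G x z \<xi>
        \<le> L * (norm \<xi> powr p + a x * norm \<xi> powr q + \<Lambda> x)"
    and u\<^sub>0: "u\<^sub>0 \<in> W11 \<Omega>" and energy_u\<^sub>0: "energy G \<Omega> u\<^sub>0 < \<infinity>"
begin

abbreviation N :: "'a measure" where "N \<equiv> lebesgue_on \<Omega>"

abbreviation H :: "'a \<Rightarrow> 'a \<Rightarrow> real" where
  "H x \<xi> \<equiv> norm \<xi> powr p + a x * norm \<xi> powr q"

definition \<xi>\<^sub>0 :: "'a \<Rightarrow> 'a" where "\<xi>\<^sub>0 = weak_gradient \<Omega> u\<^sub>0"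

text \<open>The energy of u_0 plus a perturbation, with the gradient as a separate argument, so that
  limits can be taken with explicit gradients instead of the representative chosen by
  \<open>weak_gradient\<close>.\<close>

definition E :: "('a \<Rightarrow> real) \<Rightarrow> ('a \<Rightarrow> 'a) \<Rightarrow> ennreal" where
  "E v \<xi> = (\<integral>\<^sup>+x. ennreal (G x (u\<^sub>0 x + v x) (\<xi>\<^sub>0 x + \<xi> x)) \<partial>N)"

lemma open_\<Omega>: "open \<Omega>" and nonempty_\<Omega>: "\<Omega> \<noteq> {}"
  using lipschitz_\<Omega> by (auto simp: lipschitz_domain_def)

lemma sets_\<Omega>: "\<Omega> \<in> sets lebesgue"
  using open_\<Omega> by auto

lemma a_nonneg: "x \<in> \<Omega> \<Longrightarrow> 0 \<le> a x"
    and a_measurable [measurable]: "a \<in> borel_measurable N"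
  using a by (auto simp: Z_class_def)

lemma integrable_N: "integrable lebesgue f \<Longrightarrow> integrable N (f :: 'a \<Rightarrow> 'b::euclidean_space)"
  using sets_\<Omega> by (subst integrable_restrict_space) (auto intro: integrable_mult_indicator)

lemma measurable_N: "f \<in> borel_measurable lebesgue \<Longrightarrow> f \<in> borel_measurable N"
  by (rule measurable_restrict_space1)

lemma AE_N: "(AE x in N. P x) \<longleftrightarrow> (AE x in lebesgue. x \<in> \<Omega> \<longrightarrow> P x)"
  using sets_\<Omega> by (subst AE_restrict_space_iff) auto

lemma integral_N_le:
  fixes f :: "'a \<Rightarrow> real"
  assumes "integrable lebesgue f"
  shows "(LINT x|N. \<bar>f x\<bar>) \<le> (LINT x|lebesgue. \<bar>f x\<bar>)"
proof -
  have "(LINT x|N. \<bar>f x\<bar>) = (LINT x|lebesgue. indicator \<Omega> x *\<^sub>R \<bar>f x\<bar>)"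
    using sets_\<Omega> by (subst integral_restrict_space) auto
  also have "\<dots> \<le> (LINT x|lebesgue. \<bar>f x\<bar>)"
    using assms sets_\<Omega> by (intro integral_mono integrable_mult_indicator) (auto simp: indicator_def)
  finally show ?thesis .
qed

lemma nn_integral_\<Omega>: "(\<integral>\<^sup>+x\<in>\<Omega>. f x \<partial>lebesgue)
    = (\<integral>\<^sup>+x. f x \<partial>N)"
  using sets_\<Omega> by (subst nn_integral_restrict_space) auto

lemma weak_gradient_integrable:
  assumes "u \<in> W11 \<Omega>"
  shows "is_weak_gradient \<Omega> u (weak_gradient \<Omega> u)" "weak_gradient \<Omega> u \<in> borel_measurable N" "u \<in> borel_measurable N"
proof -
  obtain g where g: "is_weak_gradient \<Omega> u g" "g absolutely_integrable_on \<Omega>"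
      and u: "u absolutely_integrable_on \<Omega>"
    using assms unfolding W11_def by blast
  show "is_weak_gradient \<Omega> u (weak_gradient \<Omega> u)" by (rule weak_gradient_works[OF g(1)])
  have "AE x in lebesgue. indicator \<Omega> x *\<^sub>R g x
      = indicator \<Omega> x *\<^sub>R weak_gradient \<Omega> u x"
    using weak_gradient_AE[OF open_\<Omega> g(1)] by eventually_elim (auto simp: indicator_def)
  then have "(\<lambda>x. indicator \<Omega> x *\<^sub>R weak_gradient \<Omega> u x) \<in> borel_measurable lebesgue"
    by (rule borel_measurable_AE[OF borel_measurable_integrable[OF g(2)[unfolded set_integrable_def]]])
  then show "weak_gradient \<Omega> u \<in> borel_measurable N"
    using sets_\<Omega> by (subst borel_measurable_restrict_space_iff) auto
  show "u \<in> borel_measurable N"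
    using u sets_\<Omega> unfolding set_integrable_def by (subst borel_measurable_restrict_space_iff) auto
qed

lemma \<xi>\<^sub>0: "is_weak_gradient \<Omega> u\<^sub>0 \<xi>\<^sub>0"
  and [measurable]: "\<xi>\<^sub>0 \<in> borel_measurable N" "u\<^sub>0 \<in> borel_measurable N"
  using weak_gradient_integrable[OF u\<^sub>0] by (auto simp: \<xi>\<^sub>0_def)

lemma integrand_measurable:
  assumes [measurable]: "v \<in> borel_measurable N" "\<xi> \<in> borel_measurable N"
  shows "(\<lambda>x. G x (u\<^sub>0 x + v x) (\<xi>\<^sub>0 x + \<xi> x)) \<in> borel_measurable N"
proof -
  have "(\<lambda>x. (case (u\<^sub>0 x + v x, \<xi>\<^sub>0 x + \<xi> x) of (z, \<xi>) \<Rightarrow> G x z \<xi>)) \<in> borel_measurable N"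
  proof (rule caratheodory_measurable[where G = "\<lambda>x (z, \<xi>). G x z \<xi>"])
    show "(\<lambda>x. case w of (z, \<xi>) \<Rightarrow> G x z \<xi>) \<in> borel_measurable N" for w
      using G_measurable by (cases w) simp
    show "continuous_on UNIV (\<lambda>w. case w of (z, \<xi>) \<Rightarrow> G x z \<xi>)" if "x \<in> space N" for x
      using G_continuous that by simp
  qed measurable
  then show ?thesis by simp
qed

lemma integrand_nonneg: "x \<in> \<Omega> \<Longrightarrow> 0 \<le> G x z \<xi>"
  using G_ge[of x \<xi> z] a_nonneg[of x] \<nu> by (smt (verit) mult_nonneg_nonneg powr_ge_zero)

lemma energy_eq_E:
  assumes "is_weak_gradient \<Omega> \<phi> \<xi>"
  shows "energy G \<Omega> (\<lambda>x. u\<^sub>0 x + \<phi> x) = E \<phi> \<xi>"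
  unfolding energy_def E_def nn_integral_\<Omega>
proof (rule nn_integral_cong_AE)
  have "AE x in lebesgue. x \<in> \<Omega>
      \<longrightarrow> weak_gradient \<Omega> (\<lambda>x. u\<^sub>0 x + \<phi> x) x = \<xi>\<^sub>0 x + \<xi> x"
    by (rule weak_gradient_AE[OF open_\<Omega> is_weak_gradient_add[OF \<xi>\<^sub>0 assms]])
  then show "AE x in N. ennreal (G x (u\<^sub>0 x + \<phi> x) (weak_gradient \<Omega> (\<lambda>x. u\<^sub>0 x + \<phi> x) x))
      = ennreal (G x (u\<^sub>0 x + \<phi> x) (\<xi>\<^sub>0 x + \<xi> x))"
    unfolding AE_N by eventually_elim auto
qed

lemma H_measurable:
  assumes [measurable]: "\<xi> \<in> borel_measurable N"
  shows "(\<lambda>x. H x (\<xi> x)) \<in> borel_measurable N"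
  by measurable

lemma H_nonneg: "x \<in> \<Omega> \<Longrightarrow> 0 \<le> H x \<xi>"
  using a_nonneg by simp

text \<open>Finite energy of \<open>u\<^sub>0\<close> and the lower growth bound on G; this is the
  contribution of \<open>u\<^sub>0\<close> to all later majorants.\<close>

lemma H_\<xi>\<^sub>0_integrable: "integrable N (\<lambda>x. H x (\<xi>\<^sub>0 x))"
proof (rule integrableI_bounded)
  have "(\<integral>\<^sup>+x. ennreal (norm (H x (\<xi>\<^sub>0 x))) \<partial>N)
      \<le> (\<integral>\<^sup>+x. ennreal (1 / \<nu>) * ennreal (G x (u\<^sub>0 x) (\<xi>\<^sub>0 x)) \<partial>N)"
  proof (rule nn_integral_mono)
    fix x assume "x \<in> space N"
    then have x: "x \<in> \<Omega>" by simp
    have "norm (H x (\<xi>\<^sub>0 x)) = H x (\<xi>\<^sub>0 x)" using H_nonneg[OF x] by simp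
    also have "\<dots> \<le> 1 / \<nu> * G x (u\<^sub>0 x) (\<xi>\<^sub>0 x)"
        using G_ge[OF x, of "\<xi>\<^sub>0 x" "u\<^sub>0 x"] \<nu> by (simp add: field_simps)
    finally show "ennreal (norm (H x (\<xi>\<^sub>0 x)))
        \<le> ennreal (1 / \<nu>) * ennreal (G x (u\<^sub>0 x) (\<xi>\<^sub>0 x))"
      using integrand_nonneg[OF x] \<nu> by (simp add: ennreal_mult[symmetric] ennreal_leI)
  qed
  also have "\<dots> = ennreal (1 / \<nu>) * energy G \<Omega> u\<^sub>0"
    unfolding energy_def nn_integral_\<Omega> \<xi>\<^sub>0_def[symmetric]
    using integrand_measurable[of "\<lambda>_. 0" "\<lambda>_. 0"] by (intro nn_integral_cmult) simp
  also have "\<dots> < \<infinity>" using energy_u\<^sub>0 by (simp add: ennreal_mult_less_top)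
  finally show "(\<integral>\<^sup>+x. ennreal (norm (H x (\<xi>\<^sub>0 x))) \<partial>N) < \<infinity>" .
qed (rule H_measurable, simp)

text \<open>The upper growth bound and the estimate of H at a sum by \<open>2 powr q\<close> times
  the two values of H turn the majorants of H into majorants of G, still convergent in L^1.
  Continuity of G gives the pointwise limit.\<close>

lemma E_limit_ge:
  assumes meas: "\<And>n. v n \<in> borel_measurable N" "\<And>n. \<xi> n \<in> borel_measurable N"
      "v' \<in> borel_measurable N" "\<xi>' \<in> borel_measurable N"
    and lim: "AE x in N. (\<lambda>n. v n x)
        \<longlonglongrightarrow> v' x" "AE x in N. (\<lambda>n. \<xi> n x) \<longlonglongrightarrow> \<xi>' x"
    and D: "\<And>n. integrable N (D n)" "integrable N D'" "(\<lambda>n. LINT x|N. \<bar>D n x - D' x\<bar>) \<longlonglongrightarrow> 0"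
    and bd: "\<And>n x. x \<in> \<Omega> \<Longrightarrow> H x (\<xi> n x) \<le> K * D n x" and K: "K \<ge> 0"
    and c: "\<And>n. c \<le> E (v n) (\<xi> n)"
  shows "c \<le> E v' \<xi>'"
  unfolding E_def
proof (rule nn_integral_limit_ge)
  let ?D = "\<lambda>d x. L * (2 powr q * H x (\<xi>\<^sub>0 x) + 2 powr q * K * d x + \<Lambda> x)"
  have i\<Lambda>: "integrable N \<Lambda>"
    using \<Lambda>(1) sets_\<Omega> unfolding set_integrable_def by (subst integrable_restrict_space) auto
  show "integrable N (?D (D n))" "integrable N (?D D')" for n
    using H_\<xi>\<^sub>0_integrable D i\<Lambda> by auto
  show "(\<lambda>n. LINT x|N. \<bar>?D (D n) x - ?D D' x\<bar>) \<longlonglongrightarrow> 0"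
  proof -
    have "\<bar>?D (D n) x - ?D D' x\<bar> = L * (2 powr q * K) * \<bar>D n x - D' x\<bar>" for n x
    proof -
      have "?D (D n) x - ?D D' x = (L * (2 powr q * K)) * (D n x - D' x)" by (simp add: algebra_simps)
      then show ?thesis using L K by (simp add: abs_mult)
    qed
    then show ?thesis using tendsto_mult_left[OF D(3), of "L * (2 powr q * K)"] by simp
  qed
  show "AE x in N. (\<lambda>n. G x (u\<^sub>0 x + v n x) (\<xi>\<^sub>0 x + \<xi> n x))
      \<longlonglongrightarrow> G x (u\<^sub>0 x + v' x) (\<xi>\<^sub>0 x + \<xi>' x)"
    using lim AE_space
  proof eventually_elim
    case (elim x)
    have "(\<lambda>n. (u\<^sub>0 x + v n x, \<xi>\<^sub>0 x + \<xi> n x))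
        \<longlonglongrightarrow> (u\<^sub>0 x + v' x, \<xi>\<^sub>0 x + \<xi>' x)"
      by (intro tendsto_intros elim)
    from continuous_on_tendsto_compose[OF G_continuous this] elim(3) show ?case by simp
  qed
  show "G x (u\<^sub>0 x + v n x) (\<xi>\<^sub>0 x + \<xi> n x) \<le> ?D (D n) x" if "x \<in> space N" for n x
  proof -
    have x: "x \<in> \<Omega>" using that by simp
    have pow: "norm (\<xi>\<^sub>0 x + \<xi> n x) powr e
        \<le> 2 powr q * (norm (\<xi>\<^sub>0 x) powr e + norm (\<xi> n x) powr e)"
      if "0 \<le> e" "e \<le> q" for e
    proof -
      have "norm (\<xi>\<^sub>0 x + \<xi> n x) powr e \<le> (norm (\<xi>\<^sub>0 x) + norm (\<xi> n x)) powr e"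
        using that by (intro powr_mono2 norm_triangle_ineq) auto
      also have "\<dots> \<le> 2 powr e * (norm (\<xi>\<^sub>0 x) powr e + norm (\<xi> n x) powr e)"
        using that by (intro powr_add_le) auto
      also have "\<dots> \<le> 2 powr q * (norm (\<xi>\<^sub>0 x) powr e + norm (\<xi> n x) powr e)"
        using that by (intro mult_right_mono powr_mono) auto
      finally show ?thesis .
    qed
    have "H x (\<xi>\<^sub>0 x + \<xi> n x) \<le> 2 powr q * (norm (\<xi>\<^sub>0 x) powr p + norm (\<xi> n x) powr p)
        + a x * (2 powr q * (norm (\<xi>\<^sub>0 x) powr q + norm (\<xi> n x) powr q))"
      using p pq by (intro add_mono mult_left_mono pow a_nonneg x) auto
    also have "\<dots> = 2 powr q * H x (\<xi>\<^sub>0 x) + 2 powr q * H x (\<xi> n x)" by (simp add: algebra_simps)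
    also have "\<dots> \<le> 2 powr q * H x (\<xi>\<^sub>0 x) + 2 powr q * (K * D n x)"
      by (intro add_left_mono mult_left_mono bd x) simp
    finally have "L * (H x (\<xi>\<^sub>0 x + \<xi> n x) + \<Lambda> x) \<le> ?D (D n) x"
      using L by (intro mult_left_mono) (auto simp: algebra_simps)
    then show ?thesis using G_le[OF x, of "u\<^sub>0 x + v n x" "\<xi>\<^sub>0 x + \<xi> n x"] by linarith
  qed
qed (use meas integrand_measurable integrand_nonneg c in \<open>auto simp: E_def\<close>)

abbreviation smooth_inf :: ennreal where
  "smooth_inf \<equiv> (INF w \<in> translate_set u\<^sub>0 (Cc_infinity \<Omega>). energy G \<Omega> w)"

lemma Z_class_constant:
  obtains C where "C > 0" "\<And>x y. x \<in> \<Omega> \<Longrightarrow> y \<in> \<Omega> \<Longrightarrow>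
      a x \<le> C * (a y + norm (x - y) powr \<kappa>)"
  using a unfolding Z_class_def by blast

lemma smooth_inf_le_E:
  assumes wg: "global_weak_gradient u g" and out: "\<And>x. x \<notin> \<Omega> \<Longrightarrow> u x
      = 0" "\<And>x. x \<notin> \<Omega> \<Longrightarrow> g x = 0"
    and hol: "\<And>x y. \<bar>u x - u y\<bar> \<le> A * norm (x - y) powr \<gamma>" and A: "A \<ge> 0"
    and \<gamma>: "\<gamma> \<ge> 0" "\<kappa> \<ge> (q - p) * (1 - \<gamma>)"
    and Mi: "integrable lebesgue (\<lambda>z. indicator \<Omega> z * H z (g z))"
  shows "smooth_inf \<le> E u g"
proof -
  obtain C where C: "C > 0" "\<And>x y. x \<in> \<Omega> \<Longrightarrow> y \<in> \<Omega> \<Longrightarrow>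
      a x \<le> C * (a y + norm (x - y) powr \<kappa>)"
    using Z_class_constant by blast
  show ?thesis
  proof (rule recovery_sequence[OF lipschitz_\<Omega> bounded_\<Omega> p pq C(1) a_nonneg C(2) \<kappa> \<gamma>(2,1) wg out hol A refl Mi])
    fix \<phi> D K
    assume \<phi>: "\<And>n. \<phi> n \<in> Cc_infinity \<Omega>" and K: "K \<ge> 0"
      and D: "\<And>n. integrable lebesgue (D n)" "(\<lambda>n. LINT x|lebesgue. \<bar>D n x - indicator \<Omega> x * H x (g x)\<bar>) \<longlonglongrightarrow> 0"
      and bd: "\<And>n x. x \<in> \<Omega> \<Longrightarrow> H x (gradient (\<phi> n) x) \<le> K * D n x"
      and ae: "AE x in lebesgue. (\<lambda>n. \<phi> n x)
          \<longlonglongrightarrow> u x" "AE x in lebesgue. (\<lambda>n. gradient (\<phi> n) x) \<longlonglongrightarrow> g x"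
    note wg\<phi> = Cc_infinity_global_weak_gradient[OF \<phi>]
    have int: "integrable lebesgue u" "integrable lebesgue g" "integrable lebesgue (\<phi> n)" "integrable lebesgue (gradient (\<phi> n))" for n
      using wg wg\<phi>[of n] by (auto simp: global_weak_gradient_def)
    show ?thesis
    proof (rule E_limit_ge[where v = \<phi> and \<xi> = "\<lambda>n. gradient (\<phi> n)" and D = D and K = K])
      show "AE x in N. (\<lambda>n. \<phi> n x)
          \<longlonglongrightarrow> u x" "AE x in N. (\<lambda>n. gradient (\<phi> n) x) \<longlonglongrightarrow> g x"
        using ae unfolding AE_N by (auto elim: eventually_mono)
      show "integrable N (D n)" for n by (rule integrable_N[OF D(1)])
      show "integrable N (\<lambda>x. indicator \<Omega> x * H x (g x))" by (rule integrable_N[OF Mi])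
      show "(\<lambda>n. LINT x|N. \<bar>D n x - indicator \<Omega> x * H x (g x)\<bar>) \<longlonglongrightarrow> 0"
        by (rule null_squeeze[OF _ integral_N_le D(2)]) (use D Mi in auto)
      fix n
      have "(\<lambda>x. u\<^sub>0 x + \<phi> n x) \<in> translate_set u\<^sub>0 (Cc_infinity \<Omega>)"
        using \<phi>[of n] unfolding translate_set_def by blast
      then have "smooth_inf \<le> energy G \<Omega> (\<lambda>x. u\<^sub>0 x + \<phi> n x)" by (rule INF_lower)
      also have "\<dots> = E (\<phi> n) (gradient (\<phi> n))"
        by (rule energy_eq_E[OF global_weak_gradient_restrict[OF wg\<phi>]])
      finally show "smooth_inf \<le> E (\<phi> n) (gradient (\<phi> n))" .
    qed (use int bd K in \<open>auto intro: measurable_N\<close>)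
  qed
qed

text \<open>Nothing changes inside \<Omega>, so the energy is unaffected, while the extension is
  open to mollification on the whole space.\<close>

lemma double_phase_W_extension:
  assumes "\<phi> \<in> double_phase_W p q a \<Omega>"
  defines "u \<equiv> \<lambda>x. indicator \<Omega> x * \<phi> x"
      and "g \<equiv> \<lambda>x. indicator \<Omega> x *\<^sub>R weak_gradient \<Omega> \<phi> x"
  shows "global_weak_gradient u g" "integrable lebesgue (\<lambda>z. indicator \<Omega> z * H z (g z))"
    "energy G \<Omega> (\<lambda>x. u\<^sub>0 x + \<phi> x) = E u g"
proof -
  have \<phi>0: "\<phi> \<in> W11_0 \<Omega>" and \<phi>1: "\<phi> \<in> W11 \<Omega>"
    and fin: "(\<integral>\<^sup>+x. ennreal (H x (weak_gradient \<Omega> \<phi> x)) \<partial>N) < \<infinity>"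
    using assms(1) unfolding double_phase_W_def W11_0_def nn_integral_\<Omega> by auto
  show "global_weak_gradient u g"
    unfolding u_def g_def by (rule W11_0_zero_extension[OF open_\<Omega> \<phi>0])
  have "integrable N (\<lambda>x. H x (weak_gradient \<Omega> \<phi> x))"
  proof (rule integrableI_bounded)
    show "(\<lambda>x. H x (weak_gradient \<Omega> \<phi> x)) \<in> borel_measurable N"
      by (rule H_measurable[OF weak_gradient_integrable(2)[OF \<phi>1]])
    have "(\<integral>\<^sup>+x. ennreal (norm (H x (weak_gradient \<Omega> \<phi> x))) \<partial>N)
        = (\<integral>\<^sup>+x. ennreal (H x (weak_gradient \<Omega> \<phi> x)) \<partial>N)"
      using H_nonneg by (intro nn_integral_cong) auto
    then show "(\<integral>\<^sup>+x. ennreal (norm (H x (weak_gradient \<Omega> \<phi> x))) \<partial>N) < \<infinity>" using fin by simp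
  qed
  then have "integrable lebesgue (\<lambda>x. indicator \<Omega> x *\<^sub>R H x (weak_gradient \<Omega> \<phi> x))"
    using sets_\<Omega> by (subst (asm) integrable_restrict_space) auto
  moreover have eq: "indicator \<Omega> x *\<^sub>R H x (weak_gradient \<Omega> \<phi> x)
      = indicator \<Omega> x * H x (g x)" for x
    by (cases "x \<in> \<Omega>") (simp_all add: g_def)
  ultimately show "integrable lebesgue (\<lambda>z. indicator \<Omega> z * H z (g z))" unfolding eq by simp
  have "energy G \<Omega> (\<lambda>x. u\<^sub>0 x + \<phi> x) = E \<phi> (weak_gradient \<Omega> \<phi>)"
    by (rule energy_eq_E[OF weak_gradient_integrable(1)[OF \<phi>1]])
  also have "\<dots> = E u g"
    unfolding E_def by (intro nn_integral_cong) (auto simp: u_def g_def)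
  finally show "energy G \<Omega> (\<lambda>x. u\<^sub>0 x + \<phi> x) = E u g" .
qed

lemma smooth_inf_le_holder:
  assumes \<phi>: "\<phi> \<in> double_phase_W p q a \<Omega> \<inter> holder_space \<gamma> \<Omega>"
      and \<gamma>: "0 < \<gamma>" "\<kappa> \<ge> (q - p) * (1 - \<gamma>)"
  shows "smooth_inf \<le> energy G \<Omega> (\<lambda>x. u\<^sub>0 x + \<phi> x)"
proof -
  let ?u = "\<lambda>x. indicator \<Omega> x * \<phi> x" and ?g
      = "\<lambda>x. indicator \<Omega> x *\<^sub>R weak_gradient \<Omega> \<phi> x"
  have W: "\<phi> \<in> double_phase_W p q a \<Omega>" using \<phi> by simp
  note ext = double_phase_W_extension[OF W]
  obtain A0 where A0: "\<And>x y. x \<in> \<Omega> \<Longrightarrow> y \<in> \<Omega> \<Longrightarrow>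
      x \<noteq> y \<Longrightarrow> \<bar>\<phi> x - \<phi> y\<bar> / norm (x - y) powr \<gamma> \<le> A0"
    using \<phi> unfolding holder_space_def bdd_above_def by blast
  \<comment> \<open>The bound supplied by \<open>bdd_above\<close> may be negative when \<Omega> has
    no two distinct points to test it; in any case the later estimates use a nonnegative
    constant.\<close>
  define A where "A = max 0 A0"
  have hol: "\<bar>?u x - ?u y\<bar>
      \<le> A * norm (x - y) powr \<gamma>" if "x \<in> \<Omega>" "y \<in> \<Omega>" for x y
  proof (cases "x = y")
    case False
    then have "norm (x - y) powr \<gamma> > 0" by simp
    moreover have "\<bar>\<phi> x - \<phi> y\<bar> / norm (x - y) powr \<gamma> \<le> A" using A0[OF that False]
        by (simp add: A_def)
    ultimately show ?thesis using that by (simp add: pos_divide_le_eq)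
  qed simp
  have A: "A \<ge> 0" by (simp add: A_def)
  have hol': "\<bar>?u x - ?u y\<bar> \<le> A * norm (x - y) powr \<gamma>" for x y
    by (rule holder_zero_extension[OF lipschitz_\<Omega> ext(1) _ hol A \<gamma>(1)]) simp_all
  show ?thesis
    unfolding ext(3) by (rule smooth_inf_le_E[OF ext(1) _ _ hol' A _ \<gamma>(2) ext(2)]) (use \<gamma> in simp_all)
qed

text \<open>Without a modulus of continuity, \<open>\<phi>\<close> is first truncated to the bounded functions
  \<open>k arctan(\<phi>/k)\<close>; bounded functions satisfy the Hoelder condition with exponent \<open>0\<close>.\<close>

lemma smooth_inf_le_W:
  assumes W: "\<phi> \<in> double_phase_W p q a \<Omega>" and \<kappa>q: "\<kappa> \<ge> q - p"
  shows "smooth_inf \<le> energy G \<Omega> (\<lambda>x. u\<^sub>0 x + \<phi> x)"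
proof -
  define u where "u x = indicator \<Omega> x * \<phi> x" for x
  define g where "g x = indicator \<Omega> x *\<^sub>R weak_gradient \<Omega> \<phi> x" for x
  note ext = double_phase_W_extension[OF W, folded u_def g_def]
  have wg: "global_weak_gradient u g" and Mi: "integrable lebesgue (\<lambda>z. indicator \<Omega> z * H z (g z))"
    and en: "energy G \<Omega> (\<lambda>x. u\<^sub>0 x + \<phi> x) = E u g"
    using ext by (simp_all add: u_def[abs_def] g_def[abs_def])
  have u: "integrable lebesgue u" and g: "integrable lebesgue g"
    using wg by (auto simp: global_weak_gradient_def)
  define \<theta> where "\<theta> n t = real (Suc n) * arctan (t / real (Suc n))" for n t
  define \<theta>' where "\<theta>' n t = inverse (1 + (t / real (Suc n))\<^sup>2)" for n and t :: real
  have \<theta>'01: "0 \<le> \<theta>' n t" "\<theta>' n t \<le> 1" for n t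
    by (simp_all add: \<theta>'_def inverse_le_1_iff)
  have wgn: "global_weak_gradient (\<lambda>x. \<theta> n (u x)) (\<lambda>x. \<theta>' n (u x) *\<^sub>R g x)" for n
  proof (rule global_weak_gradient_chain[OF wg, where K = 1])
    fix t
    have "((\<lambda>t. real (Suc n) * arctan (t / real (Suc n))) has_real_derivative
        real (Suc n) * (inverse (1 + (t / real (Suc n))\<^sup>2) * (1 / real (Suc n)))) (at t)"
      by (intro DERIV_cmult DERIV_chain2[OF DERIV_arctan] DERIV_cdivide DERIV_ident)
    then show "(\<theta> n has_real_derivative \<theta>' n t) (at t)" by (simp add: \<theta>_def[abs_def] \<theta>'_def)
    show "\<bar>\<theta>' n t\<bar> \<le> 1" using \<theta>'01[of n t] by simp
  next
    have "1 + (t / real (Suc n))\<^sup>2 \<noteq> 0" for t :: real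
      using zero_le_power2[of "t / real (Suc n)"] by linarith
    then show "continuous_on UNIV (\<theta>' n)" unfolding \<theta>'_def[abs_def] by (intro continuous_intros) auto
    show "\<theta> n 0 = 0" by (simp add: \<theta>_def)
  qed
  have int: "integrable lebesgue (\<lambda>x. \<theta> n (u x))" "integrable lebesgue (\<lambda>x. \<theta>' n (u x) *\<^sub>R g x)" for n
    using wgn[of n] by (auto simp: global_weak_gradient_def)
  \<comment> \<open>The truncation is a contraction, so its gradients are dominated by those of u
    and one fixed majorant suffices in the limit below.\<close>
  have H_le: "H x (\<theta>' n (u x) *\<^sub>R g x) \<le> H x (g x)" if "x \<in> \<Omega>" for n x
  proof -
    have "norm (\<theta>' n (u x) *\<^sub>R g x) \<le> norm (g x)" using \<theta>'01[of n "u x"]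
        by (simp add: mult_left_le_one_le)
    then show ?thesis using p pq by (intro add_mono mult_left_mono powr_mono2 a_nonneg that) auto
  qed
  have "smooth_inf \<le> E (\<lambda>x. \<theta> n (u x)) (\<lambda>x. \<theta>' n (u x) *\<^sub>R g x)" for n
  \<comment> \<open>The oscillation bound grows with n, which is harmless: the inequality with
    \<open>smooth_inf\<close> is complete for each n before n tends to infinity.\<close>
  proof (rule smooth_inf_le_E[OF wgn, where \<gamma> = 0 and A = "real (Suc n) * pi"])
    show "\<theta> n (u x) = 0" "\<theta>' n (u x) *\<^sub>R g x = 0" if "x \<notin> \<Omega>" for x
      using that by (simp_all add: u_def g_def \<theta>_def)
    show "\<bar>\<theta> n (u x) - \<theta> n (u y)\<bar> \<le> real (Suc n) * pi * norm (x - y) powr 0" for x y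
    proof (cases "x = y")
      case False
      have ar: "\<bar>arctan s - arctan t\<bar> \<le> pi" for s t
        using arctan_bounded[of s] arctan_bounded[of t] by linarith
      have "\<theta> n (u x) - \<theta> n (u y)
          = real (Suc n) * (arctan (u x / real (Suc n)) - arctan (u y / real (Suc n)))"
        by (simp add: \<theta>_def right_diff_distrib)
      then have "\<bar>\<theta> n (u x) - \<theta> n (u y)\<bar>
          = real (Suc n) * \<bar>arctan (u x / real (Suc n)) - arctan (u y / real (Suc n))\<bar>"
        by (simp add: abs_mult)
      also have "\<dots> \<le> real (Suc n) * pi" by (intro mult_left_mono ar) simp
      finally show ?thesis using False by simp
    qed simp
    show "integrable lebesgue (\<lambda>z. indicator \<Omega> z * H z (\<theta>' n (u z) *\<^sub>R g z))"
    proof (rule Bochner_Integration.integrable_bound[OF Mi])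
      have "(\<lambda>z. H z (\<theta>' n (u z) *\<^sub>R g z)) \<in> borel_measurable N"
        by (intro H_measurable measurable_N borel_measurable_integrable int)
      then show "(\<lambda>z. indicator \<Omega> z * H z (\<theta>' n (u z) *\<^sub>R g z)) \<in> borel_measurable lebesgue"
        using sets_\<Omega> by (subst (asm) borel_measurable_restrict_space_iff) auto
      show "AE z in lebesgue. norm (indicator \<Omega> z * H z (\<theta>' n (u z) *\<^sub>R g z))
          \<le> norm (indicator \<Omega> z * H z (g z))"
      proof (intro AE_I2)
        fix z show "norm (indicator \<Omega> z * H z (\<theta>' n (u z) *\<^sub>R g z))
            \<le> norm (indicator \<Omega> z * H z (g z))"
          using H_le[of z n] H_nonneg[of z "g z"] H_nonneg[of z "\<theta>' n (u z) *\<^sub>R g z"]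
          by (cases "z \<in> \<Omega>") simp_all
      qed
    qed
  qed (use \<kappa>q in auto)
  then have "smooth_inf \<le> E u g"
  proof (rule E_limit_ge[where D = "\<lambda>n x. indicator \<Omega> x * H x (g x)" and K = 1, rotated -1])
    show "AE x in N. (\<lambda>n. \<theta> n (u x)) \<longlonglongrightarrow> u x"
      unfolding \<theta>_def using arctan_truncation_lim by simp
    show "AE x in N. (\<lambda>n. \<theta>' n (u x) *\<^sub>R g x) \<longlonglongrightarrow> g x"
    proof (intro AE_I2)
      fix x
      have "(\<lambda>n. \<theta>' n (u x) *\<^sub>R g x) \<longlonglongrightarrow> 1 *\<^sub>R g x"
        unfolding \<theta>'_def by (intro tendsto_intros arctan_truncation_deriv_lim)
      then show "(\<lambda>n. \<theta>' n (u x) *\<^sub>R g x) \<longlonglongrightarrow> g x" by simp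
    qed
    show "integrable N (\<lambda>x. indicator \<Omega> x * H x (g x))" by (rule integrable_N[OF Mi])
    show "integrable N (\<lambda>x. indicator \<Omega> x * H x (g x))" by (rule integrable_N[OF Mi])
    show "H x (\<theta>' n (u x) *\<^sub>R g x)
        \<le> 1 * (indicator \<Omega> x * H x (g x))" if "x \<in> \<Omega>" for n x
      using H_le[OF that] that by simp
  qed (use int u g in \<open>auto intro: measurable_N\<close>)
  then show ?thesis unfolding en .
qed

section \<open>Test functions as admissible competitors\<close>

lemma bounded_diameter:
  obtains d where "d > 0" "\<And>x y. x \<in> \<Omega> \<Longrightarrow> y \<in> \<Omega> \<Longrightarrow>
      norm (x - y) \<le> d"
proof -
  obtain B where B: "B > 0" "\<And>x. x \<in> \<Omega> \<Longrightarrow> norm x \<le> B"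
    using bounded_\<Omega> bounded_pos by metis
  show thesis
  proof (rule that[of "2 * B"])
    show "norm (x - y) \<le> 2 * B" if "x \<in> \<Omega>" "y \<in> \<Omega>" for x y
      using B(2)[OF that(1)] B(2)[OF that(2)] norm_triangle_ineq4[of x y] by linarith
  qed (use B in simp)
qed

text \<open>Comparing with one fixed point of the bounded set \<Omega> already bounds the
  weight.\<close>

lemma a_bounded:
  obtains B where "B \<ge> 0" "\<And>x. x \<in> \<Omega> \<Longrightarrow> a x \<le> B"
proof -
  obtain C where C: "C > 0" "\<And>x y. x \<in> \<Omega> \<Longrightarrow> y \<in> \<Omega> \<Longrightarrow>
      a x \<le> C * (a y + norm (x - y) powr \<kappa>)"
    using Z_class_constant by blast
  obtain d where d: "d > 0" "\<And>x y. x \<in> \<Omega> \<Longrightarrow> y \<in> \<Omega> \<Longrightarrow>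
      norm (x - y) \<le> d"
    using bounded_diameter by blast
  obtain y where y: "y \<in> \<Omega>" using nonempty_\<Omega> by blast
  show thesis
  proof (rule that[of "C * (a y + d powr \<kappa>)"])
    show "0 \<le> C * (a y + d powr \<kappa>)" using C a_nonneg[OF y] by simp
    fix x assume x: "x \<in> \<Omega>"
    have "norm (x - y) powr \<kappa> \<le> d powr \<kappa>" using d(2)[OF x y] \<kappa> by (intro powr_mono2) auto
    then have "C * (a y + norm (x - y) powr \<kappa>) \<le> C * (a y + d powr \<kappa>)" using C by simp
    then show "a x \<le> C * (a y + d powr \<kappa>)" using C(2)[OF x y] by linarith
  qed
qed

text \<open>The constant sequence witnesses membership in \<open>W11_0\<close>. The weighted energy
  is finite because gradient and weight are bounded and \<Omega> has finite measure.\<close>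

lemma Cc_infinity_subset_W: "Cc_infinity \<Omega> \<subseteq> double_phase_W p q a \<Omega>"
proof
  fix \<phi> assume \<phi>: "\<phi> \<in> Cc_infinity \<Omega>"
  note wg = Cc_infinity_global_weak_gradient[OF \<phi>]
  have wr: "is_weak_gradient \<Omega> \<phi> (gradient \<phi>)" by (rule global_weak_gradient_restrict[OF wg])
  have int: "integrable lebesgue \<phi>" "integrable lebesgue (gradient \<phi>)"
    using wg by (auto simp: global_weak_gradient_def)
  have W: "\<phi> \<in> W11 \<Omega>"
    unfolding W11_def set_integrable_def
    using wr integrable_mult_indicator[OF sets_\<Omega> int(1)] integrable_mult_indicator[OF sets_\<Omega> int(2)] by blast
  have "W11_norm \<Omega> (\<lambda>x. \<phi> x - \<phi> x) = 0"
  proof -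
    have ae: "AE x in lebesgue. x \<in> \<Omega>
        \<longrightarrow> weak_gradient \<Omega> (\<lambda>x. \<phi> x - \<phi> x) x
            = gradient \<phi> x - gradient \<phi> x"
      by (rule weak_gradient_AE[OF open_\<Omega> is_weak_gradient_diff[OF wr wr]])
    have "(LINT x|lebesgue. indicator \<Omega> x *\<^sub>R norm (weak_gradient \<Omega> (\<lambda>x. \<phi> x - \<phi> x) x)) = 0"
      by (rule integral_eq_zero_AE) (use ae in \<open>eventually_elim, auto simp: indicator_def\<close>)
    then show ?thesis by (simp add: W11_norm_def set_lebesgue_integral_def)
  qed
  then have W0: "\<phi> \<in> W11_0 \<Omega>"
    unfolding W11_0_def using W \<phi> by (auto intro!: exI[of _ "\<lambda>_. \<phi>"])
  have \<phi>U: "\<phi> \<in> Cc_infinity UNIV" by (rule Cc_infinity_mono[OF \<phi> subset_UNIV])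
  obtain l where l: "l \<ge> 0" "\<And>x b. b \<in> Basis \<Longrightarrow>
      \<bar>frechet_derivative \<phi> (at x) b\<bar> \<le> l"
    using Cc_infinity_lipschitz[OF \<phi>U] by metis
  define R where "R = DIM('a) * l"
  have R: "norm (gradient \<phi> x) \<le> R" for x
  proof -
    have "norm (gradient \<phi> x) \<le> (\<Sum>b\<in>Basis. \<bar>gradient \<phi> x \<bullet> b\<bar>)"
        by (rule norm_le_l1)
    also have "\<dots> \<le> (\<Sum>b\<in>(Basis::'a set). l)" using l by (intro sum_mono) (simp add: gradient_inner)
    finally show ?thesis by (simp add: R_def)
  qed
  obtain B where B: "B \<ge> 0" "\<And>x. x \<in> \<Omega> \<Longrightarrow> a x \<le> B" using a_bounded by blast
  have "(\<integral>\<^sup>+x. ennreal (H x (weak_gradient \<Omega> \<phi> x)) \<partial>N)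
      \<le> (\<integral>\<^sup>+x. ennreal (R powr p + B * R powr q) \<partial>N)"
  proof (rule nn_integral_mono_AE)
    have "AE x in lebesgue. x \<in> \<Omega> \<longrightarrow> weak_gradient \<Omega> \<phi> x = gradient \<phi> x"
      by (rule weak_gradient_AE[OF open_\<Omega> wr])
    then show "AE x in N. ennreal (H x (weak_gradient \<Omega> \<phi> x)) \<le> ennreal (R powr p + B * R powr q)"
      unfolding AE_N
    proof eventually_elim
      case (elim x)
      show ?case
      proof
        assume x: "x \<in> \<Omega>"
        have "H x (gradient \<phi> x) \<le> R powr p + B * R powr q"
          using R p pq B x by (intro add_mono mult_mono powr_mono2) auto
        then show "ennreal (H x (weak_gradient \<Omega> \<phi> x)) \<le> ennreal (R powr p + B * R powr q)"
          using elim x by (simp add: ennreal_leI)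
      qed
    qed
  qed
  also have "\<dots> = ennreal (R powr p + B * R powr q) * emeasure lebesgue \<Omega>"
    using sets_\<Omega> by (simp add: emeasure_restrict_space)
  also have "\<dots> < \<infinity>"
  proof -
    have "\<Omega> \<in> lmeasurable" by (rule lmeasurable_open[OF bounded_\<Omega> open_\<Omega>])
    then have "emeasure lebesgue \<Omega> < \<infinity>" by (metis fmeasurableD2 infinity_ennreal_def less_top)
    then show ?thesis by (simp add: ennreal_mult_less_top)
  qed
  finally show "\<phi> \<in> double_phase_W p q a \<Omega>"
    unfolding double_phase_W_def nn_integral_\<Omega> using W0 by simp
qed

text \<open>Of the Lipschitz bound, the power 1 - \<gamma> of the distance is absorbed by the
  diameter of \<Omega>.\<close>

lemma Cc_infinity_subset_holder:
  assumes \<gamma>: "0 < \<gamma>" "\<gamma> \<le> 1"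
  shows "Cc_infinity \<Omega> \<subseteq> holder_space \<gamma> \<Omega>"
proof
  fix \<phi> assume \<phi>: "\<phi> \<in> Cc_infinity \<Omega>"
  obtain l where l: "l \<ge> 0" "\<And>x y. \<bar>\<phi> x - \<phi> y\<bar> \<le> l * norm (x - y)"
    using Cc_infinity_lipschitz[OF Cc_infinity_mono[OF \<phi> subset_UNIV]] by metis
  obtain d where d: "d > 0" "\<And>x y. x \<in> \<Omega> \<Longrightarrow> y \<in> \<Omega> \<Longrightarrow>
      norm (x - y) \<le> d"
    using bounded_diameter by blast
  have "\<bar>\<phi> x - \<phi> y\<bar> / norm (x - y) powr \<gamma>
      \<le> l * d powr (1 - \<gamma>)" if xy: "x \<in> \<Omega>" "y \<in> \<Omega>" "x \<noteq> y" for x y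
  proof -
    have pos: "norm (x - y) > 0" using xy by simp
    have "norm (x - y) = norm (x - y) powr (1 - \<gamma>) * norm (x - y) powr \<gamma>"
      using pos by (simp flip: powr_add)
    also have "\<dots> \<le> d powr (1 - \<gamma>) * norm (x - y) powr \<gamma>"
      using d(2)[OF xy(1,2)] \<gamma> by (intro mult_right_mono powr_mono2) auto
    finally have "l * norm (x - y) \<le> l * (d powr (1 - \<gamma>) * norm (x - y) powr \<gamma>)"
      by (rule mult_left_mono) (rule l)
    then show ?thesis using l(2)[of x y] pos by (simp add: pos_divide_le_eq mult.assoc)
  qed
  then show "\<phi> \<in> holder_space \<gamma> \<Omega>"
    unfolding holder_space_def bdd_above_def by blast
qed

text \<open>Isolates what differs between the two parts: the competitor class S and the lower bound
  for its members.\<close>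

lemma inf_eq_smooth_inf:
  assumes "Cc_infinity \<Omega> \<subseteq> S" "\<And>\<phi>. \<phi> \<in> S \<Longrightarrow> smooth_inf
      \<le> energy G \<Omega> (\<lambda>x. u\<^sub>0 x + \<phi> x)"
  shows "(INF v \<in> translate_set u\<^sub>0 S. energy G \<Omega> v) = smooth_inf"
proof (rule antisym)
  have "translate_set u\<^sub>0 (Cc_infinity \<Omega>) \<subseteq> translate_set u\<^sub>0 S"
    using assms(1) unfolding translate_set_def by blast
  then show "(INF v \<in> translate_set u\<^sub>0 S. energy G \<Omega> v) \<le> smooth_inf"
    by (intro INF_superset_mono) auto
  show "smooth_inf \<le> (INF v \<in> translate_set u\<^sub>0 S. energy G \<Omega> v)"
    using assms(2) unfolding translate_set_def by (intro INF_greatest) blast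
qed

end

theorem theorem5:
  fixes \<Omega> :: "(real ^ 'n) set"
    and p q \<kappa> \<nu> L :: real
    and a \<Lambda> u\<^sub>0 :: "real ^ 'n \<Rightarrow> real"
    and G :: "real ^ 'n \<Rightarrow> real \<Rightarrow> real ^ 'n \<Rightarrow> real"
  assumes "bounded \<Omega>" and "lipschitz_domain \<Omega>"
    and "1 < p" and "p < q" and "0 < \<kappa>"
    and "a \<in> Z_class \<kappa> \<Omega>"
    and "\<And>z \<xi>. (\<lambda>x. G x z \<xi>) \<in> borel_measurable (lebesgue_on \<Omega>)"
    and "\<And>x. x \<in> \<Omega> \<Longrightarrow> continuous_on UNIV (\<lambda>(z, \<xi>). G x z \<xi>)"
    and "0 < \<nu>" and "\<nu> < 1" and "1 < L"
    and "\<Lambda> absolutely_integrable_on \<Omega>" and "\<And>x. x \<in> \<Omega> \<Longrightarrow> 0 \<le> \<Lambda> x"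
    and "\<And>x z \<xi>. x \<in> \<Omega> \<Longrightarrow> \<nu> * (norm \<xi> powr p + a x * norm \<xi> powr q) \<le> G x z \<xi>"
    and "\<And>x z \<xi>. x \<in> \<Omega> \<Longrightarrow> G x z \<xi> \<le> L * (norm \<xi> powr p + a x * norm \<xi> powr q + \<Lambda> x)"
    and "u\<^sub>0 \<in> W11 \<Omega>" and "energy G \<Omega> u\<^sub>0 < \<infinity>"
  shows "(\<kappa> \<ge> q - p \<longrightarrow>
            (INF v \<in> translate_set u\<^sub>0 (double_phase_W p q a \<Omega>). energy G \<Omega> v) =
            (INF w \<in> translate_set u\<^sub>0 (Cc_infinity \<Omega>). energy G \<Omega> w))
       \<and> (\<forall>\<gamma>. 0 < \<gamma> \<and> \<gamma> \<le> 1 \<and> \<kappa> \<ge> (q - p) * (1 - \<gamma>) \<longrightarrow>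
            (INF v \<in> translate_set u\<^sub>0 (double_phase_W p q a \<Omega> \<inter> holder_space \<gamma> \<Omega>). energy G \<Omega> v) =
            (INF w \<in> translate_set u\<^sub>0 (Cc_infinity \<Omega>). energy G \<Omega> w))"
proof -
  interpret double_phase \<Omega> p q \<kappa> \<nu> L a \<Lambda> u\<^sub>0 G
    by unfold_locales (use assms in auto)
  show ?thesis
  proof (intro conjI impI allI)
    assume "\<kappa> \<ge> q - p"
    then show "(INF v \<in> translate_set u\<^sub>0 (double_phase_W p q a \<Omega>). energy G \<Omega> v) = smooth_inf"
      by (intro inf_eq_smooth_inf Cc_infinity_subset_W smooth_inf_le_W)
  next
    fix \<gamma> :: real assume "0 < \<gamma> \<and> \<gamma> \<le> 1 \<and> \<kappa> \<ge> (q - p) * (1 - \<gamma>)"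
    then show "(INF v \<in> translate_set u\<^sub>0 (double_phase_W p q a \<Omega> \<inter> holder_space \<gamma> \<Omega>). energy G \<Omega> v) = smooth_inf"
      using Cc_infinity_subset_W Cc_infinity_subset_holder[of \<gamma>]
      by (intro inf_eq_smooth_inf smooth_inf_le_holder) auto
  qed
qed

end
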